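(* Let $\{B_t, t\geq 0\}$ be a standard Brownian motion on $\mathbb R$, let $\lambda>0$, and let $\{S_t, t\geq 0\}$ be a symmetric $\alpha$-stable Lévy process on $\mathbb R$ with $0<\alpha\leq 2$, independent of $\{B_t\}$. Let $$Z=\int_0^{\infty-}e^{-(B_s+\lambda s)}\,dS_s .$$ Then $Z$ is of type $G$, and furthermore the mixing distribution for variance, $\mathcal L(V)$, is not only infinitely divisible but also selfdecomposable; that is, $Z$ has the same law as $V^{1/2}W$, where $W$ is a standard normal random variable and $V$ is a nonnegative random variable independent of $W$ whose law $\mathcal L(V)$ is selfdecomposable.
   Context: $\mathcal L(\cdot)$ denotes the law of a random variable. The improper stochastic integral is $\int_0^{\infty-}e^{-(B_s+\lambda s)}dS_s=\lim_{t\to\infty}\int_0^te^{-(B_s+\lambda s)}dS_s$, which exists and is finite a.s. under the stated hypotheses. The process $\{S_t\}$ satisfies $Ee^{izS_t}=\exp(-ct|z|^\alpha)$, $z\in\mathbb R$, for some constant $c>0$. A real random variable $Z$ is of type $G$ if $Z$ has the same law as $V^{1/2}W$ for some nonnegative infinitely divisible random variable $V$ and a standard normal random variable $W$ independent of each other; in this case $\mathcal L(V)$ (the mixing distribution for variance) is uniquely determined by $\mathcal L(Z)$. A distribution $\mu$ on $\mathbb R$ with characteristic function $\widehat\mu$ is selfdecomposable if for every $b\in(0,1)$ there is a distribution $\rho_b$ on $\mathbb R$ such that $\widehat\mu(z)=\widehat\mu(bz)\widehat\rho_b(z)$ for all $z\in\mathbb R$. *)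

theory Defs
  imports "HOL-Probability.Probability"
begin

text \<open>Real-valued processes are functions \<open>real \<Rightarrow> 'a \<Rightarrow> real\<close>. Only the times \<open>t \<ge> 0\<close> matter, and
  all conditions are restricted to them.\<close>

section \<open>Brownian motion and stable processes\<close>

definition cadlag :: "(real \<Rightarrow> real) \<Rightarrow> bool" where
  "cadlag f \<longleftrightarrow> (\<forall>t\<ge>0. continuous (at_right t) f) \<and> (\<forall>t>0. \<exists>l. (f \<longlongrightarrow> l) (at_left t))"

definition independent_increments :: "'a measure \<Rightarrow> (real \<Rightarrow> 'a \<Rightarrow> real) \<Rightarrow> bool" where
  "independent_increments M X \<longleftrightarrow>
     (\<forall>(n::nat) t. 0 \<le> t 0 \<and> (\<forall>i<n. t i < t (Suc i)) \<longrightarrow>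
        prob_space.indep_vars M (\<lambda>_. borel) (\<lambda>i \<omega>. X (t (Suc i)) \<omega> - X (t i) \<omega>) {..<n})"

definition stationary_increments :: "'a measure \<Rightarrow> (real \<Rightarrow> 'a \<Rightarrow> real) \<Rightarrow> bool" where
  "stationary_increments M X \<longleftrightarrow>
     (\<forall>s\<ge>0. \<forall>t\<ge>0. distr M borel (\<lambda>\<omega>. X (s + t) \<omega> - X s \<omega>) = distr M borel (\<lambda>\<omega>. X t \<omega> - X 0 \<omega>))"

definition stochastically_continuous :: "'a measure \<Rightarrow> (real \<Rightarrow> 'a \<Rightarrow> real) \<Rightarrow> bool" where
  "stochastically_continuous M X \<longleftrightarrow>
     (\<forall>t\<ge>0. \<forall>\<epsilon>>0. ((\<lambda>s. measure M {\<omega>\<in>space M. \<bar>X s \<omega> - X t \<omega>\<bar> > \<epsilon>}) \<longlongrightarrow> 0) (at t within {0..}))"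

definition standard_brownian_motion :: "'a measure \<Rightarrow> (real \<Rightarrow> 'a \<Rightarrow> real) \<Rightarrow> bool" where
  "standard_brownian_motion M B \<longleftrightarrow>
     (\<forall>t\<ge>0. B t \<in> borel_measurable M) \<and>
     (AE \<omega> in M. B 0 \<omega> = 0) \<and>
     independent_increments M B \<and>
     (\<forall>s\<ge>0. \<forall>t>s. distributed M lborel (\<lambda>\<omega>. B t \<omega> - B s \<omega>) (normal_density 0 (sqrt (t - s)))) \<and>
     (AE \<omega> in M. continuous_on {0..} (\<lambda>t. B t \<omega>))"

definition levy_process :: "'a measure \<Rightarrow> (real \<Rightarrow> 'a \<Rightarrow> real) \<Rightarrow> bool" where
  "levy_process M X \<longleftrightarrow>
     (\<forall>t\<ge>0. X t \<in> borel_measurable M) \<and>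
     (AE \<omega> in M. X 0 \<omega> = 0) \<and>
     independent_increments M X \<and>
     stationary_increments M X \<and>
     stochastically_continuous M X \<and>
     (AE \<omega> in M. cadlag (\<lambda>t. X t \<omega>))"

definition symmetric_stable_levy_process :: "'a measure \<Rightarrow> real \<Rightarrow> (real \<Rightarrow> 'a \<Rightarrow> real) \<Rightarrow> bool" where
  "symmetric_stable_levy_process M \<alpha> S \<longleftrightarrow>
     levy_process M S \<and>
     (\<exists>c>0. \<forall>t\<ge>0. \<forall>z.
        char (distr M borel (S t)) z = complex_of_real (exp (- (c * t * \<bar>z\<bar> powr \<alpha>))))"

definition independent_processes ::
  "'a measure \<Rightarrow> (real \<Rightarrow> 'a \<Rightarrow> real) \<Rightarrow> (real \<Rightarrow> 'a \<Rightarrow> real) \<Rightarrow> bool" where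
  "independent_processes M X Y \<longleftrightarrow>
     prob_space.indep_var M
       (Pi\<^sub>M {0..} (\<lambda>_. borel)) (\<lambda>\<omega>. \<lambda>t\<in>{0..}. X t \<omega>)
       (Pi\<^sub>M {0..} (\<lambda>_. borel)) (\<lambda>\<omega>. \<lambda>t\<in>{0..}. Y t \<omega>)"

section \<open>The stochastic integral\<close>

definition joint_natural_filtration ::
  "'a measure \<Rightarrow> (real \<Rightarrow> 'a \<Rightarrow> real) \<Rightarrow> (real \<Rightarrow> 'a \<Rightarrow> real) \<Rightarrow> real \<Rightarrow> 'a measure" where
  "joint_natural_filtration M X Y t =
     sigma (space M)
       ({X s -` A \<inter> space M | s A. s \<in> {0..t} \<and> A \<in> sets borel} \<union>
        {Y s -` A \<inter> space M | s A. s \<in> {0..t} \<and> A \<in> sets borel})"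

text \<open>Convergence uniformly on compacts in probability (ucp). The exceptional event is only required
  to be covered by measurable sets of small probability: without completeness of the measure, the
  event itself may fail to be measurable (paths are regular only almost surely), and
  \<^const>\<open>measure\<close> would then give it the junk value \<open>0\<close>. When the event is measurable, this is the
  usual convergence in probability of the supremum over \<open>[0,t]\<close>.\<close>

definition ucp_tendsto ::
  "'a measure \<Rightarrow> (nat \<Rightarrow> real \<Rightarrow> 'a \<Rightarrow> real) \<Rightarrow> (real \<Rightarrow> 'a \<Rightarrow> real) \<Rightarrow> bool" where
  "ucp_tendsto M X Y \<longleftrightarrow>
     (\<forall>t\<ge>0. \<forall>\<epsilon>>0. \<forall>\<delta>>0. \<forall>\<^sub>F k in sequentially.
        \<exists>A\<in>sets M. measure M A < \<delta> \<and>
          {\<omega>\<in>space M. \<exists>s\<in>{0..t}. \<bar>X k s \<omega> - Y s \<omega>\<bar> > \<epsilon>} \<subseteq> A)"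

text \<open>A simple predictable process is
  \<open>h\<^sub>* 1\<^bsub>{0}\<^esub> + (\<Sum>i<n. h i 1\<^bsub>(T i, T (i+1)]\<^esub>)\<close> with finite stopping times
  \<open>0 = T 0 \<le> \<dots> \<le> T n\<close>, \<open>h\<^sub>*\<close> measurable at time \<open>0\<close> and \<open>h i\<close> measurable at time \<open>T i\<close>.
  Its integral over \<open>(0,t]\<close> is elementary and does not involve \<open>h\<^sub>*\<close>.\<close>

definition simple_predictable ::
  "'a measure \<Rightarrow> (real \<Rightarrow> 'a measure) \<Rightarrow> nat \<Rightarrow> (nat \<Rightarrow> 'a \<Rightarrow> real) \<Rightarrow> ('a \<Rightarrow> real) \<Rightarrow> (nat \<Rightarrow> 'a \<Rightarrow> real) \<Rightarrow> bool" where
  "simple_predictable M F n T h0 h \<longleftrightarrow>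
     (\<forall>i\<le>n. stopping_time F (T i)) \<and>
     (\<forall>\<omega>\<in>space M. T 0 \<omega> = 0 \<and> (\<forall>i<n. T i \<omega> \<le> T (Suc i) \<omega>)) \<and>
     h0 \<in> borel_measurable (F 0) \<and>
     (\<forall>i<n. h i \<in> borel_measurable (filtration.pre_sigma (space M) F (T i)))"

definition simple_process ::
  "nat \<Rightarrow> (nat \<Rightarrow> 'a \<Rightarrow> real) \<Rightarrow> ('a \<Rightarrow> real) \<Rightarrow> (nat \<Rightarrow> 'a \<Rightarrow> real) \<Rightarrow> real \<Rightarrow> 'a \<Rightarrow> real" where
  "simple_process n T h0 h t \<omega> =
     h0 \<omega> * indicator {0} t + (\<Sum>i<n. h i \<omega> * indicator {T i \<omega><..T (Suc i) \<omega>} t)"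

definition simple_integral ::
  "nat \<Rightarrow> (nat \<Rightarrow> 'a \<Rightarrow> real) \<Rightarrow> (nat \<Rightarrow> 'a \<Rightarrow> real) \<Rightarrow> (real \<Rightarrow> 'a \<Rightarrow> real) \<Rightarrow> real \<Rightarrow> 'a \<Rightarrow> real" where
  "simple_integral n T h S t \<omega> =
     (\<Sum>i<n. h i \<omega> * (S (min (T (Suc i) \<omega>) t) \<omega> - S (min (T i \<omega>) t) \<omega>))"

text \<open>\<open>has_stochastic_integral M F X S Y\<close>: \<open>Y\<close> is a cadlag version of the process
  \<open>t \<mapsto> \<integral>\<^sub>0\<^sup>t X\<^sub>s dS\<^sub>s\<close>, defined (as for left-continuous integrands and a semimartingale \<open>S\<close>) as the
  extension of the elementary integral by ucp limits. The existence clause excludes integrands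
  that are not ucp limits of simple predictable processes; adapted left-continuous processes with
  right limits always are.\<close>

definition has_stochastic_integral ::
  "'a measure \<Rightarrow> (real \<Rightarrow> 'a measure) \<Rightarrow> (real \<Rightarrow> 'a \<Rightarrow> real) \<Rightarrow> (real \<Rightarrow> 'a \<Rightarrow> real) \<Rightarrow> (real \<Rightarrow> 'a \<Rightarrow> real) \<Rightarrow> bool" where
  "has_stochastic_integral M F X S Y \<longleftrightarrow>
     (\<forall>t\<ge>0. Y t \<in> borel_measurable M) \<and>
     (AE \<omega> in M. cadlag (\<lambda>t. Y t \<omega>)) \<and>
     (\<exists>n T h0 h. (\<forall>k. simple_predictable M F (n k) (T k) (h0 k) (h k)) \<and>
        ucp_tendsto M (\<lambda>k. simple_process (n k) (T k) (h0 k) (h k)) X) \<and>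
     (\<forall>n T h0 h. (\<forall>k. simple_predictable M F (n k) (T k) (h0 k) (h k)) \<and>
        ucp_tendsto M (\<lambda>k. simple_process (n k) (T k) (h0 k) (h k)) X \<longrightarrow>
        ucp_tendsto M (\<lambda>k. simple_integral (n k) (T k) (h k) S) Y)"

definition has_improper_stochastic_integral ::
  "'a measure \<Rightarrow> (real \<Rightarrow> 'a measure) \<Rightarrow> (real \<Rightarrow> 'a \<Rightarrow> real) \<Rightarrow> (real \<Rightarrow> 'a \<Rightarrow> real) \<Rightarrow> ('a \<Rightarrow> real) \<Rightarrow> bool" where
  "has_improper_stochastic_integral M F X S Z \<longleftrightarrow>
     Z \<in> borel_measurable M \<and>
     (\<exists>Y. has_stochastic_integral M F X S Y \<and> (AE \<omega> in M. ((\<lambda>t. Y t \<omega>) \<longlongrightarrow> Z \<omega>) at_top))"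

section \<open>Infinite divisibility, selfdecomposability, type G\<close>

definition infinitely_divisible :: "real measure \<Rightarrow> bool" where
  "infinitely_divisible \<mu> \<longleftrightarrow>
     real_distribution \<mu> \<and>
     (\<forall>n\<ge>1. \<exists>\<rho>. real_distribution \<rho> \<and> \<mu> = ((\<lambda>\<sigma>. \<rho> \<star> \<sigma>) ^^ n) (return borel 0))"

definition selfdecomposable :: "real measure \<Rightarrow> bool" where
  "selfdecomposable \<mu> \<longleftrightarrow>
     real_distribution \<mu> \<and>
     (\<forall>b\<in>{0<..<1}. \<exists>\<rho>. real_distribution \<rho> \<and> (\<forall>z. char \<mu> z = char \<mu> (b * z) * char \<rho> z))"

text \<open>\<open>\<mu>\<close> is the law of \<open>V\<^bsup>1/2\<^esup> W\<close> with \<open>V \<ge> 0\<close> of law \<open>\<nu>\<close> and \<open>W\<close> standard normal, independent.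
  Taking the underlying sample space to be \<open>real \<times> real\<close> loses no generality, since only the joint
  law of \<open>(V, W)\<close> matters.\<close>

definition variance_mixing_distribution :: "real measure \<Rightarrow> real measure \<Rightarrow> bool" where
  "variance_mixing_distribution \<mu> \<nu> \<longleftrightarrow>
     (\<exists>(P :: (real \<times> real) measure) V W.
        prob_space P \<and>
        prob_space.indep_var P borel V borel W \<and>
        (\<forall>\<omega>\<in>space P. 0 \<le> V \<omega>) \<and>
        distr P borel V = \<nu> \<and>
        distributed P lborel W std_normal_density \<and>
        distr P borel (\<lambda>\<omega>. sqrt (V \<omega>) * W \<omega>) = \<mu>)"

definition type_G :: "real measure \<Rightarrow> bool" where
  "type_G \<mu> \<longleftrightarrow> (\<exists>\<nu>. variance_mixing_distribution \<mu> \<nu> \<and> infinitely_divisible \<nu>)"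

end

theory Submission
  imports Defs "HOL-Real_Asymp.Real_Asymp"
begin

text \<open>Given \<open>B\<close>, the integral \<open>Z\<close> is symmetric stable, and \<open>E exp (i z Z) = L (c |z|\<^sup>\<alpha>)\<close>, where \<open>L\<close> is the
  Laplace transform of the exponential functional \<open>A = \<integral> exp (- \<alpha> (B\<^sub>s + \<lambda> s)) ds\<close> over \<open>[0,\<infinity>)\<close>. Hence
  \<open>Z\<close> is a normal variance mixture with \<open>V\<close> a multiple of \<open>A\<close> to the power \<open>2/\<alpha>\<close> times an independent
  positive \<open>\<alpha>/2\<close>-stable variable, and the Laplace transform of \<open>V\<close> at \<open>u\<close> is \<open>L (k u\<^sup>\<beta>)\<close>
  with \<open>\<beta> = \<alpha>/2\<close>. Since \<open>B\<^sub>s + \<lambda> s\<close> has no upward jumps, the strong Markov property at the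
  first passage over a level \<open>a\<close> shows that \<open>A\<close> is distributed as \<open>C + exp (- \<alpha> a) A'\<close> with \<open>A'\<close> an
  independent copy of \<open>A\<close>; thus \<open>A\<close> is selfdecomposable, and so is \<open>V\<close>. The strong Markov
  property is only applied to the random walks obtained by sampling at dyadic times, whose
  overshoot vanishes in the limit. Infinite divisibility of \<open>V\<close> follows from
  selfdecomposability.

  The functional \<open>A\<close> itself never appears: \<open>L\<close> is read off from the characteristic function of
  \<open>Z\<close>, and it is a limit of Laplace transforms of Riemann sums because the elementary
  integrals converge. Finiteness of \<open>A\<close> (equivalently \<open>L\<close> tending to \<open>1\<close> at \<open>0\<close>) is thus a
  consequence of the existence of \<open>Z\<close>; it also forces the walks to pass every level.\<close>

section \<open>Laplace transforms of laws on the half-line\<close>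

text \<open>The argument works with functions: \<open>is_laplace\<close> is closed under products,
  mixtures, scaling and, given the limit 1 at 0, pointwise limits. The components of the
  decompositions are therefore obtained as limits of explicit transforms and need not be built as
  random variables. Laplace transforms never vanish, so \<open>L u / L (b * u)\<close> always makes
  sense; the identity of characteristic functions follows afterwards from uniqueness of laws on the
  half-line. The quotient arises, with \<open>a = - ln b / \<alpha>\<close>, as the limit of the
  transforms of Riemann sums stopped at the first passage over \<open>a\<close>. A walk overshoots
  by at least 0 and, off a rare event, by at most \<open>\<epsilon>\<close>, so the strong Markov
  identity turns into two inequalities, one with the factor \<open>exp (- (\<alpha> * a))\<close>,
  one with \<open>exp (- (\<alpha> * (a + \<epsilon>)))\<close>. The mesh tends to 0 first and the
  time horizon to infinity only then, since the elementary integrals converge on compact time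
  intervals. Paths are regular only almost surely and the measure may be incomplete, so path events
  are tested at rational times.\<close>

definition nonneg_law :: "real measure \<Rightarrow> bool" where
  "nonneg_law \<mu> \<longleftrightarrow> real_distribution \<mu> \<and> (AE x in \<mu>. 0 \<le> x)"

definition laplace :: "real measure \<Rightarrow> real \<Rightarrow> real" where
  "laplace \<mu> u = (LINT x|\<mu>. exp (- (u * x)))"

text \<open>Agreement is demanded only for \<open>u > 0\<close>, so formulas with
  \<open>powr\<close> or quotients may take any value elsewhere. The value 1 at 0 survives as the
  one-sided limit \<open>is_laplace_at_0\<close>.\<close>

definition is_laplace :: "(real \<Rightarrow> real) \<Rightarrow> bool" where
  "is_laplace \<phi> \<longleftrightarrow> (\<exists>\<mu>. nonneg_law \<mu> \<and> (\<forall>u>0. \<phi> u = laplace \<mu> u))"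

lemma (in prob_space) integrable_laplace:
  assumes "X \<in> borel_measurable M" "AE x in M. 0 \<le> X x" "0 \<le> (u::real)"
  shows "integrable M (\<lambda>x. exp (- (u * X x)))"
  by (rule integrable_const_bound[where B = 1]) (use assms in auto)

lemma laplace_integrable: "nonneg_law \<mu> \<Longrightarrow> 0 \<le> u \<Longrightarrow> integrable \<mu> (\<lambda>x. exp (- (u * x)))"
  unfolding nonneg_law_def
  by (intro prob_space.integrable_laplace) (auto simp: real_distribution_def real_distribution_axioms_def measurable_def)

lemma nonneg_law_distr:
  assumes "prob_space M" "X \<in> borel_measurable M" "AE x in M. 0 \<le> X x"
  shows "nonneg_law (distr M borel X)"
  using assms by (auto simp: nonneg_law_def AE_distr_iff prob_space.real_distribution_distr)

lemma laplace_distr: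
  "X \<in> borel_measurable M \<Longrightarrow> laplace (distr M borel X) u = (LINT x|M. exp (- (u * X x)))"
  by (simp add: laplace_def integral_distr)

lemma is_laplaceI:
  assumes "prob_space M" "X \<in> borel_measurable M" "AE x in M. 0 \<le> X x"
    and "\<And>u. 0 < u \<Longrightarrow> \<phi> u = (LINT x|M. exp (- (u * X x)))"
  shows "is_laplace \<phi>"
  unfolding is_laplace_def
  by (intro exI[of _ "distr M borel X"]) (use assms nonneg_law_distr in \<open>auto simp: laplace_distr\<close>)

lemma laplace_pos:
  assumes "nonneg_law \<mu>" "0 \<le> u" shows "0 < laplace \<mu> u"
proof -
  interpret real_distribution \<mu> using assms by (simp add: nonneg_law_def)
  have "0 \<le> laplace \<mu> u" unfolding laplace_def by simp
  moreover have "laplace \<mu> u \<noteq> 0"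
  proof
    assume "laplace \<mu> u = 0"
    then have "AE x in \<mu>. exp (- (u * x)) = 0"
      unfolding laplace_def using integral_nonneg_eq_0_iff_AE[OF laplace_integrable[OF assms]] by simp
    then show False by simp
  qed
  ultimately show ?thesis by simp
qed

lemma laplace_antimono:
  assumes "nonneg_law \<mu>" "0 \<le> u" "u \<le> v" shows "laplace \<mu> v \<le> laplace \<mu> u"
  unfolding laplace_def using assms
  by (intro integral_mono_AE laplace_integrable) (auto simp: nonneg_law_def intro: mult_right_mono elim!: eventually_mono)

lemma laplace_0: "nonneg_law \<mu> \<Longrightarrow> laplace \<mu> 0 = 1"
proof -
  assume "nonneg_law \<mu>"
  then interpret real_distribution \<mu> by (simp add: nonneg_law_def)
  show ?thesis by (simp add: laplace_def del: space_eq_univ add: prob_space)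
qed

lemma laplace_le_1: "nonneg_law \<mu> \<Longrightarrow> 0 \<le> u \<Longrightarrow> laplace \<mu> u \<le> 1"
  using laplace_antimono[of \<mu> 0 u] by (simp add: laplace_0)

lemma laplace_tendsto:
  assumes "nonneg_law \<mu>" "s \<longlonglongrightarrow> u" "\<And>n. 0 \<le> s n"
  shows "(\<lambda>n. laplace \<mu> (s n)) \<longlonglongrightarrow> laplace \<mu> u"
proof -
  interpret real_distribution \<mu> using assms by (simp add: nonneg_law_def)
  show ?thesis unfolding laplace_def
  proof (rule integral_dominated_convergence[where w = "\<lambda>_. 1"])
    show "AE x in \<mu>. (\<lambda>n. exp (- (s n * x))) \<longlonglongrightarrow> exp (- (u * x))"
      using assms(2) by (auto intro!: AE_I2 tendsto_intros)
    show "AE x in \<mu>. norm (exp (- (s n * x))) \<le> 1" for n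
      using assms(1,3) by (auto simp: nonneg_law_def)
  qed auto
qed

text \<open>The image under \<open>exp (- x)\<close> is a law on (0,1] whose moments are the Laplace
  transform at the natural numbers. As it is bounded, its characteristic function is the power
  series in these moments; Levy uniqueness applies, and \<open>- ln y\<close> transports the
  equality back.\<close>

lemma laplace_unique:
  assumes "nonneg_law \<mu>" "nonneg_law \<nu>" and eq: "\<And>u. 0 < u \<Longrightarrow> laplace \<mu> u = laplace \<nu> u"
  shows "\<mu> = \<nu>"
proof -
  have chr: "(\<lambda>k. ((\<i> * t) ^ k / fact k) * of_real (laplace \<mu> (real k))) sums char (distr \<mu> borel (\<lambda>x. exp (- x))) t"
    if mu: "nonneg_law \<mu>" for \<mu> t
  proof -
    interpret real_distribution \<mu> using mu by (simp add: nonneg_law_def)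
    define f where "f k x = ((\<i> * t) ^ k / fact k) * complex_of_real (exp (- (real k * x)))" for k :: nat and x :: real
    have fsums: "(\<lambda>k. f k x) sums iexp (t * exp (- x))" for x
    proof -
      have "f k x = (\<i> * (t * exp (- x))) ^ k /\<^sub>R fact k" for k
        by (simp add: f_def power_mult_distrib scaleR_conv_of_real exp_of_nat_mult [symmetric] divide_simps flip: of_real_power)
      then show ?thesis using exp_converges[of "\<i> * (t * exp (- x))"] by simp
    qed
    have nrm: "norm (f k x) \<le> \<bar>t\<bar> ^ k / fact k" if "0 \<le> x" for k x
      using that by (simp add: f_def norm_mult norm_power norm_divide divide_right_mono mult_left_le)
    have int: "integrable \<mu> (f k)" for k
      unfolding f_def
      by (intro integrable_mult_right integrable_of_real laplace_integrable[OF mu]) auto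
    have sm: "summable (\<lambda>k. \<bar>t\<bar> ^ k / fact k)"
      using summable_exp[of "\<bar>t\<bar>"] by (simp add: field_simps)
    have ae: "AE x in \<mu>. 0 \<le> x" using mu by (simp add: nonneg_law_def)
    have "(\<lambda>k. integral\<^sup>L \<mu> (f k)) sums (LINT x|\<mu>. (\<Sum>k. f k x))"
    proof (rule sums_integral[OF int])
      show "AE x in \<mu>. summable (\<lambda>i. norm (f i x))"
        using ae by (rule eventually_mono) (rule summable_comparison_test'[OF sm], simp add: nrm)
      show "summable (\<lambda>i. LINT x|\<mu>. norm (f i x))"
      proof (rule summable_comparison_test'[OF sm])
        fix n :: nat
        have "(LINT x|\<mu>. norm (f n x)) \<le> \<bar>t\<bar> ^ n / fact n"
          by (rule integral_le_const) (use int ae nrm in auto)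
        then show "norm (LINT x|\<mu>. norm (f n x)) \<le> \<bar>t\<bar> ^ n / fact n" by simp
      qed
    qed
    moreover have "integral\<^sup>L \<mu> (f k) = ((\<i> * t) ^ k / fact k) * of_real (laplace \<mu> (real k))" for k
      unfolding f_def laplace_def by simp
    moreover have "(LINT x|\<mu>. (\<Sum>k. f k x)) = char (distr \<mu> borel (\<lambda>x. exp (- x))) t"
      using fsums by (simp add: char_def integral_distr sums_iff)
    ultimately show ?thesis by simp
  qed
  interpret m: real_distribution \<mu> using assms by (simp add: nonneg_law_def)
  interpret n: real_distribution \<nu> using assms by (simp add: nonneg_law_def)
  have eq0: "laplace \<mu> (real k) = laplace \<nu> (real k)" for k
    using eq[of "real k"] laplace_0 assms by (cases "k = 0") auto
  have "char (distr \<mu> borel (\<lambda>x. exp (- x))) t = char (distr \<nu> borel (\<lambda>x. exp (- x))) t" for t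
    using chr[OF assms(1), of t] chr[OF assms(2), of t] unfolding eq0 by (rule sums_unique2)
  then have "distr \<mu> borel (\<lambda>x. exp (- x)) = distr \<nu> borel (\<lambda>x. exp (- x))"
    by (intro Levy_uniqueness) (auto intro!: m.real_distribution_distr n.real_distribution_distr)
  then have "distr (distr \<mu> borel (\<lambda>x. exp (- x))) borel (\<lambda>y. - ln y) = distr (distr \<nu> borel (\<lambda>x. exp (- x))) borel (\<lambda>y. - ln y)"
    by simp
  then show ?thesis by (simp add: distr_distr comp_def distr_id2)
qed

text \<open>The laws are transported to \<open>[0,1]\<close> by \<open>x \<mapsto> exp (- x)\<close>, where tightness is automatic; mass
  escaping to infinity would show up as an atom at \<open>0\<close>, which the behaviour of \<open>\<phi>\<close> at \<open>0\<close> excludes.\<close>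

lemma laplace_continuity:
  assumes mu: "\<And>n. nonneg_law (\<mu> n)"
    and lim: "\<And>u. 0 < u \<Longrightarrow> (\<lambda>n. laplace (\<mu> n) u) \<longlonglongrightarrow> \<phi> u"
    and phi0: "(\<lambda>k. \<phi> (1 / real (Suc k))) \<longlonglongrightarrow> 1"
  shows "is_laplace \<phi>"
proof -
  interpret m: real_distribution "\<mu> n" for n using mu by (simp add: nonneg_law_def)
  define m' where "m' n = distr (\<mu> n) borel (\<lambda>x. exp (- x))" for n
  have rd: "real_distribution (m' n)" for n unfolding m'_def by (rule m.real_distribution_distr) simp
  have AE1: "AE y in m' n. 0 < y \<and> y \<le> 1" for n
    using mu[of n] unfolding m'_def by (subst AE_distr_iff) (auto simp: nonneg_law_def)
  have tight: "tight m'"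
    unfolding tight_def
  proof (intro conjI allI impI)
    fix e :: real assume "0 < e"
    have "measure (m' n) {-1<..1} = 1" for n
    proof -
      interpret real_distribution "m' n" by (rule rd)
      show ?thesis using AE1[of n] by (subst prob_eq_1) (auto elim!: eventually_mono)
    qed
    then show "\<exists>a b. a < b \<and> (\<forall>n. 1 - e < measure (m' n) {a<..b})"
      using \<open>0 < e\<close> by (intro exI[of _ "-1"] exI[of _ 1]) auto
  qed (rule rd)
  obtain r \<pi> where r: "strict_mono r" "real_distribution \<pi>" "weak_conv_m (m' \<circ> id \<circ> r) \<pi>"
    using tight_imp_convergent_subsubsequence[OF tight strict_mono_id] by blast
  interpret p: real_distribution \<pi> by fact
  \<comment> \<open>The power \<open>y powr u\<close>, truncated to be continuous and bounded on the
    whole line as weak convergence requires. It vanishes at 0, so it ignores a possible atom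
    there.\<close>
  define g where "g u y = max 0 (min 1 y) powr u" for u y :: real
  have gcont: "isCont (g u) y" if "0 < u" for u y
  proof -
    have "continuous_on UNIV (g u)"
      unfolding g_def using that by (intro continuous_on_powr' continuous_intros) auto
    then show ?thesis by (simp add: continuous_on_eq_continuous_at)
  qed
  have gmeas[measurable]: "g u \<in> borel_measurable borel" for u unfolding g_def by measurable
  have gbd: "norm (g u y) \<le> 1" if "0 < u" for u y unfolding g_def using that by (auto intro!: powr_le1)
  have gint: "integral\<^sup>L \<pi> (g u) = \<phi> u" if u: "0 < u" for u
  proof -
    have "(\<lambda>n. integral\<^sup>L ((m' \<circ> id \<circ> r) n) (g u)) \<longlonglongrightarrow> integral\<^sup>L \<pi> (g u)"
      by (rule weak_conv_imp_integral_bdd_continuous_conv[OF _ _ r(3)])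
        (use rd r gcont[OF u] gbd[OF u] in auto)
    moreover have "integral\<^sup>L (m' n) (g u) = laplace (\<mu> n) u" for n
    proof -
      have "integral\<^sup>L (m' n) (g u) = (LINT x|\<mu> n. g u (exp (- x)))"
        unfolding m'_def by (rule integral_distr) auto
      also have "\<dots> = laplace (\<mu> n) u"
        unfolding laplace_def
        by (rule integral_cong_AE)
          (use mu[of n] in \<open>auto simp: nonneg_law_def g_def powr_def elim!: eventually_mono\<close>)
      finally show ?thesis .
    qed
    moreover have "(\<lambda>n. laplace (\<mu> (r n)) u) \<longlonglongrightarrow> \<phi> u"
      using LIMSEQ_subseq_LIMSEQ[OF lim[OF u] r(1)] by (simp add: comp_def)
    ultimately show ?thesis by (simp add: LIMSEQ_unique)
  qed
  \<comment> \<open>As the exponent tends to 0, \<open>g\<close> tends to the indicator of the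
    positive half-line, so the limit 1 of \<open>\<phi>\<close> forces the weak limit to give this
    half-line full mass.\<close>
  have "(\<lambda>k. integral\<^sup>L \<pi> (g (1 / real (Suc k)))) \<longlonglongrightarrow> integral\<^sup>L \<pi> (indicator {0<..})"
  proof (rule integral_dominated_convergence[where w = "\<lambda>_. 1"])
    show "AE y in \<pi>. (\<lambda>k. g (1 / real (Suc k)) y) \<longlonglongrightarrow> indicator {0<..} y"
    proof (rule AE_I2)
      fix y
      have l0: "(\<lambda>k. 1 / real (Suc k)) \<longlonglongrightarrow> 0" using LIMSEQ_Suc[OF lim_1_over_n] by simp
      show "(\<lambda>k. g (1 / real (Suc k)) y) \<longlonglongrightarrow> indicator {0<..} y"
      proof (cases "0 < y")
        case True
        then have "(\<lambda>k. max 0 (min 1 y) powr (1 / real (Suc k))) \<longlonglongrightarrow> max 0 (min 1 y) powr 0"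
          by (intro tendsto_powr tendsto_const l0) auto
        moreover have "max 0 (min 1 y) powr 0 = 1" using True by (simp add: min_def)
        ultimately show ?thesis using True by (simp only: g_def indicator_simps greaterThan_iff)
      qed (simp add: g_def)
    qed
    show "AE y in \<pi>. norm (g (1 / real (Suc k)) y) \<le> 1" for k by (intro AE_I2 gbd) simp
  qed auto
  then have "(\<lambda>k. \<phi> (1 / real (Suc k))) \<longlonglongrightarrow> measure \<pi> {0<..}"
    by (simp add: gint)
  then have "measure \<pi> {0<..} = 1" using phi0 LIMSEQ_unique by blast
  then have ae: "AE y in \<pi>. 0 < y" using p.prob_eq_1[of "{0<..}"] by simp
  show ?thesis
  \<comment> \<open>The weak limit has only been shown to be positive, so values above 1 are cut off
    by \<open>min\<close>. The same truncation is built into \<open>g\<close>, so the integrals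
    agree.\<close>
  proof (rule is_laplaceI[where M = \<pi> and X = "\<lambda>y. - ln (min 1 y)"])
    show "prob_space \<pi>" by (rule p.prob_space_axioms)
    show "AE y in \<pi>. 0 \<le> - ln (min 1 y)" using ae by (rule eventually_mono) (simp add: ln_le_zero_iff)
    fix u :: real assume u: "0 < u"
    have "integral\<^sup>L \<pi> (g u) = (LINT y|\<pi>. exp (- (u * - ln (min 1 y))))"
      by (rule integral_cong_AE) (use ae in \<open>auto simp: g_def powr_def elim!: eventually_mono\<close>)
    then show "\<phi> u = (LINT y|\<pi>. exp (- (u * - ln (min 1 y))))" using gint[OF u] by simp
  qed simp
qed

lemma is_laplace_limit:
  assumes "\<And>n. is_laplace (f n)" "\<And>u. 0 < u \<Longrightarrow> (\<lambda>n. f n u) \<longlonglongrightarrow> \<phi> u"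
    and "(\<phi> \<longlongrightarrow> 1) (at_right 0)"
  shows "is_laplace \<phi>"
proof -
  obtain \<mu> where mu: "\<And>n. nonneg_law (\<mu> n)" "\<And>n u. 0 < u \<Longrightarrow> f n u = laplace (\<mu> n) u"
    using assms(1) unfolding is_laplace_def by metis
  show ?thesis
  proof (rule laplace_continuity[OF mu(1)])
    show "(\<lambda>n. laplace (\<mu> n) u) \<longlonglongrightarrow> \<phi> u" if "0 < u" for u using assms(2)[OF that] mu(2)[OF that] by simp
    have "filterlim (\<lambda>k. 1 / real (Suc k)) (at_right 0) sequentially"
      unfolding filterlim_at using LIMSEQ_Suc[OF lim_1_over_n] by auto
    then show "(\<lambda>k. \<phi> (1 / real (Suc k))) \<longlonglongrightarrow> 1"
      using assms(3) by (rule filterlim_compose[rotated])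
  qed
qed

lemma is_laplace_pos: "is_laplace \<phi> \<Longrightarrow> 0 < u \<Longrightarrow> 0 < \<phi> u"
  unfolding is_laplace_def using laplace_pos by fastforce

lemma is_laplace_le_1: "is_laplace \<phi> \<Longrightarrow> 0 < u \<Longrightarrow> \<phi> u \<le> 1"
  unfolding is_laplace_def using laplace_le_1 by fastforce

lemma is_laplace_antimono: "is_laplace \<phi> \<Longrightarrow> 0 < u \<Longrightarrow> u \<le> v \<Longrightarrow> \<phi> v \<le> \<phi> u"
  unfolding is_laplace_def using laplace_antimono by fastforce

lemma is_laplace_isCont:
  assumes "is_laplace \<phi>" "0 < u" shows "isCont \<phi> u"
proof -
  obtain \<mu> where mu: "nonneg_law \<mu>" "\<And>u. 0 < u \<Longrightarrow> \<phi> u = laplace \<mu> u"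
    using assms unfolding is_laplace_def by auto
  have "isCont (\<lambda>v. laplace \<mu> (max 0 v)) u"
    unfolding continuous_at_sequentially comp_def
    by (intro allI impI laplace_tendsto mu tendsto_intros) auto
  moreover have "eventually (\<lambda>v. laplace \<mu> (max 0 v) = \<phi> v) (nhds u)"
    using eventually_nhds_in_open[of "{0<..}" u] assms by (auto simp: mu elim!: eventually_mono)
  ultimately show ?thesis by (simp add: isCont_cong)
qed

lemma is_laplace_at_0:
  assumes "is_laplace \<phi>" shows "(\<phi> \<longlongrightarrow> 1) (at_right 0)"
proof -
  obtain \<mu> where mu: "nonneg_law \<mu>" "\<And>u. 0 < u \<Longrightarrow> \<phi> u = laplace \<mu> u"
    using assms unfolding is_laplace_def by auto
  show ?thesis
    unfolding tendsto_at_iff_sequentially comp_def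
  proof (intro allI impI)
    fix X :: "nat \<Rightarrow> real" assume X: "\<forall>i. X i \<in> {0<..} - {0}" "X \<longlonglongrightarrow> 0"
    then have "(\<lambda>i. laplace \<mu> (X i)) \<longlonglongrightarrow> laplace \<mu> 0"
      by (intro laplace_tendsto mu) (auto simp: less_imp_le)
    then show "(\<lambda>i. \<phi> (X i)) \<longlonglongrightarrow> 1" using X mu by (simp add: laplace_0)
  qed
qed

section \<open>Closure of Laplace transforms under products, mixtures and subordination\<close>

lemma AE_pair_prod:
  assumes "prob_space M" "prob_space N" "Measurable.pred (M \<Otimes>\<^sub>M N) P" "AE x in M. AE y in N. P (x, y)"
  shows "AE z in M \<Otimes>\<^sub>M N. P z"
proof -
  interpret M: prob_space M by fact
  interpret N: prob_space N by fact
  interpret pair_sigma_finite M N ..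
  show ?thesis using assms by (intro AE_pair_measure) auto
qed

lemma integral_pair_bounded:
  fixes f :: "_ \<Rightarrow> 'c::{banach, second_countable_topology}"
  assumes "prob_space M" "prob_space N" "f \<in> borel_measurable (M \<Otimes>\<^sub>M N)"
    and "AE x in M. AE y in N. norm (f (x, y)) \<le> C"
  shows "integral\<^sup>L (M \<Otimes>\<^sub>M N) f = (LINT x|M. LINT y|N. f (x, y))"
proof -
  interpret M: prob_space M by fact
  interpret N: prob_space N by fact
  interpret pair_prob_space M N ..
  have "AE z in M \<Otimes>\<^sub>M N. norm (f z) \<le> C"
    by (rule AE_pair_prod) (use assms in auto)
  then have "integrable (M \<Otimes>\<^sub>M N) f"
    by (intro P.integrable_const_bound[where B = C]) (use assms in auto)
  then show ?thesis using integral_fst' by metis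
qed

lemma nonneg_law_convolution:
  assumes "nonneg_law \<mu>" "nonneg_law \<nu>"
  shows "nonneg_law (\<mu> \<star> \<nu>)"
    and "0 \<le> u \<Longrightarrow> laplace (\<mu> \<star> \<nu>) u = laplace \<mu> u * laplace \<nu> u"
proof -
  interpret m: real_distribution \<mu> using assms by (simp add: nonneg_law_def)
  interpret n: real_distribution \<nu> using assms by (simp add: nonneg_law_def)
  interpret pair_prob_space \<mu> \<nu> ..
  have conv: "\<mu> \<star> \<nu> = distr (\<mu> \<Otimes>\<^sub>M \<nu>) borel (\<lambda>z. fst z + snd z)"
    by (simp add: convolution_def case_prod_beta')
  have ae: "AE z in \<mu> \<Otimes>\<^sub>M \<nu>. 0 \<le> fst z + snd z"
    by (rule AE_pair_prod) (use assms m.prob_space_axioms n.prob_space_axioms in \<open>auto simp: nonneg_law_def elim!: eventually_mono\<close>)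
  show "nonneg_law (\<mu> \<star> \<nu>)"
    unfolding conv by (rule nonneg_law_distr) (use ae P.prob_space_axioms in auto)
  assume u: "0 \<le> u"
  have "laplace (\<mu> \<star> \<nu>) u = (LINT z|(\<mu> \<Otimes>\<^sub>M \<nu>). exp (- (u * (fst z + snd z))))"
    unfolding conv by (rule laplace_distr) simp
  also have "\<dots> = (LINT x|\<mu>. LINT y|\<nu>. exp (- (u * (fst (x, y) + snd (x, y)))))"
    by (rule integral_pair_bounded[where C = 1])
      (use assms u m.prob_space_axioms n.prob_space_axioms in \<open>auto simp: nonneg_law_def elim!: eventually_mono\<close>)
  also have "\<dots> = laplace \<mu> u * laplace \<nu> u"
  proof -
    have "exp (- (u * (x + y))) = exp (- (u * x)) * exp (- (u * y))" for x y
      by (simp add: distrib_left flip: exp_add)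
    then show ?thesis unfolding laplace_def by simp
  qed
  finally show "laplace (\<mu> \<star> \<nu>) u = laplace \<mu> u * laplace \<nu> u" .
qed

lemma is_laplace_one: "is_laplace (\<lambda>_. 1)"
proof -
  interpret prob_space "return borel (0::real)" by (rule prob_space_return) simp
  show ?thesis
    by (rule is_laplaceI[where M = "return borel (0::real)" and X = "\<lambda>_. 0"]) (auto simp: prob_space_axioms prob_space[simplified])
qed

lemma is_laplace_mult: "is_laplace f \<Longrightarrow> is_laplace g \<Longrightarrow> is_laplace (\<lambda>u. f u * g u)"
  unfolding is_laplace_def using nonneg_law_convolution by (metis less_imp_le)

lemma is_laplace_prod: "(\<And>i. i \<in> I \<Longrightarrow> is_laplace (f i)) \<Longrightarrow> is_laplace (\<lambda>u. \<Prod>i\<in>I. f i u)"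
  by (induction I rule: infinite_finite_induct) (auto intro: is_laplace_one is_laplace_mult)

lemma is_laplace_scale:
  assumes "is_laplace f" "0 < b" shows "is_laplace (\<lambda>u. f (b * u))"
proof -
  obtain \<mu> where mu: "nonneg_law \<mu>" "\<And>u. 0 < u \<Longrightarrow> f u = laplace \<mu> u"
    using assms unfolding is_laplace_def by auto
  interpret real_distribution \<mu> using mu by (simp add: nonneg_law_def)
  show ?thesis
    by (rule is_laplaceI[where M = \<mu> and X = "\<lambda>x. b * x"])
      (use mu assms prob_space_axioms in \<open>auto simp: nonneg_law_def laplace_def mult_ac elim!: eventually_mono\<close>)
qed

text \<open>The transform of a variable with transform \<open>f\<close> multiplied by an independent
  Bernoulli variable of parameter \<open>p\<close>.\<close>

lemma is_laplace_mixture: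
  assumes "is_laplace f" "0 \<le> p" "p \<le> 1" shows "is_laplace (\<lambda>u. (1 - p) + p * f u)"
proof -
  obtain \<mu> where mu: "nonneg_law \<mu>" "\<And>u. 0 < u \<Longrightarrow> f u = laplace \<mu> u"
    using assms unfolding is_laplace_def by auto
  interpret m: real_distribution \<mu> using mu by (simp add: nonneg_law_def)
  let ?B = "measure_pmf (bernoulli_pmf p)"
  interpret pair_prob_space ?B \<mu> ..
  define X where "X z = (if fst z then snd z else 0)" for z :: "bool \<times> real"
  have Xm[measurable]: "X \<in> borel_measurable (?B \<Otimes>\<^sub>M \<mu>)" unfolding X_def by measurable
  show ?thesis
  proof (rule is_laplaceI[OF P.prob_space_axioms Xm])
    show "AE z in ?B \<Otimes>\<^sub>M \<mu>. 0 \<le> X z"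
      by (rule AE_pair_prod) (use mu m.prob_space_axioms in \<open>auto simp: X_def nonneg_law_def measure_pmf.prob_space_axioms\<close>)
    fix u :: real assume u: "0 < u"
    have "(LINT z|(?B \<Otimes>\<^sub>M \<mu>). exp (- (u * X z))) = (LINT x|?B. LINT y|\<mu>. exp (- (u * X (x, y))))"
      by (rule integral_pair_bounded[where C = 1])
        (use mu u m.prob_space_axioms in \<open>auto simp: X_def nonneg_law_def measure_pmf.prob_space_axioms elim!: eventually_mono\<close>)
    also have "\<dots> = (1 - p) + p * f u"
      using assms u by (simp add: X_def mu laplace_def m.prob_space[simplified])
    finally show "(1 - p) + p * f u = (LINT z|(?B \<Otimes>\<^sub>M \<mu>). exp (- (u * X z)))" by simp
  qed
qed

text \<open>If \<open>T\<close> has transform \<open>exp (- (K * u powr \<beta>))\<close> and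
  \<open>R\<close> is independent of it, then \<open>R * T\<close> has conditional transform
  \<open>exp (- (K * u powr \<beta> * R powr \<beta>))\<close> given \<open>R\<close>. Taking
  \<open>R\<close> a suitable power of a variable with transform \<open>L\<close> gives
  \<open>L\<close> at the rescaled argument.\<close>

lemma is_laplace_subordinate:
  assumes L: "is_laplace L" and S: "is_laplace (\<lambda>u. exp (- (K * u powr \<beta>)))"
    and pos: "0 < K" "0 < \<beta>" "0 < K'"
  shows "is_laplace (\<lambda>u. L (K' * u powr \<beta>))"
proof -
  obtain \<mu> where mu: "nonneg_law \<mu>" "\<And>u. 0 < u \<Longrightarrow> L u = laplace \<mu> u"
    using L unfolding is_laplace_def by auto
  obtain \<kappa> where ka: "nonneg_law \<kappa>" "\<And>u. 0 < u \<Longrightarrow> exp (- (K * u powr \<beta>)) = laplace \<kappa> u"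
    using S unfolding is_laplace_def by auto
  interpret m: real_distribution \<mu> using mu by (simp add: nonneg_law_def)
  interpret n: real_distribution \<kappa> using ka by (simp add: nonneg_law_def)
  interpret pair_prob_space \<mu> \<kappa> ..
  \<comment> \<open>Solves \<open>K * R x powr \<beta> = K' * x\<close> for
    \<open>x \<ge> 0\<close>; \<open>max 0\<close> keeps it nonnegative off the support of the
    law.\<close>
  define R where "R x = (max 0 x * (K' / K)) powr (1 / \<beta>)" for x
  define X where "X z = R (fst z) * snd z" for z
  have R0: "0 \<le> R x" for x by (simp add: R_def)
  have [measurable]: "R \<in> borel_measurable borel" unfolding R_def by measurable
  have Xm[measurable]: "X \<in> borel_measurable (\<mu> \<Otimes>\<^sub>M \<kappa>)" unfolding X_def by measurable
  show ?thesis
  proof (rule is_laplaceI[OF P.prob_space_axioms Xm])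
    show "AE z in \<mu> \<Otimes>\<^sub>M \<kappa>. 0 \<le> X z"
    proof (rule AE_pair_prod[OF m.prob_space_axioms n.prob_space_axioms])
      show "AE x in \<mu>. AE y in \<kappa>. 0 \<le> X (x, y)"
        using ka R0 by (auto simp: X_def nonneg_law_def elim!: eventually_mono)
    qed measurable
    fix u :: real assume u: "0 < u"
    have "(LINT z|(\<mu> \<Otimes>\<^sub>M \<kappa>). exp (- (u * X z))) = (LINT x|\<mu>. LINT y|\<kappa>. exp (- (u * X (x, y))))"
      by (rule integral_pair_bounded[where C = 1])
        (use ka u m.prob_space_axioms n.prob_space_axioms R0 in \<open>auto simp: X_def nonneg_law_def elim!: eventually_mono\<close>)
    also have "\<dots> = (LINT x|\<mu>. exp (- (K' * u powr \<beta> * x)))"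
    proof (rule integral_cong_AE)
      have "(LINT y|\<kappa>. exp (- (u * X (x, y)))) = exp (- (K' * u powr \<beta> * x))" if "0 \<le> x" for x
      proof (cases "x = 0")
        case True
        then show ?thesis by (simp add: X_def R_def n.prob_space[simplified])
      next
        case False
        then have "0 < R x" using that pos by (simp add: R_def)
        have "(LINT y|\<kappa>. exp (- (u * X (x, y)))) = laplace \<kappa> (u * R x)"
          by (simp add: X_def laplace_def mult_ac)
        also have "\<dots> = exp (- (K * (u * R x) powr \<beta>))" using ka(2) u \<open>0 < R x\<close> by simp
        also have "(u * R x) powr \<beta> = u powr \<beta> * (x * (K' / K))"
          using that pos u by (simp add: R_def powr_mult powr_powr)
        finally show ?thesis using pos by (simp add: field_simps)
      qed
      then show "AE x in \<mu>. (LINT y|\<kappa>. exp (- (u * X (x, y)))) = exp (- (K' * u powr \<beta> * x))"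
        using mu by (auto simp: nonneg_law_def elim!: eventually_mono)
    qed (unfold X_def R_def, measurable)
    also have "\<dots> = L (K' * u powr \<beta>)" using u pos by (simp add: mu laplace_def)
    finally show "L (K' * u powr \<beta>) = (LINT z|(\<mu> \<Otimes>\<^sub>M \<kappa>). exp (- (u * X z)))" by simp
  qed
qed

lemma nonneg_law_convolution_power:
  assumes "nonneg_law \<rho>"
  shows "nonneg_law (((\<lambda>\<sigma>. \<rho> \<star> \<sigma>) ^^ n) (return borel 0)) \<and>
    (\<forall>u\<ge>0. laplace (((\<lambda>\<sigma>. \<rho> \<star> \<sigma>) ^^ n) (return borel 0)) u = laplace \<rho> u ^ n)"
proof (induction n)
  case 0
  interpret prob_space "return borel (0::real)" by (rule prob_space_return) simp
  show ?case
    by (auto simp: nonneg_law_def laplace_def real_distribution_def real_distribution_axioms_def prob_space_axioms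
        integral_return AE_return)
next
  case (Suc n)
  then show ?case using nonneg_law_convolution[OF assms] by simp
qed

lemma char_convolution:
  assumes "real_distribution \<mu>" "real_distribution \<nu>"
  shows "char (\<mu> \<star> \<nu>) z = char \<mu> z * char \<nu> z"
proof -
  interpret m: real_distribution \<mu> by fact
  interpret n: real_distribution \<nu> by fact
  interpret pair_prob_space \<mu> \<nu> ..
  have "char (\<mu> \<star> \<nu>) z = (LINT w|(\<mu> \<Otimes>\<^sub>M \<nu>). iexp (z * (fst w + snd w)))"
    unfolding char_def convolution_def by (subst integral_distr) (auto simp: case_prod_beta')
  also have "\<dots> = (LINT x|\<mu>. LINT y|\<nu>. iexp (z * (fst (x, y) + snd (x, y))))"
    by (rule integral_pair_bounded[where C = 1]) (auto simp: m.prob_space_axioms n.prob_space_axioms)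
  also have "\<dots> = char \<mu> z * char \<nu> z"
    unfolding char_def by (simp add: distrib_left exp_add)
  finally show ?thesis .
qed

section \<open>Selfdecomposability and infinite divisibility\<close>

text \<open>The hypothesis gives the law of the remainder. Uniqueness turns the product formula for
  transforms into an equality of laws with a convolution, from which the identity of characteristic
  functions is read off.\<close>

lemma selfdecomposable_of_laplace:
  assumes nu: "nonneg_law \<nu>"
    and quot: "\<And>b. 0 < b \<Longrightarrow> b < 1 \<Longrightarrow> is_laplace (\<lambda>u. laplace \<nu> u / laplace \<nu> (b * u))"
  shows "selfdecomposable \<nu>"
  unfolding selfdecomposable_def
proof (intro conjI ballI)
  show rd: "real_distribution \<nu>" using nu by (simp add: nonneg_law_def)
  interpret real_distribution \<nu> by (rule rd)
  fix b :: real assume b: "b \<in> {0<..<1}"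
  then obtain \<rho> where rho: "nonneg_law \<rho>" "\<And>u. 0 < u \<Longrightarrow> laplace \<nu> u / laplace \<nu> (b * u) = laplace \<rho> u"
    using quot[of b] unfolding is_laplace_def by auto
  let ?s = "distr \<nu> borel (\<lambda>x. b * x)"
  have s: "nonneg_law ?s"
    by (rule nonneg_law_distr) (use nu b prob_space_axioms in \<open>auto simp: nonneg_law_def elim!: eventually_mono\<close>)
  have "\<nu> = (?s \<star> \<rho>)"
  proof (rule laplace_unique[OF nu nonneg_law_convolution(1)[OF s rho(1)]])
    fix u :: real assume u: "0 < u"
    have "laplace (?s \<star> \<rho>) u = laplace ?s u * laplace \<rho> u"
      using u by (intro nonneg_law_convolution(2)[OF s rho(1)]) simp
    also have "laplace ?s u = laplace \<nu> (b * u)"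
      by (subst laplace_distr) (auto simp: laplace_def mult_ac)
    finally show "laplace \<nu> u = laplace (?s \<star> \<rho>) u"
      using laplace_pos[OF nu, of "b * u"] u b rho(2)[OF u] by (simp add: field_simps)
  qed
  then have "char \<nu> z = char ?s z * char \<rho> z" for z
    using char_convolution[of ?s \<rho> z] s rho(1) by (simp add: nonneg_law_def)
  moreover have "char ?s z = char \<nu> (b * z)" for z
    unfolding char_def by (subst integral_distr) (auto simp: mult_ac)
  ultimately show "\<exists>\<rho>. real_distribution \<rho> \<and> (\<forall>z. char \<nu> z = char \<nu> (b * z) * char \<rho> z)"
    using rho(1) unfolding nonneg_law_def by metis
qed

lemma infinitely_divisible_of_laplace:
  assumes nu: "nonneg_law \<nu>"
    and root: "\<And>n. n \<ge> 1 \<Longrightarrow> is_laplace (\<lambda>u. laplace \<nu> u powr (1 / real n))"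
  shows "infinitely_divisible \<nu>"
  unfolding infinitely_divisible_def
proof (intro conjI allI impI)
  show "real_distribution \<nu>" using nu by (simp add: nonneg_law_def)
  fix n :: nat assume n: "n \<ge> 1"
  then obtain \<rho> where rho: "nonneg_law \<rho>" "\<And>u. 0 < u \<Longrightarrow> laplace \<nu> u powr (1 / real n) = laplace \<rho> u"
    using root[OF n] unfolding is_laplace_def by auto
  have "\<nu> = ((\<lambda>\<sigma>. \<rho> \<star> \<sigma>) ^^ n) (return borel 0)"
  proof (rule laplace_unique[OF nu])
    show "nonneg_law (((\<lambda>\<sigma>. \<rho> \<star> \<sigma>) ^^ n) (return borel 0))"
      using nonneg_law_convolution_power[OF rho(1)] by simp
    fix u :: real assume u: "0 < u"
    have "laplace (((\<lambda>\<sigma>. \<rho> \<star> \<sigma>) ^^ n) (return borel 0)) u = (laplace \<nu> u powr (1 / real n)) ^ n"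
      using nonneg_law_convolution_power[OF rho(1)] u rho(2)[OF u] by simp
    also have "\<dots> = laplace \<nu> u" using laplace_pos[OF nu, of u] u n by (simp add: powr_power)
    finally show "laplace \<nu> u = laplace (((\<lambda>\<sigma>. \<rho> \<star> \<sigma>) ^^ n) (return borel 0)) u" by simp
  qed
  then show "\<exists>\<rho>. real_distribution \<rho> \<and> \<nu> = ((\<lambda>\<sigma>. \<rho> \<star> \<sigma>) ^^ n) (return borel 0)"
    using rho(1) unfolding nonneg_law_def by auto
qed

lemma one_minus_ge_exp:
  assumes "0 \<le> x" "x \<le> 1/2" shows "exp (- x - 2 * x\<^sup>2) \<le> 1 - (x::real)"
proof -
  have "exp (- x - 2 * x\<^sup>2) \<le> exp (ln (1 - x))" using ln_one_minus_pos_lower_bound[OF assms] by simp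
  then show ?thesis using assms by simp
qed

lemma one_minus_le_exp: "1 - x \<le> exp (- x)" for x :: real
  using exp_ge_add_one_self[of "- x"] by simp

text \<open>Uniform in \<open>v\<close> and in the law: the difference of exponentials is at most
  \<open>exp (- (b * y)) * ((1 - b) * y)\<close>, and \<open>y \<le> exp (b * y) / b\<close>. It
  makes all factors of a telescoping product close to 1 at once.\<close>

lemma is_laplace_diff_le:
  assumes "is_laplace \<phi>" "0 < v" "0 < b" "b < 1"
  shows "\<phi> (b * v) - \<phi> v \<le> 1 / b - 1"
proof -
  obtain \<mu> where mu: "nonneg_law \<mu>" "\<And>u. 0 < u \<Longrightarrow> \<phi> u = laplace \<mu> u"
    using assms unfolding is_laplace_def by auto
  interpret real_distribution \<mu> using mu by (simp add: nonneg_law_def)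
  have bound: "exp (- (b * v * x)) - exp (- (v * x)) \<le> 1 / b - 1" if "0 \<le> x" for x
  proof -
    define y where "y = v * x"
    have y: "0 \<le> y" using that assms by (simp add: y_def)
    have "exp (- (b * y)) - exp (- y) = exp (- (b * y)) * (1 - exp (- ((1 - b) * y)))"
      by (simp add: algebra_simps flip: exp_add)
    also have "\<dots> \<le> exp (- (b * y)) * ((1 - b) * y)"
      using one_minus_le_exp[of "(1 - b) * y"] by (intro mult_left_mono) auto
    also have "\<dots> \<le> exp (- (b * y)) * ((1 - b) * (exp (b * y) / b))"
    proof (intro mult_left_mono)
      have "b * y \<le> exp (b * y)" using exp_ge_add_one_self[of "b * y"] by linarith
      then show "y \<le> exp (b * y) / b" using assms by (simp add: field_simps)
    qed (use assms in auto)
    also have "\<dots> = 1 / b - 1" using assms by (simp add: exp_minus field_simps)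
    finally show ?thesis by (simp add: y_def mult_ac)
  qed
  have "\<phi> (b * v) - \<phi> v = (LINT x|\<mu>. exp (- (b * v * x)) - exp (- (v * x)))"
    using assms by (simp add: mu laplace_def laplace_integrable[OF mu(1)])
  also have "\<dots> \<le> 1 / b - 1"
    by (rule integral_le_const)
      (use assms mu bound in \<open>auto intro!: Bochner_Integration.integrable_diff laplace_integrable simp: nonneg_law_def elim!: eventually_mono\<close>)
  finally show ?thesis .
qed

text \<open>The factors \<open>\<rho>\<^sub>j\<close> of the telescoping product for \<open>\<phi>\<close> are uniformly close to \<open>1\<close>, so
  \<open>\<rho>\<^sub>j\<close> to the power \<open>1/n\<close> may be replaced by the mixture \<open>1 - 1/n + \<rho>\<^sub>j/n\<close>.\<close>

lemma is_laplace_root: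
  assumes L: "is_laplace \<phi>"
    and quot: "\<And>b. 0 < b \<Longrightarrow> b < 1 \<Longrightarrow> is_laplace (\<lambda>u. \<phi> u / \<phi> (b * u))"
    and n: "n \<ge> 1"
  shows "is_laplace (\<lambda>u. \<phi> u powr (1 / real n))"
proof -
  \<comment> \<open>The ratio tends to 1, so each factor \<open>r N j u\<close> does too, while the
    number \<open>m N\<close> of factors grows fast enough that
    \<open>b N ^ m N = exp (- real (Suc N))\<close> tends to 0 and the denominator left after
    telescoping tends to 1.\<close>
  define b where "b N = exp (- (1 / real (Suc N)))" for N
  define m where "m N = (Suc N)\<^sup>2" for N :: nat
  define r where "r N j u = \<phi> (b N ^ j * u) / \<phi> (b N * (b N ^ j * u))" for N j u
  define f where "f N u = (\<Prod>j<m N. (1 - 1 / real n) + 1 / real n * r N j u)" for N u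
  have b: "0 < b N" "b N < 1" for N by (auto simp: b_def)
  have inv: "1 / b N = exp (1 / real (Suc N))" for N by (simp add: b_def exp_minus field_simps)
  show ?thesis
  proof (rule is_laplace_limit[of f])
    show "is_laplace (f N)" for N
      unfolding f_def
    proof (intro is_laplace_prod is_laplace_mixture)
      show "is_laplace (r N j)" for j
        unfolding r_def using is_laplace_scale[OF quot[OF b], of "b N ^ j"] b by simp
    qed (use n in auto)
    show "((\<lambda>u. \<phi> u powr (1 / real n)) \<longlongrightarrow> 1) (at_right 0)"
      using tendsto_powr[OF is_laplace_at_0[OF L] tendsto_const[of "1 / real n"]] by simp
    fix u :: real assume u: "0 < u"
    define K where "K = - ln (\<phi> u)"
    \<comment> \<open>Bound on \<open>1 - r N j u\<close> uniform in \<open>j\<close>: the numerator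
      comes from \<open>is_laplace_diff_le\<close>, and \<open>\<phi> u\<close> is a lower bound for
      all denominators by monotonicity.\<close>
    define d where "d N = (exp (1 / real (Suc N)) - 1) / \<phi> u" for N
    have pu: "0 < \<phi> u" "\<phi> u \<le> 1" using is_laplace_pos[OF L u] is_laplace_le_1[OF L u] by auto
    have "(\<lambda>N. 1 / real (Suc N)) \<longlonglongrightarrow> 0" using LIMSEQ_Suc[OF lim_1_over_n] by simp
    then have "d \<longlonglongrightarrow> (exp 0 - 1) / \<phi> u" unfolding d_def by (intro tendsto_intros) (use pu in auto)
    then have d0: "d \<longlonglongrightarrow> 0" by simp
    have rpos: "0 < r N j u" and rle: "r N j u \<le> 1" and x: "1 - r N j u \<le> d N" for N j
    proof -
      define v where "v = b N ^ j * u"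
      have v: "0 < v" "v \<le> u" using u b[of N] by (simp_all add: v_def mult_left_le_one_le power_le_one)
      have bv: "0 < b N * v" "b N * v \<le> v" "b N * v \<le> u"
      proof -
        show "0 < b N * v" using v b[of N] by simp
        show "b N * v \<le> v" using v b[of N] by (simp add: mult_left_le_one_le)
        then show "b N * v \<le> u" using v(2) by (rule order_trans)
      qed
      note pos = is_laplace_pos[OF L v(1)] is_laplace_pos[OF L bv(1)]
      have r: "r N j u = \<phi> v / \<phi> (b N * v)" by (simp add: r_def v_def)
      show "0 < r N j u" "r N j u \<le> 1" using pos is_laplace_antimono[OF L bv(1,2)] by (auto simp: r)
      have "1 - r N j u = (\<phi> (b N * v) - \<phi> v) / \<phi> (b N * v)" using pos by (simp add: r field_simps)
      also have "\<dots> \<le> (exp (1 / real (Suc N)) - 1) / \<phi> u"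
      proof (rule frac_le)
        show "\<phi> (b N * v) - \<phi> v \<le> exp (1 / real (Suc N)) - 1"
          using is_laplace_diff_le[OF L v(1) b[of N]] unfolding inv .
      qed (use is_laplace_antimono[OF L bv(1,3)] pu in simp_all)
      finally show "1 - r N j u \<le> d N" by (simp add: d_def)
    qed
    have tel: "(\<Prod>j<k. r N j u) = \<phi> u / \<phi> (b N ^ k * u)" for k N
    proof (induction k)
      case (Suc k)
      have "0 < \<phi> (b N ^ k * u)" using is_laplace_pos[OF L] u b[of N] by simp
      then show ?case using Suc by (simp add: r_def mult_ac)
    qed (use pu in simp)
    define p where "p N = \<phi> u / \<phi> (b N ^ m N * u)" for N
    have bm: "b N ^ m N = exp (- real (Suc N))" for N
    proof -
      have "b N ^ m N = exp (real (m N) * - (1 / real (Suc N)))" unfolding b_def by (rule exp_of_nat_mult[symmetric])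
      then show ?thesis by (simp add: m_def power2_eq_square field_simps)
    qed
    have p_lim: "p \<longlonglongrightarrow> \<phi> u"
    proof -
      have "filterlim (\<lambda>N. exp (- real (Suc N)) * u) (at_right 0) sequentially"
        unfolding filterlim_at using u
        by (auto intro!: tendsto_mult_left_zero filterlim_compose[OF exp_at_bot]
            filterlim_compose[OF filterlim_uminus_at_bot_at_top] filterlim_compose[OF filterlim_real_sequentially filterlim_Suc] simp del: of_nat_Suc)
      then have "(\<lambda>N. \<phi> (exp (- real (Suc N)) * u)) \<longlonglongrightarrow> 1"
        by (rule filterlim_compose[OF is_laplace_at_0[OF L]])
      then have "(\<lambda>N. \<phi> u / \<phi> (exp (- real (Suc N)) * u)) \<longlonglongrightarrow> \<phi> u / 1"
        by (intro tendsto_intros) auto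
      then show ?thesis unfolding p_def bm by simp
    qed
    \<comment> \<open>The total second-order error. It is at most the largest
      \<open>1 - r N j u\<close> times their sum, and the sum is bounded by \<open>K\<close> through
      \<open>- ln\<close> of the telescoping product.\<close>
    define s where "s N = (\<Sum>j<m N. (1 - r N j u)\<^sup>2)" for N
    have s_bound: "0 \<le> s N \<and> s N \<le> d N * K" for N
    proof
      show "0 \<le> s N" by (simp add: s_def sum_nonneg)
      have d_nn: "0 \<le> d N" using rle[of N 0] x[of N 0] by linarith
      have "(\<Sum>j<m N. 1 - r N j u) \<le> (\<Sum>j<m N. - ln (r N j u))"
        using ln_le_minus_one[OF rpos] by (intro sum_mono) (simp add: algebra_simps)
      also have "\<dots> = - ln (\<Prod>j<m N. r N j u)" using rpos by (subst ln_prod) (auto simp: sum_negf less_imp_neq[symmetric])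
      also have "\<dots> \<le> K"
        unfolding tel K_def using pu u b[of N] is_laplace_le_1[OF L, of "b N ^ m N * u"] is_laplace_pos[OF L, of "b N ^ m N * u"]
        by (simp add: ln_div)
      finally have *: "(\<Sum>j<m N. 1 - r N j u) \<le> K" .
      have "s N \<le> (\<Sum>j<m N. d N * (1 - r N j u))"
        unfolding s_def power2_eq_square using x rle by (intro sum_mono mult_right_mono) auto
      also have "\<dots> \<le> d N * K" using * d_nn by (simp add: mult_left_mono flip: sum_distrib_left)
      finally show "s N \<le> d N * K" .
    qed
    have "(\<lambda>N. d N * K) \<longlonglongrightarrow> 0 * K" by (intro tendsto_intros d0)
    then have s0: "s \<longlonglongrightarrow> 0"
      by (intro real_tendsto_sandwich[of "\<lambda>_. 0" s sequentially "\<lambda>N. d N * K"]) (use s_bound in auto)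
    have ev: "eventually (\<lambda>N. d N \<le> 1/2) sequentially"
      using order_tendstoD(2)[OF d0, of "1/2"] by (auto elim: eventually_mono)
    \<comment> \<open>Bernoulli's inequality bounds each factor \<open>r\<close> by the
      \<open>n\<close>-th power of its mixture. With \<open>up\<close> below,
      \<open>f N u ^ n\<close> is squeezed between \<open>p N\<close> and
      \<open>p N * exp (2 * s N)\<close>, both tending to \<open>\<phi> u\<close>.\<close>
    have low: "p N \<le> f N u ^ n" for N
    proof -
      have "r N j u \<le> ((1 - 1 / real n) + 1 / real n * r N j u) ^ n" for j
      proof -
        have "1 + real n * (- ((1 - r N j u) / real n)) \<le> (1 + - ((1 - r N j u) / real n)) ^ n"
          using rpos[of N j] rle[of N j] n by (intro Bernoulli_inequality) (simp add: field_simps)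
        moreover have "(1 - 1 / real n) + 1 / real n * r N j u = 1 + - ((1 - r N j u) / real n)"
          by (simp add: diff_divide_distrib)
        moreover have "1 + real n * (- ((1 - r N j u) / real n)) = r N j u" using n by simp
        ultimately show ?thesis by (simp only:)
      qed
      then have "(\<Prod>j<m N. r N j u) \<le> (\<Prod>j<m N. ((1 - 1 / real n) + 1 / real n * r N j u) ^ n)"
        using rpos by (intro prod_mono) (auto simp: less_imp_le)
      then show ?thesis by (simp add: tel p_def f_def prod_power_distrib)
    qed
    have up: "f N u ^ n \<le> p N * exp (2 * s N)" if "d N \<le> 1/2" for N
    proof -
      have "((1 - 1 / real n) + 1 / real n * r N j u) ^ n \<le> r N j u * exp (2 * (1 - r N j u)\<^sup>2)" for j
      proof -
        have "(1 - 1 / real n) + 1 / real n * r N j u = 1 - (1 - r N j u) / real n"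
          by (simp add: diff_divide_distrib)
        moreover have "0 \<le> (1 - 1 / real n) + 1 / real n * r N j u"
          using rpos[of N j] n by (intro add_nonneg_nonneg) auto
        ultimately have "((1 - 1 / real n) + 1 / real n * r N j u) ^ n \<le> exp (- ((1 - r N j u) / real n)) ^ n"
          using one_minus_le_exp[of "(1 - r N j u) / real n"] by (intro power_mono) auto
        also have "\<dots> = exp (- (1 - r N j u))" using n by (simp flip: exp_of_nat_mult)
        also have "\<dots> = exp (- (1 - r N j u) - 2 * (1 - r N j u)\<^sup>2) * exp (2 * (1 - r N j u)\<^sup>2)"
          by (simp flip: exp_add)
        also have "\<dots> \<le> r N j u * exp (2 * (1 - r N j u)\<^sup>2)"
          using one_minus_ge_exp[of "1 - r N j u"] x[of N j] rle[of N j] that by (intro mult_right_mono) auto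
        finally show ?thesis .
      qed
      moreover have "0 \<le> ((1 - 1 / real n) + 1 / real n * r N j u) ^ n" for j
        using rpos[of N j] n by (intro zero_le_power add_nonneg_nonneg) auto
      ultimately have "(\<Prod>j<m N. ((1 - 1 / real n) + 1 / real n * r N j u) ^ n) \<le> (\<Prod>j<m N. r N j u * exp (2 * (1 - r N j u)\<^sup>2))"
        by (intro prod_mono) auto
      then show ?thesis
        by (simp add: tel p_def f_def prod_power_distrib prod.distrib s_def exp_sum sum_distrib_left)
    qed
    have "(\<lambda>N. p N * exp (2 * s N)) \<longlonglongrightarrow> \<phi> u * exp (2 * 0)" by (intro tendsto_intros p_lim s0)
    then have up_lim: "(\<lambda>N. p N * exp (2 * s N)) \<longlonglongrightarrow> \<phi> u" by simp
    have "(\<lambda>N. f N u ^ n) \<longlonglongrightarrow> \<phi> u"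
    proof (rule real_tendsto_sandwich[OF _ _ p_lim up_lim])
      show "eventually (\<lambda>N. p N \<le> f N u ^ n) sequentially" by (intro always_eventually allI low)
      show "eventually (\<lambda>N. f N u ^ n \<le> p N * exp (2 * s N)) sequentially"
        using ev by (rule eventually_mono) (rule up)
    qed
    then have "(\<lambda>N. (f N u ^ n) powr (1 / real n)) \<longlonglongrightarrow> \<phi> u powr (1 / real n)"
      by (intro tendsto_powr tendsto_const) (use pu in auto)
    moreover have "(f N u ^ n) powr (1 / real n) = f N u" for N
    proof -
      have "0 < (1 - 1 / real n) + 1 / real n * r N j u" for j
        using rpos[of N j] n by (intro add_nonneg_pos) auto
      then have "0 < f N u" unfolding f_def by (intro prod_pos) auto
      then show ?thesis using n by (subst powr_realpow[symmetric]) (auto simp: powr_powr)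
    qed
    ultimately show "(\<lambda>N. f N u) \<longlonglongrightarrow> \<phi> u powr (1 / real n)" by simp
  qed
qed

section \<open>Positive stable laws and variance mixtures\<close>

lemma one_minus_power_tendsto_exp:
  fixes y :: "nat \<Rightarrow> real"
  assumes y: "y \<longlonglongrightarrow> l" "\<And>N. 0 \<le> y N"
  shows "(\<lambda>N. (1 - y N / real (Suc N)) ^ Suc N) \<longlonglongrightarrow> exp (- l)"
proof (rule real_tendsto_sandwich)
  have i0: "(\<lambda>N. 1 / real (Suc N)) \<longlonglongrightarrow> 0" using LIMSEQ_Suc[OF lim_1_over_n] by simp
  have "(\<lambda>N. y N * (1 / real (Suc N))) \<longlonglongrightarrow> l * 0" by (intro tendsto_intros y i0)
  then have ev: "eventually (\<lambda>N. y N / real (Suc N) < 1/2) sequentially"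
    using order_tendstoD(2)[of "\<lambda>N. y N / real (Suc N)" 0 sequentially "1/2"] by simp
  show "eventually (\<lambda>N. exp (- y N - 2 * (y N)\<^sup>2 * (1 / real (Suc N))) \<le> (1 - y N / real (Suc N)) ^ Suc N) sequentially"
    using ev
  proof eventually_elim
    case (elim N)
    let ?x = "y N / real (Suc N)"
    have "exp (- y N - 2 * (y N)\<^sup>2 * (1 / real (Suc N))) = exp (real (Suc N) * (- ?x - 2 * ?x\<^sup>2))"
    proof (rule arg_cong[where f = exp])
      have "real (Suc N) \<noteq> 0" by simp
      then show "- y N - 2 * (y N)\<^sup>2 * (1 / real (Suc N)) = real (Suc N) * (- ?x - 2 * ?x\<^sup>2)"
        by (simp add: power2_eq_square right_diff_distrib del: of_nat_Suc)
    qed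
    also have "\<dots> = exp (- ?x - 2 * ?x\<^sup>2) ^ Suc N" by (rule exp_of_nat_mult)
    also have "\<dots> \<le> (1 - ?x) ^ Suc N"
      using elim y(2)[of N] by (intro power_mono one_minus_ge_exp) auto
    finally show ?case .
  qed
  show "eventually (\<lambda>N. (1 - y N / real (Suc N)) ^ Suc N \<le> exp (- y N)) sequentially"
    using ev
  proof eventually_elim
    case (elim N)
    have "(1 - y N / real (Suc N)) ^ Suc N \<le> exp (- (y N / real (Suc N))) ^ Suc N"
      using elim by (intro power_mono one_minus_le_exp) auto
    also have "\<dots> = exp (- y N)" by (simp flip: exp_of_nat_mult del: of_nat_Suc power_Suc)
    finally show ?case .
  qed
  have "(\<lambda>N. exp (- y N - 2 * (y N)\<^sup>2 * (1 / real (Suc N)))) \<longlonglongrightarrow> exp (- l - 2 * l\<^sup>2 * 0)"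
    by (intro tendsto_intros y i0)
  then show "(\<lambda>N. exp (- y N - 2 * (y N)\<^sup>2 * (1 / real (Suc N)))) \<longlonglongrightarrow> exp (- l)" by simp
  show "(\<lambda>N. exp (- y N)) \<longlonglongrightarrow> exp (- l)" by (intro tendsto_intros y)
qed

text \<open>\<open>exp (- (v * x\<^sup>2))\<close> is the standard normal characteristic function at
  \<open>sqrt (2 * v) * x\<close>; exchanging the two integrals moves the Fourier transform onto
  \<open>\<sigma>\<close>.\<close>

lemma gaussian_mixture_laplace:
  assumes "real_distribution \<sigma>" "0 \<le> v"
  shows "complex_of_real (LINT x|\<sigma>. exp (- (v * x\<^sup>2))) = (LINT w|std_normal_distribution. char \<sigma> (sqrt (2 * v) * w))"
proof -
  let ?N = std_normal_distribution
  interpret s: real_distribution \<sigma> by fact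
  interpret N: real_distribution ?N by (rule real_dist_normal_dist)
  interpret pair_prob_space \<sigma> ?N ..
  have m[measurable_cong]: "sets ?N = sets borel" by simp
  have ch: "complex_of_real (exp (- (v * x\<^sup>2))) = (LINT w|?N. iexp (sqrt (2 * v) * x * w))" for x
    using fun_cong[OF char_std_normal_distribution, of "sqrt (2 * v) * x"] assms
    unfolding char_def by (simp add: power_mult_distrib)
  have "complex_of_real (LINT x|\<sigma>. exp (- (v * x\<^sup>2))) = (LINT x|\<sigma>. complex_of_real (exp (- (v * x\<^sup>2))))"
    by simp
  also have "\<dots> = (LINT x|\<sigma>. LINT w|?N. iexp (sqrt (2 * v) * x * w))"
    unfolding ch ..
  also have "\<dots> = (LINT w|?N. LINT x|\<sigma>. iexp (sqrt (2 * v) * x * w))"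
  proof (rule Fubini_integral[symmetric])
    show "integrable (\<sigma> \<Otimes>\<^sub>M ?N) (\<lambda>(x, w). iexp (sqrt (2 * v) * x * w))"
      by (rule P.integrable_const_bound[where B = 1]) auto
  qed
  finally show ?thesis unfolding char_def by (simp add: mult_ac)
qed

text \<open>The positive stable law is the limit of \<open>n\<close> independent squares \<open>X\<^sup>2\<close>, \<open>X\<close> of law \<open>\<sigma>\<close>, scaled by
  \<open>n\<close> to the power \<open>- 2/\<alpha>\<close>; the previous lemma makes the Laplace transform of \<open>X\<^sup>2\<close> explicit.\<close>

lemma positive_stable_laplace:
  assumes sig: "real_distribution \<sigma>"
    and chr: "\<And>z. char \<sigma> z = complex_of_real (exp (- (c * \<bar>z\<bar> powr \<alpha>)))"
    and c: "0 < c" and al: "0 < \<alpha>" "\<alpha> \<le> 2"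
  shows "\<exists>K>0. is_laplace (\<lambda>u. exp (- (K * u powr (\<alpha> / 2))))"
proof -
  let ?N = std_normal_distribution
  interpret s: real_distribution \<sigma> by fact
  interpret N: real_distribution ?N by (rule real_dist_normal_dist)
  have m[measurable_cong]: "sets ?N = sets borel" by simp
  define g where "g v = (LINT x|\<sigma>. exp (- (v * x\<^sup>2)))" for v
  have g: "g v = (LINT w|?N. exp (- (c * (2 * v) powr (\<alpha> / 2) * \<bar>w\<bar> powr \<alpha>)))" if v: "0 \<le> v" for v
  proof -
    have "\<bar>sqrt (2 * v) * w\<bar> powr \<alpha> = (2 * v) powr (\<alpha> / 2) * \<bar>w\<bar> powr \<alpha>" for w
      using v by (simp add: abs_mult powr_mult powr_half_sqrt[symmetric] powr_powr)
    then have "complex_of_real (g v) = complex_of_real (LINT w|?N. exp (- (c * (2 * v) powr (\<alpha> / 2) * \<bar>w\<bar> powr \<alpha>)))"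
      unfolding g_def gaussian_mixture_laplace[OF sig v] chr by (simp add: mult_ac)
    then show ?thesis using of_real_eq_iff by blast
  qed
  define mom where "mom = (LINT w|?N. \<bar>w\<bar> powr \<alpha>)"
  \<comment> \<open>This is where \<open>\<alpha> \<le> 2\<close> enters: the power is dominated by
    \<open>1 + w\<^sup>2\<close>.\<close>
  have int: "integrable ?N (\<lambda>w. \<bar>w\<bar> powr \<alpha>)"
  proof (rule Bochner_Integration.integrable_bound)
    show "integrable ?N (\<lambda>w. 1 + w ^ 2)"
      by (intro Bochner_Integration.integrable_add integrable_std_normal_distribution_moment) simp
    have "\<bar>w\<bar> powr \<alpha> \<le> 1 + w\<^sup>2" for w :: real
    proof (cases "\<bar>w\<bar> \<le> 1")
      case True
      then have "\<bar>w\<bar> powr \<alpha> \<le> 1" using al by (intro powr_le1) auto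
      then show ?thesis by (simp add: add_increasing2)
    next
      case False
      then have "\<bar>w\<bar> powr \<alpha> \<le> \<bar>w\<bar> powr 2" using al by (intro powr_mono) auto
      also have "\<dots> = w\<^sup>2" using False by simp
      finally show ?thesis by simp
    qed
    then show "AE w in ?N. norm (\<bar>w\<bar> powr \<alpha>) \<le> norm (1 + w\<^sup>2)" by simp
  qed simp
  have mom: "0 < mom"
  proof -
    have "mom \<noteq> 0"
    proof
      assume "mom = 0"
      then have "AE w in ?N. \<bar>w\<bar> powr \<alpha> = 0"
        unfolding mom_def by (subst (asm) integral_nonneg_eq_0_iff_AE[OF int]) auto
      then have "AE w in ?N. w = 0" by (rule eventually_mono) simp
      \<comment> \<open>A vanishing absolute moment would force the second moment of the standard
        normal law to be 0 instead of 1.\<close>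
      then have "(LINT w|?N. w ^ (2 * 1)) = (LINT w|?N. 0)"
        by (intro integral_cong_AE) (auto elim!: eventually_mono)
      then show False unfolding std_normal_distribution_even_moments by simp
    qed
    moreover have "0 \<le> mom" unfolding mom_def by simp
    ultimately show ?thesis by simp
  qed
  \<comment> \<open>The first-order coefficient: by the formula for \<open>g\<close>,
    \<open>1 - g v\<close> behaves like \<open>K * v powr (\<alpha> / 2)\<close> near 0. The scaling
    in \<open>f\<close> makes \<open>v powr (\<alpha> / 2)\<close> equal to
    \<open>u powr (\<alpha> / 2)\<close> divided by the number \<open>Suc N\<close> of
    summands.\<close>
  define K where "K = c * 2 powr (\<alpha> / 2) * mom"
  have K: "0 < K" using c mom by (simp add: K_def)
  define f where "f N u = g (real (Suc N) powr (- (2 / \<alpha>)) * u) ^ Suc N" for N u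
  have "is_laplace (\<lambda>u. exp (- (K * u powr (\<alpha> / 2))))"
  proof (rule is_laplace_limit[of f])
    have gl: "is_laplace g"
      by (rule is_laplaceI[where M = \<sigma> and X = "\<lambda>x. x\<^sup>2"]) (auto simp: g_def s.prob_space_axioms)
    show "is_laplace (f N)" for N
    proof -
      have "is_laplace (\<lambda>u. \<Prod>i<Suc N. g (real (Suc N) powr (- (2 / \<alpha>)) * u))"
        by (intro is_laplace_prod is_laplace_scale[OF gl]) simp
      then show ?thesis by (simp add: f_def[abs_def])
    qed
    have "((\<lambda>u. u powr (\<alpha> / 2)) \<longlongrightarrow> 0 powr (\<alpha> / 2)) (at_right (0::real))"
      using al by (intro tendsto_powr') (auto simp: eventually_at_filter)
    then have "((\<lambda>u. exp (- (K * u powr (\<alpha> / 2)))) \<longlongrightarrow> exp (- (K * 0))) (at_right 0)"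
      by (intro tendsto_intros) simp
    then show "((\<lambda>u. exp (- (K * u powr (\<alpha> / 2)))) \<longlongrightarrow> 1) (at_right 0)" by simp
    fix u :: real assume u: "0 < u"
    define a where "a = c * (2 * u) powr (\<alpha> / 2)"
    have a: "0 < a" using c u by (simp add: a_def)
    define y where "y N = (LINT w|?N. real (Suc N) * (1 - exp (- (a / real (Suc N) * \<bar>w\<bar> powr \<alpha>))))" for N
    have bd: "real (Suc N) * (1 - exp (- (a / real (Suc N) * t))) \<le> a * t"
      "0 \<le> real (Suc N) * (1 - exp (- (a / real (Suc N) * t)))" if "0 \<le> t" for N t
    proof -
      have "real (Suc N) * (1 - exp (- (a / real (Suc N) * t))) \<le> real (Suc N) * (a / real (Suc N) * t)"
        using one_minus_le_exp[of "a / real (Suc N) * t"] by (intro mult_left_mono) auto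
      also have "\<dots> = a * t" by simp
      finally show "real (Suc N) * (1 - exp (- (a / real (Suc N) * t))) \<le> a * t" .
      show "0 \<le> real (Suc N) * (1 - exp (- (a / real (Suc N) * t)))" using a that by simp
    qed
    have "y \<longlonglongrightarrow> (LINT w|?N. a * \<bar>w\<bar> powr \<alpha>)"
      unfolding y_def
    proof (rule integral_dominated_convergence[where w = "\<lambda>w. a * \<bar>w\<bar> powr \<alpha>"])
      show "AE w in ?N. (\<lambda>N. real (Suc N) * (1 - exp (- (a / real (Suc N) * \<bar>w\<bar> powr \<alpha>)))) \<longlonglongrightarrow> a * \<bar>w\<bar> powr \<alpha>"
      proof (rule AE_I2)
        fix w :: real
        define t where "t = a * \<bar>w\<bar> powr \<alpha>"
        have "(\<lambda>N. real N * (1 - exp (- (t / real N)))) \<longlonglongrightarrow> t" by real_asymp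
        then show "(\<lambda>N. real (Suc N) * (1 - exp (- (a / real (Suc N) * \<bar>w\<bar> powr \<alpha>)))) \<longlonglongrightarrow> a * \<bar>w\<bar> powr \<alpha>"
          using LIMSEQ_Suc unfolding t_def by fastforce
      qed
      show "AE w in ?N. norm (real (Suc N) * (1 - exp (- (a / real (Suc N) * \<bar>w\<bar> powr \<alpha>)))) \<le> a * \<bar>w\<bar> powr \<alpha>" for N
        using bd by (intro AE_I2) (simp del: of_nat_Suc)
    qed (use int in auto)
    moreover have "(LINT w|?N. a * \<bar>w\<bar> powr \<alpha>) = K * u powr (\<alpha> / 2)"
      using u by (simp add: a_def K_def mom_def powr_mult)
    ultimately have lim: "y \<longlonglongrightarrow> K * u powr (\<alpha> / 2)" by simp
    have "f N u = (1 - y N / real (Suc N)) ^ Suc N" for N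
    proof -
      have e: "c * (2 * (real (Suc N) powr (- (2 / \<alpha>)) * u)) powr (\<alpha> / 2) = a / real (Suc N)"
      proof -
        have "2 * (real (Suc N) powr (- (2 / \<alpha>)) * u) = 2 * u * real (Suc N) powr (- (2 / \<alpha>))" by simp
        then have "(2 * (real (Suc N) powr (- (2 / \<alpha>)) * u)) powr (\<alpha> / 2) = (2 * u) powr (\<alpha> / 2) * real (Suc N) powr (- 1)"
          using u al by (simp only: powr_mult powr_powr) simp
        then show ?thesis by (simp add: a_def powr_minus_divide del: of_nat_Suc)
      qed
      have "integrable ?N (\<lambda>w. exp (- (a / real (Suc N) * \<bar>w\<bar> powr \<alpha>)))"
        using a by (intro N.integrable_laplace) auto
      then have "y N / real (Suc N) = 1 - (LINT w|?N. exp (- (a / real (Suc N) * \<bar>w\<bar> powr \<alpha>)))"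
        unfolding y_def by (simp add: N.prob_space[simplified] del: of_nat_Suc)
      also have "(LINT w|?N. exp (- (a / real (Suc N) * \<bar>w\<bar> powr \<alpha>))) = g (real (Suc N) powr (- (2 / \<alpha>)) * u)"
        using u g[of "real (Suc N) powr (- (2 / \<alpha>)) * u", unfolded e] by (simp del: of_nat_Suc)
      finally show ?thesis by (simp add: f_def)
    qed
    moreover have "0 \<le> y N" for N
      unfolding y_def by (rule Bochner_Integration.integral_nonneg) (rule bd(2), simp)
    ultimately show "(\<lambda>N. f N u) \<longlonglongrightarrow> exp (- (K * u powr (\<alpha> / 2)))"
      using one_minus_power_tendsto_exp[OF lim] by (simp only:)
  qed
  then show ?thesis using K by blast
qed

text \<open>Given \<open>V = v\<close>, the product \<open>sqrt v * W\<close> has characteristic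
  function \<open>exp (- (z\<^sup>2 / 2 * v))\<close>, which integrates to the Laplace transform of
  \<open>\<nu>\<close> at \<open>z\<^sup>2 / 2\<close>.\<close>

lemma variance_mixing_distribution_of_laplace:
  assumes nu: "nonneg_law \<nu>" and mu: "real_distribution \<mu>"
    and chr: "\<And>z. char \<mu> z = complex_of_real (laplace \<nu> (z\<^sup>2 / 2))"
  shows "variance_mixing_distribution \<mu> \<nu>"
proof -
  let ?N = std_normal_distribution
  interpret n: real_distribution \<nu> using nu by (simp add: nonneg_law_def)
  interpret N: real_distribution ?N by (rule real_dist_normal_dist)
  interpret pair_prob_space \<nu> ?N ..
  have m[measurable_cong]: "sets ?N = sets borel" by simp
  let ?P = "\<nu> \<Otimes>\<^sub>M ?N"
  \<comment> \<open>\<open>variance_mixing_distribution\<close> asks for \<open>V\<close>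
    nonnegative at every sample point, whereas \<open>\<nu>\<close> is carried by the half-line only
    almost surely.\<close>
  define V where "V = (\<lambda>\<omega>::real \<times> real. max 0 (fst \<omega>))"
  define W where "W = (\<lambda>\<omega>::real \<times> real. snd \<omega>)"
  have Vm[measurable]: "V \<in> borel_measurable ?P" unfolding V_def by measurable
  have Wm[measurable]: "W \<in> borel_measurable ?P" unfolding W_def by measurable
  have ae_nu: "AE x in \<nu>. 0 \<le> x" using nu by (simp add: nonneg_law_def)
  have ae: "AE \<omega> in ?P. V \<omega> = fst \<omega>"
    by (rule AE_pair_prod) (use ae_nu n.prob_space_axioms N.prob_space_axioms in \<open>auto simp: V_def elim!: eventually_mono\<close>)
  have dV: "distr ?P borel V = \<nu>"
  proof -
    have "distr ?P borel V = distr ?P \<nu> fst" by (rule distr_cong_AE) (use ae in auto)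
    then show ?thesis by (simp add: N.distr_pair_fst)
  qed
  have dW: "distr ?P borel W = ?N"
  proof (rule measure_eqI)
    fix A assume "A \<in> sets (distr ?P borel W)"
    then have A: "A \<in> sets borel" by simp
    have "W -` A \<inter> space ?P = UNIV \<times> A" by (auto simp: W_def space_pair_measure)
    then show "emeasure (distr ?P borel W) A = emeasure ?N A"
      using A n.emeasure_space_1 by (simp add: emeasure_distr N.emeasure_pair_measure_Times)
  qed simp
  have "distr ?P (borel \<Otimes>\<^sub>M borel) (\<lambda>\<omega>. (V \<omega>, W \<omega>)) = distr ?P ?P (\<lambda>\<omega>. \<omega>)"
    by (rule distr_cong_AE) (use ae in \<open>auto simp: W_def elim!: eventually_mono intro!: sets_pair_measure_cong\<close>)
  then have dVW: "distr ?P (borel \<Otimes>\<^sub>M borel) (\<lambda>\<omega>. (V \<omega>, W \<omega>)) = ?P" by (simp add: distr_id2)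
  have ind: "P.indep_var borel V borel W"
    unfolding P.indep_var_distribution_eq dV dW dVW by simp
  have dist: "distributed ?P lborel W std_normal_density"
    unfolding distributed_def
  proof (intro conjI)
    show "distr ?P lborel W = density lborel std_normal_density"
      using dW by (simp cong: distr_cong)
  qed auto
  have "distr ?P borel (\<lambda>\<omega>. sqrt (V \<omega>) * W \<omega>) = \<mu>"
  proof (rule Levy_uniqueness[OF _ mu])
    show "real_distribution (distr ?P borel (\<lambda>\<omega>. sqrt (V \<omega>) * W \<omega>))" by (rule P.real_distribution_distr) simp
    show "char (distr ?P borel (\<lambda>\<omega>. sqrt (V \<omega>) * W \<omega>)) = char \<mu>"
    proof
      fix z
      have "char (distr ?P borel (\<lambda>\<omega>. sqrt (V \<omega>) * W \<omega>)) z = (LINT \<omega>|?P. iexp (z * (sqrt (V \<omega>) * W \<omega>)))"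
        unfolding char_def by (rule integral_distr) auto
      also have "\<dots> = (LINT v|\<nu>. LINT w|?N. iexp (z * (sqrt (V (v, w)) * W (v, w))))"
        by (rule integral_pair_bounded[where C = 1]) (auto simp: n.prob_space_axioms N.prob_space_axioms)
      also have "\<dots> = (LINT v|\<nu>. char ?N (z * sqrt (max 0 v)))"
        unfolding char_def by (simp add: V_def W_def mult_ac)
      also have "\<dots> = (LINT v|\<nu>. complex_of_real (exp (- (z\<^sup>2 / 2 * v))))"
        unfolding char_std_normal_distribution
      proof (rule integral_cong_AE)
        show "AE v in \<nu>. complex_of_real (exp (- (z * sqrt (max 0 v))\<^sup>2 / 2)) = complex_of_real (exp (- (z\<^sup>2 / 2 * v)))"
          using ae_nu by (rule eventually_mono) (simp add: power_mult_distrib)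
      qed auto
      also have "\<dots> = char \<mu> z" unfolding chr laplace_def by simp
      finally show "char (distr ?P borel (\<lambda>\<omega>. sqrt (V \<omega>) * W \<omega>)) z = char \<mu> z" .
    qed
  qed
  then show ?thesis
    unfolding variance_mixing_distribution_def
    using ind dV dist P.prob_space_axioms by (intro exI[of _ ?P] exI[of _ V] exI[of _ W]) (auto simp: V_def)
qed

text \<open>Subordination is applied twice: to \<open>L\<close>, which yields the mixing law, and to
  the quotients of \<open>L\<close>, which yields the quotients of its transform.\<close>

lemma stable_mixture:
  assumes mu: "real_distribution \<mu>"
    and chr: "\<And>z. z \<noteq> 0 \<Longrightarrow> char \<mu> z = complex_of_real (L (c * \<bar>z\<bar> powr \<alpha>))"
    and L: "is_laplace L" and quot: "\<And>b. 0 < b \<Longrightarrow> b < 1 \<Longrightarrow> is_laplace (\<lambda>u. L u / L (b * u))"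
    and pos: "0 < c" "0 < \<alpha>" "0 < K" and stable: "is_laplace (\<lambda>u. exp (- (K * u powr (\<alpha> / 2))))"
  shows "\<exists>\<nu>. variance_mixing_distribution \<mu> \<nu> \<and> infinitely_divisible \<nu> \<and> selfdecomposable \<nu>"
proof -
  interpret m: real_distribution \<mu> by fact
  \<comment> \<open>Chosen so that \<open>k * u powr (\<alpha> / 2)\<close> at
    \<open>u = z\<^sup>2 / 2\<close> equals \<open>c * \<bar>z\<bar> powr \<alpha>\<close>.\<close>
  define k where "k = c * 2 powr (\<alpha> / 2)"
  have k: "0 < k" using pos by (simp add: k_def)
  note sub = is_laplace_subordinate[OF _ stable pos(3) _ k]
  have "is_laplace (\<lambda>u. L (k * u powr (\<alpha> / 2)))" by (rule sub) (use L pos in auto)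
  then obtain \<nu> where nu: "nonneg_law \<nu>" "\<And>u. 0 < u \<Longrightarrow> L (k * u powr (\<alpha> / 2)) = laplace \<nu> u"
    unfolding is_laplace_def by auto
  have lnu: "is_laplace (laplace \<nu>)" using nu unfolding is_laplace_def by auto
  have q: "is_laplace (\<lambda>u. laplace \<nu> u / laplace \<nu> (b * u))" if b: "0 < b" "b < 1" for b
  proof -
    \<comment> \<open>Scaling \<open>u\<close> by \<open>b\<close> scales the argument of
      \<open>L\<close> by \<open>b powr (\<alpha> / 2)\<close>, so this is the ratio at which the
      quotient of \<open>L\<close> is needed.\<close>
    have b': "0 < b powr (\<alpha> / 2)" "b powr (\<alpha> / 2) < 1" using b pos powr_less_mono2[of "\<alpha> / 2" b 1] by auto
    have "is_laplace (\<lambda>u. L (k * u powr (\<alpha> / 2)) / L (b powr (\<alpha> / 2) * (k * u powr (\<alpha> / 2))))"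
      by (rule sub[OF quot[OF b']]) (use pos in auto)
    moreover have "L (k * u powr (\<alpha> / 2)) / L (b powr (\<alpha> / 2) * (k * u powr (\<alpha> / 2))) = laplace \<nu> u / laplace \<nu> (b * u)"
      if "0 < u" for u using that b by (simp add: nu(2)[symmetric] powr_mult mult_ac)
    ultimately show ?thesis unfolding is_laplace_def by auto
  qed
  have "variance_mixing_distribution \<mu> \<nu>"
  proof (rule variance_mixing_distribution_of_laplace[OF nu(1) mu])
    fix z show "char \<mu> z = complex_of_real (laplace \<nu> (z\<^sup>2 / 2))"
    proof (cases "z = 0")
      case True
      then show ?thesis by (simp add: m.char_zero laplace_0[OF nu(1)])
    next
      case False
      have "(z\<^sup>2) powr (\<alpha> / 2) = \<bar>z\<bar> powr \<alpha>"
      proof -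
        have "z\<^sup>2 = \<bar>z\<bar> powr 2" using False by simp
        then show ?thesis by (simp only: powr_powr) simp
      qed
      then have "k * (z\<^sup>2 / 2) powr (\<alpha> / 2) = c * \<bar>z\<bar> powr \<alpha>"
        by (simp add: k_def powr_divide)
      then show ?thesis using chr[OF False] nu(2)[of "z\<^sup>2 / 2"] False by simp
    qed
  qed
  moreover have "infinitely_divisible \<nu>"
    by (rule infinitely_divisible_of_laplace[OF nu(1)]) (rule is_laplace_root[OF lnu q])
  moreover have "selfdecomposable \<nu>"
    by (rule selfdecomposable_of_laplace[OF nu(1)]) (rule q)
  ultimately show ?thesis by blast
qed

section \<open>First passage of random walks\<close>

lemma sum_lessThan_add: "(\<Sum>j<k + n. f j) = (\<Sum>j<k. f j) + (\<Sum>j<n. f (k + j))" for k n :: nat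
  by (induction n) (auto simp: add.assoc)

lemma borel_measurable_exp_neg: "f \<in> borel_measurable N \<Longrightarrow> (\<lambda>x. exp (- (c * f x :: real))) \<in> borel_measurable N"
  by measurable

text \<open>Abstract form of Brownian motion with drift sampled at mesh \<open>h\<close>, with
  \<open>D\<close> its increments and \<open>a\<close> the level to pass. Independence is assumed
  for shifted blocks, the shape needed when the walk is restarted at step \<open>k\<close>.\<close>

locale iid_walk = prob_space M for M :: "'a measure" +
  fixes D :: "nat \<Rightarrow> 'a \<Rightarrow> real" and \<alpha> h a :: real
  assumes rv[measurable]: "\<And>i. D i \<in> borel_measurable M"
    and indep_shift: "\<And>k n. indep_vars (\<lambda>_. borel) (\<lambda>i. D (k + i)) {..<n}"
    and ident: "\<And>i. distr M borel (D i) = distr M borel (D 0)"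
    and alpha_pos: "0 < \<alpha>" and h_pos: "0 < h" and a_pos: "0 < a"
begin

definition walk :: "nat \<Rightarrow> 'a \<Rightarrow> real" where
  "walk i \<omega> = (\<Sum>j<i. D j \<omega>)"

text \<open>Left-endpoint Riemann sum, over \<open>n\<close> steps, of the exponential functional of
  the walk restarted from 0 at step \<open>k\<close>.\<close>

definition area :: "nat \<Rightarrow> nat \<Rightarrow> 'a \<Rightarrow> real" where
  "area k n \<omega> = h * (\<Sum>i<n. exp (- (\<alpha> * (\<Sum>j<i. D (k + j) \<omega>))))"

definition lap :: "nat \<Rightarrow> real \<Rightarrow> real" where
  "lap n u = expectation (\<lambda>\<omega>. exp (- (u * area 0 n \<omega>)))"

definition hit :: "nat \<Rightarrow> 'a \<Rightarrow> bool" where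
  "hit k \<omega> \<longleftrightarrow> (\<forall>j<k. walk j \<omega> < a) \<and> a \<le> walk k \<omega>"

text \<open>A defective transform: that of the area accumulated before first passage, restricted to
  passage within \<open>N\<close> steps.\<close>

definition hit_lap :: "nat \<Rightarrow> real \<Rightarrow> real" where
  "hit_lap N u = (\<Sum>k\<le>N. expectation (\<lambda>\<omega>. of_bool (hit k \<omega>) * exp (- (u * area 0 k \<omega>))))"

text \<open>The area up to first passage, or up to step \<open>N\<close> if there is none before.
  Unlike \<open>hit_lap\<close>, its transform belongs to a genuine law and so qualifies for
  \<open>is_laplace_limit\<close>.\<close>

definition stopped_area :: "nat \<Rightarrow> 'a \<Rightarrow> real" where
  "stopped_area N \<omega> = h * (\<Sum>i<N. of_bool (\<forall>j\<le>i. walk j \<omega> < a) * exp (- (\<alpha> * walk i \<omega>)))"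

lemma indep: "indep_vars (\<lambda>_. borel) D {..<n}"
  using indep_shift[of 0 n] by simp

lemma walk_measurable[measurable]: "walk i \<in> borel_measurable M"
  unfolding walk_def by measurable

lemma area_measurable[measurable]: "area k n \<in> borel_measurable M"
  unfolding area_def by measurable

lemma hit_measurable[measurable]: "Measurable.pred M (hit k)"
  unfolding hit_def by measurable

lemma stopped_area_measurable[measurable]: "stopped_area N \<in> borel_measurable M"
  unfolding stopped_area_def by measurable

lemma area_nonneg: "0 \<le> area k n \<omega>"
  unfolding area_def using h_pos by (simp add: sum_nonneg)

lemma area_mono: "m \<le> n \<Longrightarrow> area k m \<omega> \<le> area k n \<omega>"
  unfolding area_def using h_pos by (intro mult_left_mono sum_mono2) auto

lemma stopped_area_nonneg: "0 \<le> stopped_area N \<omega>"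
  unfolding stopped_area_def using h_pos by (simp add: sum_nonneg)

text \<open>Splitting the path at step \<open>k\<close> factors
  \<open>exp (- (\<alpha> * walk k \<omega>))\<close> out of the remainder: the pathwise source of
  the affine identity for the exponential functional.\<close>

lemma area_add: "area 0 (k + n) \<omega> = area 0 k \<omega> + exp (- (\<alpha> * walk k \<omega>)) * area k n \<omega>"
proof -
  have s: "(\<Sum>j<k + i. D (0 + j) \<omega>) = walk k \<omega> + (\<Sum>j<i. D (k + j) \<omega>)" for i
    unfolding walk_def by (simp add: sum_lessThan_add)
  define g where "g i = exp (- (\<alpha> * (\<Sum>j<i. D (0 + j) \<omega>)))" for i
  have "g (k + i) = exp (- (\<alpha> * walk k \<omega>)) * exp (- (\<alpha> * (\<Sum>j<i. D (k + j) \<omega>)))" for i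
    unfolding g_def s by (simp add: distrib_left flip: exp_add)
  then have "(\<Sum>i<k + n. g i) = (\<Sum>i<k. g i) + exp (- (\<alpha> * walk k \<omega>)) * (\<Sum>i<n. exp (- (\<alpha> * (\<Sum>j<i. D (k + j) \<omega>))))"
    by (simp add: sum_lessThan_add sum_distrib_left)
  then show ?thesis unfolding area_def g_def by (simp add: distrib_left)
qed

lemma integrable_indicator_event: "A \<in> sets M \<Longrightarrow> integrable M (indicator A :: 'a \<Rightarrow> real)"
  by (rule integrable_const_bound[where B = 1]) auto

lemma integrable_exp: "X \<in> borel_measurable M \<Longrightarrow> (\<And>\<omega>. 0 \<le> X \<omega>) \<Longrightarrow> 0 \<le> (u::real) \<Longrightarrow> integrable M (\<lambda>\<omega>. exp (- (u * X \<omega>)))"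
  by (rule integrable_laplace) auto

lemma integrable_hit: "0 \<le> u \<Longrightarrow> integrable M (\<lambda>\<omega>. of_bool (hit k \<omega>) * exp (- (u * area 0 k \<omega>)))"
  by (rule integrable_const_bound[where B = 1]) (auto simp: area_nonneg)

lemma lap_shift: "expectation (\<lambda>\<omega>. exp (- (u * area k n \<omega>))) = lap n u"
\<comment> \<open>The product description of the joint law needs a nonempty index set.\<close>
proof (cases "n = 0")
  case True
  then show ?thesis by (simp add: lap_def area_def)
next
  case False
  define F where "F f = exp (- (u * (h * (\<Sum>i<n. exp (- (\<alpha> * (\<Sum>j<i. f j)))))))" for f :: "nat \<Rightarrow> real"
  have Fm[measurable]: "F \<in> borel_measurable (PiM {..<n} (\<lambda>_. borel))"
    unfolding F_def by (intro borel_measurable_exp_neg borel_measurable_times borel_measurable_const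
        borel_measurable_sum measurable_component_singleton) auto
  have law: "distr M (PiM {..<n} (\<lambda>_. borel)) (\<lambda>\<omega>. \<lambda>i\<in>{..<n}. D (k + i) \<omega>) = PiM {..<n} (\<lambda>_. distr M borel (D 0))" for k
  proof -
    have "indep_vars (\<lambda>_. borel) (\<lambda>i. D (k + i)) {..<n}" by (rule indep_shift)
    then show ?thesis
      using False by (subst (asm) indep_vars_iff_distr_eq_PiM') (auto simp: ident[of "k + _"])
  qed
  have eq: "expectation (\<lambda>\<omega>. exp (- (u * area k n \<omega>))) = integral\<^sup>L (PiM {..<n} (\<lambda>_. distr M borel (D 0))) F" for k
  proof -
    have i: "integral\<^sup>L (PiM {..<n} (\<lambda>_. distr M borel (D 0))) F = (\<integral>\<omega>. F (\<lambda>i\<in>{..<n}. D (k + i) \<omega>) \<partial>M)"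
      unfolding law[of k, symmetric] by (rule integral_distr) auto
    have "F (\<lambda>i\<in>{..<n}. D (k + i) \<omega>) = exp (- (u * area k n \<omega>))" for \<omega>
      unfolding F_def area_def by (auto intro!: sum.cong arg_cong[where f = exp] arg_cong[where f = "\<lambda>x. \<alpha> * x"])
    then show ?thesis unfolding i by simp
  qed
  show ?thesis unfolding lap_def eq ..
qed

text \<open>The event and the area before step \<open>k\<close> are functions of the first
  \<open>k\<close> increments, \<open>area k n\<close> is a function of the next \<open>n\<close>.
  The parameters \<open>u\<close> and \<open>v\<close> differ because the remainder gets
  rescaled.\<close>

lemma hit_markov:
  assumes u: "0 \<le> u" and v: "0 \<le> v"
  shows "expectation (\<lambda>\<omega>. of_bool (hit k \<omega>) * exp (- (u * area 0 k \<omega>)) * exp (- (v * area k n \<omega>)))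
    = expectation (\<lambda>\<omega>. of_bool (hit k \<omega>) * exp (- (u * area 0 k \<omega>))) * lap n v"
proof -
  let ?A = "{..<k}" and ?B = "{k..<k + n}"
  define F where "F f = (of_bool ((\<forall>j\<in>{..<k}. (\<Sum>i<j. f i) < a) \<and> a \<le> (\<Sum>i<k. f i)) :: real)
      * exp (- (u * (h * (\<Sum>i<k. exp (- (\<alpha> * (\<Sum>j<i. f j)))))))" for f :: "nat \<Rightarrow> real"
  define G where "G f = exp (- (v * (h * (\<Sum>i<n. exp (- (\<alpha> * (\<Sum>j<i. f (k + j))))))))" for f :: "nat \<Rightarrow> real"
  have s[measurable]: "(\<lambda>f. \<Sum>i<j. f i) \<in> borel_measurable (PiM ?A (\<lambda>_. borel :: real measure))" if "j \<le> k" for j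
    using that by (intro borel_measurable_sum measurable_component_singleton) auto
  have Fm: "F \<in> borel_measurable (PiM ?A (\<lambda>_. borel))"
  proof -
    have "Measurable.pred (PiM ?A (\<lambda>_. borel)) (\<lambda>f. (\<forall>j\<in>{..<k}. (\<Sum>i<j. f i) < a) \<and> a \<le> (\<Sum>i<k. f i))"
      by (intro pred_intros_logic pred_intros_finite borel_measurable_pred_less borel_measurable_le s) auto
    then have "(\<lambda>f. of_bool ((\<forall>j\<in>{..<k}. (\<Sum>i<j. f i) < a) \<and> a \<le> (\<Sum>i<k. f i)) :: real) \<in> borel_measurable (PiM ?A (\<lambda>_. borel))"
      by (rule measurable_compose) simp
    moreover have "(\<lambda>f. exp (- (u * (h * (\<Sum>i<k. exp (- (\<alpha> * (\<Sum>j<i. f j)))))))) \<in> borel_measurable (PiM ?A (\<lambda>_. borel))"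
      by (intro borel_measurable_exp_neg borel_measurable_times borel_measurable_const borel_measurable_sum s) auto
    ultimately show ?thesis unfolding F_def by (rule borel_measurable_times)
  qed
  have Gm: "G \<in> borel_measurable (PiM ?B (\<lambda>_. borel))"
    unfolding G_def by (intro borel_measurable_exp_neg borel_measurable_times borel_measurable_const
        borel_measurable_sum measurable_component_singleton) auto
  have "indep_var (PiM ?A (\<lambda>_. borel)) (\<lambda>\<omega>. restrict (\<lambda>i. D i \<omega>) ?A) (PiM ?B (\<lambda>_. borel)) (\<lambda>\<omega>. restrict (\<lambda>i. D i \<omega>) ?B)"
    by (rule indep_var_restrict[OF indep[of "k + n"]]) auto
  then have "indep_var borel (F \<circ> (\<lambda>\<omega>. restrict (\<lambda>i. D i \<omega>) ?A)) borel (G \<circ> (\<lambda>\<omega>. restrict (\<lambda>i. D i \<omega>) ?B))"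
    by (rule indep_var_compose[OF _ Fm Gm])
  moreover have "F \<circ> (\<lambda>\<omega>. restrict (\<lambda>i. D i \<omega>) ?A) = (\<lambda>\<omega>. of_bool (hit k \<omega>) * exp (- (u * area 0 k \<omega>)))"
  proof
    fix \<omega>
    have "(\<Sum>i<j. restrict (\<lambda>i. D i \<omega>) ?A i) = (\<Sum>i<j. D i \<omega>)" if "j \<le> k" for j
      using that by (intro sum.cong) auto
    then show "(F \<circ> (\<lambda>\<omega>. restrict (\<lambda>i. D i \<omega>) ?A)) \<omega> = of_bool (hit k \<omega>) * exp (- (u * area 0 k \<omega>))"
      unfolding F_def hit_def area_def walk_def comp_def by (simp add: Ball_def)
  qed
  moreover have "G \<circ> (\<lambda>\<omega>. restrict (\<lambda>i. D i \<omega>) ?B) = (\<lambda>\<omega>. exp (- (v * area k n \<omega>)))"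
    unfolding G_def area_def comp_def by (auto intro!: ext sum.cong arg_cong[where f = exp] arg_cong[where f = "\<lambda>x. \<alpha> * x"])
  ultimately have "indep_var borel (\<lambda>\<omega>. of_bool (hit k \<omega>) * exp (- (u * area 0 k \<omega>))) borel (\<lambda>\<omega>. exp (- (v * area k n \<omega>)))"
    by simp
  then show ?thesis
    by (subst indep_var_lebesgue_integral) (auto intro!: integrable_hit integrable_exp area_nonneg u v simp: lap_shift)
qed

lemma hit_unique: "hit k \<omega> \<Longrightarrow> hit k' \<omega> \<Longrightarrow> k = k'"
  unfolding hit_def by (metis linorder_neqE_nat not_less)

lemma sum_hit: "k \<le> N \<Longrightarrow> hit k \<omega> \<Longrightarrow> (\<Sum>i\<le>N. of_bool (hit i \<omega>) * f i) = (f k :: real)"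
proof -
  assume k: "k \<le> N" "hit k \<omega>"
  have "(\<Sum>i\<le>N. of_bool (hit i \<omega>) * f i) = (\<Sum>i\<le>N. if i = k then f k else 0)"
    using k hit_unique by (intro sum.cong) auto
  then show ?thesis using k by simp
qed

lemma sum_hit_none: "(\<forall>k\<le>N. \<not> hit k \<omega>) \<Longrightarrow> (\<Sum>i\<le>N. of_bool (hit i \<omega>) * f i) = (0 :: real)"
  by (intro sum.neutral) auto

lemma no_hit: "(\<forall>k\<le>N. \<not> hit k \<omega>) \<Longrightarrow> j \<le> N \<Longrightarrow> walk j \<omega> < a"
proof (induction j rule: less_induct)
  case (less j)
  then have "\<forall>i<j. walk i \<omega> < a" by auto
  then show ?case using less.prems unfolding hit_def by force
qed

lemma hit_lap_eq: "0 \<le> u \<Longrightarrow> hit_lap N u = expectation (\<lambda>\<omega>. \<Sum>k\<le>N. of_bool (hit k \<omega>) * exp (- (u * area 0 k \<omega>)))"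
  unfolding hit_lap_def by (subst Bochner_Integration.integral_sum) (auto intro: integrable_hit)

lemma hit_lap_times_lap: 
  assumes "0 \<le> u" "0 \<le> v"
  shows "hit_lap N u * lap n v = expectation (\<lambda>\<omega>. \<Sum>k\<le>N. of_bool (hit k \<omega>) * (exp (- (u * area 0 k \<omega>)) * exp (- (v * area k n \<omega>))))"
    and "integrable M (\<lambda>\<omega>. \<Sum>k\<le>N. of_bool (hit k \<omega>) * (exp (- (u * area 0 k \<omega>)) * exp (- (v * area k n \<omega>))))"
proof -
  have i: "integrable M (\<lambda>\<omega>. of_bool (hit k \<omega>) * (exp (- (u * area 0 k \<omega>)) * exp (- (v * area k n \<omega>))))" for k
    using assms by (intro integrable_const_bound[where B = 1]) (auto simp: area_nonneg mult_le_one)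
  then show "integrable M (\<lambda>\<omega>. \<Sum>k\<le>N. of_bool (hit k \<omega>) * (exp (- (u * area 0 k \<omega>)) * exp (- (v * area k n \<omega>))))"
    by (rule Bochner_Integration.integrable_sum)
  show "hit_lap N u * lap n v = expectation (\<lambda>\<omega>. \<Sum>k\<le>N. of_bool (hit k \<omega>) * (exp (- (u * area 0 k \<omega>)) * exp (- (v * area k n \<omega>))))"
    unfolding hit_lap_def sum_distrib_right Bochner_Integration.integral_sum[OF i]
    by (intro sum.cong refl) (simp add: hit_markov[OF assms, symmetric] mult.assoc)
qed

text \<open>At the passage step the walk is at least \<open>a\<close>, so the weight of the
  remainder is at most \<open>exp (- (\<alpha> * a))\<close>; prolonging the remainder from
  \<open>n - k\<close> to \<open>n\<close> steps only increases the area.\<close>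

lemma hit_lap_upper:
  assumes u: "0 \<le> u" and N: "N \<le> n"
  shows "hit_lap N u * lap n (u * exp (- (\<alpha> * a))) \<le> lap n u"
proof -
  let ?v = "u * exp (- (\<alpha> * a))"
  have v: "0 \<le> ?v" using u by simp
  show ?thesis
    unfolding hit_lap_times_lap(1)[OF u v] unfolding lap_def
  proof (rule integral_mono[OF hit_lap_times_lap(2)[OF u v] integrable_exp])
    fix \<omega>
    show "(\<Sum>k\<le>N. of_bool (hit k \<omega>) * (exp (- (u * area 0 k \<omega>)) * exp (- (?v * area k n \<omega>)))) \<le> exp (- (u * area 0 n \<omega>))"
    proof (cases "\<exists>k\<le>N. hit k \<omega>")
      case True
      then obtain k where k: "k \<le> N" "hit k \<omega>" by auto
      have "area 0 n \<omega> = area 0 k \<omega> + exp (- (\<alpha> * walk k \<omega>)) * area k (n - k) \<omega>"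
        using area_add[of k "n - k"] k N by simp
      also have "\<dots> \<le> area 0 k \<omega> + exp (- (\<alpha> * a)) * area k n \<omega>"
        using k alpha_pos by (intro add_left_mono mult_mono area_mono area_nonneg) (auto simp: hit_def)
      finally have "u * area 0 n \<omega> \<le> u * area 0 k \<omega> + ?v * area k n \<omega>"
        using mult_left_mono[OF _ u] by (fastforce simp: distrib_left mult_ac)
      then show ?thesis by (simp add: sum_hit[OF k] flip: exp_add)
    next
      case False
      then show ?thesis by (subst sum_hit_none) auto
    qed
  qed (use u area_nonneg in auto)
qed

text \<open>Converse of \<open>hit_lap_upper\<close>. Unless some step exceeds
  \<open>\<epsilon>\<close>, the walk is at most \<open>a + \<epsilon>\<close> at passage, so the
  weight of the remainder is at least \<open>exp (- (\<alpha> * (a + \<epsilon>)))\<close>. With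
  horizon \<open>N + n\<close>, a passage within \<open>N\<close> steps leaves at least
  \<open>n\<close> further ones.\<close>

lemma lap_upper:
  assumes u: "0 \<le> u" and e: "0 < \<epsilon>"
  shows "lap (N + n) u \<le> prob {\<omega>\<in>space M. \<forall>j\<le>N. walk j \<omega> < a} + prob {\<omega>\<in>space M. \<exists>j<N. \<epsilon> < \<bar>D j \<omega>\<bar>}
    + hit_lap N u * lap n (u * exp (- (\<alpha> * (a + \<epsilon>))))"
proof -
  let ?v = "u * exp (- (\<alpha> * (a + \<epsilon>)))"
  have v: "0 \<le> ?v" using u by simp
  let ?C = "{\<omega>\<in>space M. \<forall>j\<le>N. walk j \<omega> < a}" and ?E = "{\<omega>\<in>space M. \<exists>j<N. \<epsilon> < \<bar>D j \<omega>\<bar>}"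
  let ?S = "\<lambda>\<omega>. \<Sum>k\<le>N. of_bool (hit k \<omega>) * (exp (- (u * area 0 k \<omega>)) * exp (- (?v * area k n \<omega>)))"
  have [measurable]: "?C \<in> sets M" "?E \<in> sets M" by measurable
  have "lap (N + n) u \<le> expectation (\<lambda>\<omega>. indicator ?C \<omega> + indicator ?E \<omega> + ?S \<omega>)"
    unfolding lap_def
  proof (rule integral_mono)
    show "integrable M (\<lambda>\<omega>. indicator ?C \<omega> + indicator ?E \<omega> + ?S \<omega>)"
      by (intro Bochner_Integration.integrable_add hit_lap_times_lap(2)[OF u v] integrable_indicator_event) auto
    show "integrable M (\<lambda>\<omega>. exp (- (u * area 0 (N + n) \<omega>)))" using u area_nonneg by (intro integrable_exp) auto
    fix \<omega> assume \<omega>: "\<omega> \<in> space M"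
    have S0: "0 \<le> ?S \<omega>" by (intro sum_nonneg) auto
    have le1: "exp (- (u * area 0 (N + n) \<omega>)) \<le> 1" using u area_nonneg by simp
    show "exp (- (u * area 0 (N + n) \<omega>)) \<le> indicator ?C \<omega> + indicator ?E \<omega> + ?S \<omega>"
    proof (cases "\<exists>k\<le>N. hit k \<omega>")
      case True
      then obtain k where k: "k \<le> N" "hit k \<omega>" by auto
      show ?thesis
      proof (cases "\<omega> \<in> ?E")
        case True
        then have "indicator ?E \<omega> = (1 :: real)" by (rule indicator_simps)
        moreover have "0 \<le> (indicator ?C \<omega> :: real)" by simp
        ultimately show ?thesis using S0 le1 by linarith
      next
        case False
        \<comment> \<open>The walk starts at 0, below the level, so the passage happens through an
          increment \<open>D j\<close>.\<close>
        have "k \<noteq> 0" using k a_pos by (intro notI) (simp add: hit_def walk_def)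
        then obtain j where j: "k = Suc j" using not0_implies_Suc by blast
        have "walk k \<omega> = walk j \<omega> + D j \<omega>" by (simp add: j walk_def)
        moreover have "walk j \<omega> < a" using k j by (simp add: hit_def)
        moreover have "\<bar>D j \<omega>\<bar> \<le> \<epsilon>"
        proof -
          have "j < N" using k(1) j by simp
          then have "\<not> \<epsilon> < \<bar>D j \<omega>\<bar>" using False \<omega> by blast
          then show ?thesis by simp
        qed
        ultimately have wk: "walk k \<omega> \<le> a + \<epsilon>" by linarith
        have "area 0 k \<omega> + exp (- (\<alpha> * (a + \<epsilon>))) * area k n \<omega> \<le> area 0 k \<omega> + exp (- (\<alpha> * walk k \<omega>)) * area k n \<omega>"
          using wk alpha_pos by (intro add_left_mono mult_right_mono area_nonneg) auto
        also have "\<dots> \<le> area 0 (N + n) \<omega>"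
          unfolding area_add[symmetric] using k by (intro area_mono) simp
        finally have "u * area 0 k \<omega> + ?v * area k n \<omega> \<le> u * area 0 (N + n) \<omega>"
          using mult_left_mono[OF _ u] by (fastforce simp: distrib_left mult_ac)
        then have "exp (- (u * area 0 (N + n) \<omega>)) \<le> ?S \<omega>" by (simp add: sum_hit[OF k] flip: exp_add)
        then show ?thesis by (simp add: add_increasing)
      qed
    next
      case False
      then have "\<omega> \<in> ?C" using no_hit \<omega> by auto
      then have "indicator ?C \<omega> = (1 :: real)" by (rule indicator_simps)
      moreover have "0 \<le> (indicator ?E \<omega> :: real)" by simp
      ultimately show ?thesis using S0 le1 by linarith
    qed
  qed
  also have "\<dots> = expectation (\<lambda>\<omega>. indicator ?C \<omega> + indicator ?E \<omega>) + expectation ?S"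
    by (rule Bochner_Integration.integral_add[OF Bochner_Integration.integrable_add hit_lap_times_lap(2)[OF u v]])
      (auto intro!: integrable_indicator_event)
  also have "expectation (\<lambda>\<omega>. indicator ?C \<omega> + indicator ?E \<omega>) = prob ?C + prob ?E"
    by (subst Bochner_Integration.integral_add) (auto intro!: integrable_indicator_event)
  finally show ?thesis unfolding hit_lap_times_lap(1)[OF u v] .
qed

lemma stopped_area_hit:
  assumes "hit k \<omega>" "k \<le> N" shows "stopped_area N \<omega> = area 0 k \<omega>"
proof -
  have "(\<Sum>i<N. of_bool (\<forall>j\<le>i. walk j \<omega> < a) * exp (- (\<alpha> * walk i \<omega>))) = (\<Sum>i<k. exp (- (\<alpha> * walk i \<omega>)))"
  proof (rule sum.mono_neutral_cong_right)
    show "\<forall>i\<in>{..<N} - {..<k}. of_bool (\<forall>j\<le>i. walk j \<omega> < a) * exp (- (\<alpha> * walk i \<omega>)) = 0"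
      using assms by (auto simp: hit_def)
    fix i assume "i \<in> {..<k}"
    then have "\<forall>j\<le>i. walk j \<omega> < a" using assms by (auto simp: hit_def)
    then show "of_bool (\<forall>j\<le>i. walk j \<omega> < a) * exp (- (\<alpha> * walk i \<omega>)) = exp (- (\<alpha> * walk i \<omega>))" by simp
  qed (use assms in auto)
  then show ?thesis by (simp add: stopped_area_def area_def walk_def)
qed

text \<open>On passage within \<open>N\<close> steps the stopped area is the area at passage. Hence
  the genuine transform dominates the defective one, and by \<open>stopped_lap_upper\<close> exceeds
  it by at most the probability of no passage.\<close>

lemma stopped_lap_lower:
  assumes u: "0 \<le> u" and N: "N \<le> N'"
  shows "hit_lap N u \<le> expectation (\<lambda>\<omega>. exp (- (u * stopped_area N' \<omega>)))"
  unfolding hit_lap_eq[OF u]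
proof (rule integral_mono)
  fix \<omega>
  show "(\<Sum>k\<le>N. of_bool (hit k \<omega>) * exp (- (u * area 0 k \<omega>))) \<le> exp (- (u * stopped_area N' \<omega>))"
  proof (cases "\<exists>k\<le>N. hit k \<omega>")
    case True
    then obtain k where k: "k \<le> N" "hit k \<omega>" by auto
    then show ?thesis using stopped_area_hit[OF k(2), of N'] N by (simp add: sum_hit[OF k])
  next
    case False
    then show ?thesis by (subst sum_hit_none) auto
  qed
next
  show "integrable M (\<lambda>\<omega>. \<Sum>k\<le>N. of_bool (hit k \<omega>) * exp (- (u * area 0 k \<omega>)))"
    using integrable_hit[OF u] by (intro Bochner_Integration.integrable_sum)
  show "integrable M (\<lambda>\<omega>. exp (- (u * stopped_area N' \<omega>)))"
    using u stopped_area_nonneg by (intro integrable_exp) auto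
qed

lemma stopped_lap_upper:
  assumes u: "0 \<le> u" and N: "N \<le> N'"
  shows "expectation (\<lambda>\<omega>. exp (- (u * stopped_area N' \<omega>))) \<le> prob {\<omega>\<in>space M. \<forall>j\<le>N. walk j \<omega> < a} + hit_lap N u"
proof -
  let ?C = "{\<omega>\<in>space M. \<forall>j\<le>N. walk j \<omega> < a}"
  let ?S = "\<lambda>\<omega>. \<Sum>k\<le>N. of_bool (hit k \<omega>) * exp (- (u * area 0 k \<omega>))"
  have [measurable]: "?C \<in> sets M" by measurable
  have S: "integrable M ?S" using integrable_hit[OF u] by (intro Bochner_Integration.integrable_sum)
  have "expectation (\<lambda>\<omega>. exp (- (u * stopped_area N' \<omega>))) \<le> expectation (\<lambda>\<omega>. indicator ?C \<omega> + ?S \<omega>)"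
  proof (rule integral_mono)
    show "integrable M (\<lambda>\<omega>. indicator ?C \<omega> + ?S \<omega>)"
      by (intro Bochner_Integration.integrable_add S integrable_indicator_event) auto
    show "integrable M (\<lambda>\<omega>. exp (- (u * stopped_area N' \<omega>)))" using u stopped_area_nonneg by (intro integrable_exp) auto
    fix \<omega> assume \<omega>: "\<omega> \<in> space M"
    show "exp (- (u * stopped_area N' \<omega>)) \<le> indicator ?C \<omega> + ?S \<omega>"
    proof (cases "\<exists>k\<le>N. hit k \<omega>")
      case True
      then obtain k where k: "k \<le> N" "hit k \<omega>" by auto
      then show ?thesis using stopped_area_hit[OF k(2), of N'] N by (simp add: sum_hit[OF k])
    next
      case False
      then have "\<omega> \<in> ?C" using no_hit \<omega> by auto
      moreover have "0 \<le> ?S \<omega>" by (intro sum_nonneg) auto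
      moreover have "exp (- (u * stopped_area N' \<omega>)) \<le> 1" using u stopped_area_nonneg[of N' \<omega>] by simp
      ultimately show ?thesis using indicator_simps(1)[of \<omega> ?C] by (smt (verit))
    qed
  qed
  also have "\<dots> = expectation (indicator ?C) + expectation ?S"
    by (rule Bochner_Integration.integral_add[OF integrable_indicator_event S]) simp
  also have "expectation (indicator ?C) = prob ?C" by simp
  finally show ?thesis unfolding hit_lap_eq[OF u] .
qed

end

text \<open>The transforms of the stopped areas are squeezed between bounds tending to
  \<open>L u / L v\<close>, with \<open>v = u * exp (- (\<alpha> * a))\<close>. The bound
  \<open>\<delta> m\<close> on staying below the level holds for all meshes
  \<open>k \<ge> m\<close>, so it survives the limit in \<open>k\<close>.\<close>

lemma laplace_quotient_of_walks:
  fixes M :: "'a measure" and D :: "nat \<Rightarrow> nat \<Rightarrow> 'a \<Rightarrow> real" and \<alpha> a :: real and h :: "nat \<Rightarrow> real"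
    and Lm :: "nat \<Rightarrow> real \<Rightarrow> real" and L :: "real \<Rightarrow> real" and \<delta> :: "nat \<Rightarrow> real"
  assumes w: "\<And>k. iid_walk M (D k) \<alpha> (h k) a"
    and lim_k: "\<And>m u. 0 < u \<Longrightarrow>
      (\<lambda>k. \<integral>\<omega>. exp (- (u * (h k * (\<Sum>i<m * 2 ^ k. exp (- (\<alpha> * (\<Sum>j<i. D k j \<omega>))))))) \<partial>M) \<longlonglongrightarrow> Lm m u"
    and lim_m: "\<And>u. 0 < u \<Longrightarrow> (\<lambda>m. Lm m u) \<longlonglongrightarrow> L u"
    and L: "is_laplace L"
    and stay: "\<And>m k. m \<le> k \<Longrightarrow> measure M {\<omega>\<in>space M. \<forall>j\<le>m * 2 ^ k. (\<Sum>i<j. D k i \<omega>) < a} \<le> \<delta> m"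
    and delta: "\<delta> \<longlonglongrightarrow> 0"
    and jump: "\<And>m \<epsilon>. 0 < \<epsilon> \<Longrightarrow> (\<lambda>k. measure M {\<omega>\<in>space M. \<exists>j<m * 2 ^ k. \<epsilon> < \<bar>D k j \<omega>\<bar>}) \<longlonglongrightarrow> 0"
  shows "is_laplace (\<lambda>u. L u / L (exp (- (\<alpha> * a)) * u))"
proof -
  interpret w: iid_walk M "D k" \<alpha> "h k" a for k by (rule w)
  have al: "0 < \<alpha>" and a: "0 < a" using w.alpha_pos w.a_pos by auto
  have lap: "w.lap k n u = (\<integral>\<omega>. exp (- (u * (h k * (\<Sum>i<n. exp (- (\<alpha> * (\<Sum>j<i. D k j \<omega>))))))) \<partial>M)" for k n u
    by (simp add: w.lap_def w.area_def)
  have lim_k: "(\<lambda>k. w.lap k (m * 2 ^ k) u) \<longlonglongrightarrow> Lm m u" if "0 < u" for m u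
    unfolding lap by (rule lim_k[OF that])
  have stay: "w.prob {\<omega>\<in>space M. \<forall>j\<le>m * 2 ^ k. w.walk k j \<omega> < a} \<le> \<delta> m" if "m \<le> k" for m k
    unfolding w.walk_def by (rule stay[OF that])
  \<comment> \<open>The horizon is the time \<open>k\<close>, which eventually exceeds any fixed
    horizon \<open>m\<close>; a single sequence therefore serves all bounds.\<close>
  define G where "G k u = w.expectation (\<lambda>\<omega>. exp (- (u * w.stopped_area k (k * 2 ^ k) \<omega>)))" for k u
  have Lpos: "0 < L v" if "0 < v" for v using is_laplace_pos[OF L that] .
  show ?thesis
  proof (rule is_laplace_limit[of G])
    show "is_laplace (G k)" for k
      by (rule is_laplaceI[OF w.prob_space_axioms w.stopped_area_measurable])
        (auto simp: G_def w.stopped_area_nonneg)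
    have L0: "(L \<longlongrightarrow> 1) (at_right 0)" by (rule is_laplace_at_0[OF L])
    have "((\<lambda>u. L (exp (- (\<alpha> * a)) * u)) \<longlongrightarrow> 1) (at_right 0)"
      by (rule is_laplace_at_0[OF is_laplace_scale[OF L]]) simp
    then show "((\<lambda>u. L u / L (exp (- (\<alpha> * a)) * u)) \<longlongrightarrow> 1) (at_right 0)"
      using tendsto_divide[OF L0] by fastforce
    fix u :: real assume u: "0 < u"
    define v where "v = u * exp (- (\<alpha> * a))"
    have v: "0 < v" using u by (simp add: v_def)
    have upper: "eventually (\<lambda>k. G k u \<le> \<delta> m + w.lap k (m * 2 ^ k) u / w.lap k (m * 2 ^ k) v) sequentially"
      if "0 < Lm m v" for m
      using order_tendstoD(1)[OF lim_k[OF v] that] eventually_ge_at_top[of m]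
    proof eventually_elim
      case (elim k)
      have "G k u \<le> w.prob {\<omega>\<in>space M. \<forall>j\<le>m * 2 ^ k. w.walk k j \<omega> < a} + w.hit_lap k (m * 2 ^ k) u"
        unfolding G_def using u elim by (intro w.stopped_lap_upper) auto
      moreover have "w.hit_lap k (m * 2 ^ k) u \<le> w.lap k (m * 2 ^ k) u / w.lap k (m * 2 ^ k) v"
        unfolding pos_le_divide_eq[OF elim(1)]
        unfolding v_def using u by (intro w.hit_lap_upper) auto
      ultimately show ?case using stay[OF elim(2)] by linarith
    qed
    have lower: "eventually (\<lambda>k. (w.lap k ((m + m') * 2 ^ k) u - \<delta> m - w.prob {\<omega>\<in>space M. \<exists>j<m * 2 ^ k. \<epsilon> < \<bar>D k j \<omega>\<bar>})
        / w.lap k (m' * 2 ^ k) (u * exp (- (\<alpha> * (a + \<epsilon>)))) \<le> G k u) sequentially"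
      if "0 < Lm m' (u * exp (- (\<alpha> * (a + \<epsilon>))))" "0 < \<epsilon>" for m m' \<epsilon>
    proof -
      have x0: "0 < u * exp (- (\<alpha> * (a + \<epsilon>)))" using u by simp
      show ?thesis
      using order_tendstoD(1)[OF lim_k[OF x0] that(1)] eventually_ge_at_top[of m]
    proof eventually_elim
      case (elim k)
      let ?v = "u * exp (- (\<alpha> * (a + \<epsilon>)))"
      have "w.hit_lap k (m * 2 ^ k) u \<le> G k u"
        unfolding G_def using u elim by (intro w.stopped_lap_lower) auto
      then have "w.hit_lap k (m * 2 ^ k) u * w.lap k (m' * 2 ^ k) ?v \<le> G k u * w.lap k (m' * 2 ^ k) ?v"
        using elim by (intro mult_right_mono) auto
      moreover have "w.lap k (m * 2 ^ k + m' * 2 ^ k) u \<le> w.prob {\<omega>\<in>space M. \<forall>j\<le>m * 2 ^ k. w.walk k j \<omega> < a}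
          + w.prob {\<omega>\<in>space M. \<exists>j<m * 2 ^ k. \<epsilon> < \<bar>D k j \<omega>\<bar>} + w.hit_lap k (m * 2 ^ k) u * w.lap k (m' * 2 ^ k) ?v"
        using u that(2) by (intro w.lap_upper) auto
      ultimately have "w.lap k ((m + m') * 2 ^ k) u - \<delta> m - w.prob {\<omega>\<in>space M. \<exists>j<m * 2 ^ k. \<epsilon> < \<bar>D k j \<omega>\<bar>}
          \<le> G k u * w.lap k (m' * 2 ^ k) ?v"
        using stay[OF elim(2)] by (simp add: distrib_right)
      then show ?case using elim(1) by (simp add: divide_le_eq)
    qed
    qed
    have "(\<lambda>k. G k u) \<longlonglongrightarrow> L u / L v"
    proof (rule order_tendstoI)
      fix y assume y: "L u / L v < y"
      have "(\<lambda>m. \<delta> m + Lm m u / Lm m v) \<longlonglongrightarrow> 0 + L u / L v"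
        using Lpos[OF v] by (intro tendsto_intros delta lim_m u v) simp
      then have "eventually (\<lambda>m. \<delta> m + Lm m u / Lm m v < y) sequentially" using y by (auto intro: order_tendstoD)
      moreover have "eventually (\<lambda>m. 0 < Lm m v) sequentially" by (rule order_tendstoD(1)[OF lim_m[OF v] Lpos[OF v]])
      ultimately obtain m where m: "\<delta> m + Lm m u / Lm m v < y" "0 < Lm m v"
        using eventually_happens'[OF sequentially_bot eventually_conj] by blast
      have "(\<lambda>k. \<delta> m + w.lap k (m * 2 ^ k) u / w.lap k (m * 2 ^ k) v) \<longlonglongrightarrow> \<delta> m + Lm m u / Lm m v"
        using m by (intro tendsto_intros lim_k u v) simp
      then have "eventually (\<lambda>k. \<delta> m + w.lap k (m * 2 ^ k) u / w.lap k (m * 2 ^ k) v < y) sequentially"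
        using m by (auto intro: order_tendstoD)
      then show "eventually (\<lambda>k. G k u < y) sequentially" using upper[OF m(2)] by eventually_elim simp
    next
      \<comment> \<open>The parameters are chosen in the reverse order of the limits:
        \<open>\<epsilon>\<close> by continuity of \<open>L\<close> at \<open>v\<close>, then
        \<open>m\<close> to make \<open>\<delta> m\<close> harmless, then \<open>m'\<close> for the
        remaining time, and \<open>k\<close> last.\<close>
      fix y assume y: "y < L u / L v"
      have "(\<lambda>i. u * exp (- (\<alpha> * (a + 1 / real (Suc i))))) \<longlonglongrightarrow> u * exp (- (\<alpha> * (a + 0)))"
        using LIMSEQ_Suc[OF lim_1_over_n] by (intro tendsto_intros) simp
      then have "(\<lambda>i. L (u * exp (- (\<alpha> * (a + 1 / real (Suc i)))))) \<longlonglongrightarrow> L v"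
        using is_laplace_isCont[OF L v] by (intro isCont_tendsto_compose[of v L]) (auto simp: v_def)
      then have "(\<lambda>i. L u / L (u * exp (- (\<alpha> * (a + 1 / real (Suc i)))))) \<longlonglongrightarrow> L u / L v"
        using Lpos[OF v] by (intro tendsto_intros) auto
      then have "eventually (\<lambda>i. y < L u / L (u * exp (- (\<alpha> * (a + 1 / real (Suc i)))))) sequentially"
        using y by (auto intro: order_tendstoD)
      then obtain i where i: "y < L u / L (u * exp (- (\<alpha> * (a + 1 / real (Suc i)))))"
        using eventually_happens'[OF sequentially_bot] by blast
      define \<epsilon> where "\<epsilon> = 1 / real (Suc i)"
      have e: "0 < \<epsilon>" by (simp add: \<epsilon>_def)
      define x where "x = u * exp (- (\<alpha> * (a + \<epsilon>)))"
      have x: "0 < x" using u by (simp add: x_def)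
      have yx: "y < L u / L x" using i by (simp add: x_def \<epsilon>_def)
      have "(\<lambda>m. (L u - \<delta> m) / L x) \<longlonglongrightarrow> (L u - 0) / L x"
        using Lpos[OF x] by (intro tendsto_intros delta) simp
      then have "eventually (\<lambda>m. y < (L u - \<delta> m) / L x) sequentially" using yx by (auto intro: order_tendstoD)
      then obtain m where m: "y < (L u - \<delta> m) / L x"
        using eventually_happens'[OF sequentially_bot] by blast
      have "(\<lambda>m'. Lm (m + m') u) \<longlonglongrightarrow> L u"
        using LIMSEQ_ignore_initial_segment[OF lim_m[OF u], of m] by (simp add: add.commute)
      then have "(\<lambda>m'. (Lm (m + m') u - \<delta> m) / Lm m' x) \<longlonglongrightarrow> (L u - \<delta> m) / L x"
        using less_imp_neq[OF Lpos[OF x], symmetric] by (intro tendsto_intros lim_m x)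
      then have "eventually (\<lambda>m'. y < (Lm (m + m') u - \<delta> m) / Lm m' x) sequentially" using m by (auto intro: order_tendstoD)
      moreover have "eventually (\<lambda>m'. 0 < Lm m' x) sequentially" by (rule order_tendstoD(1)[OF lim_m[OF x] Lpos[OF x]])
      ultimately obtain m' where m': "y < (Lm (m + m') u - \<delta> m) / Lm m' x" "0 < Lm m' x"
        using eventually_happens'[OF sequentially_bot eventually_conj] by blast
      have "(\<lambda>k. (w.lap k ((m + m') * 2 ^ k) u - \<delta> m - w.prob {\<omega>\<in>space M. \<exists>j<m * 2 ^ k. \<epsilon> < \<bar>D k j \<omega>\<bar>})
          / w.lap k (m' * 2 ^ k) x) \<longlonglongrightarrow> (Lm (m + m') u - \<delta> m - 0) / Lm m' x"
        using m' by (intro tendsto_intros lim_k u x jump[OF e]) simp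
      then have "eventually (\<lambda>k. y < (w.lap k ((m + m') * 2 ^ k) u - \<delta> m - w.prob {\<omega>\<in>space M. \<exists>j<m * 2 ^ k. \<epsilon> < \<bar>D k j \<omega>\<bar>})
          / w.lap k (m' * 2 ^ k) x) sequentially" using m' by (auto intro: order_tendstoD)
      then show "eventually (\<lambda>k. y < G k u) sequentially"
        using lower[of m' \<epsilon> m, folded x_def, OF m'(2) e] by eventually_elim simp
    qed
    then show "(\<lambda>k. G k u) \<longlonglongrightarrow> L u / L (exp (- (\<alpha> * a)) * u)" by (simp add: v_def mult.commute)
  qed
qed

section \<open>The stochastic integral along dyadic partitions\<close>

lemma (in prob_space) integral_indep_var:
  fixes f :: "_ \<Rightarrow> complex"
  assumes ind: "indep_var S X T Y" and f[measurable]: "f \<in> borel_measurable (S \<Otimes>\<^sub>M T)"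
    and bd: "\<And>z. norm (f z) \<le> 1"
  shows "(LINT \<omega>|M. f (X \<omega>, Y \<omega>)) = (LINT \<omega>|M. LINT \<omega>'|M. f (X \<omega>, Y \<omega>'))"
proof -
  have X[measurable]: "X \<in> measurable M S" and Y[measurable]: "Y \<in> measurable M T"
    using ind indep_var_rv1 indep_var_rv2 by blast+
  interpret X: prob_space "distr M S X" by (rule prob_space_distr) simp
  interpret Y: prob_space "distr M T Y" by (rule prob_space_distr) simp
  have "(LINT \<omega>|M. f (X \<omega>, Y \<omega>)) = integral\<^sup>L (distr M (S \<Otimes>\<^sub>M T) (\<lambda>\<omega>. (X \<omega>, Y \<omega>))) f"
    by (rule integral_distr[symmetric]) auto
  also have "distr M (S \<Otimes>\<^sub>M T) (\<lambda>\<omega>. (X \<omega>, Y \<omega>)) = distr M S X \<Otimes>\<^sub>M distr M T Y"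
    using ind by (simp add: indep_var_distribution_eq)
  also have "integral\<^sup>L (distr M S X \<Otimes>\<^sub>M distr M T Y) f = (LINT x|distr M S X. LINT y|distr M T Y. f (x, y))"
    by (rule integral_pair_bounded[where C = 1]) (auto simp: bd X.prob_space_axioms Y.prob_space_axioms)
  also have "\<dots> = (LINT \<omega>|M. LINT y|distr M T Y. f (X \<omega>, y))"
    by (rule integral_distr[OF X]) measurable
  also have "\<dots> = (LINT \<omega>|M. LINT \<omega>'|M. f (X \<omega>, Y \<omega>'))"
  proof (rule Bochner_Integration.integral_cong[OF refl])
    fix \<omega> assume "\<omega> \<in> space M"
    then have "X \<omega> \<in> space S" using measurable_space[OF X] by blast
    then show "(LINT y|distr M T Y. f (X \<omega>, y)) = (LINT \<omega>'|M. f (X \<omega>, Y \<omega>'))"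
      by (intro integral_distr[OF Y]) measurable
  qed
  finally show ?thesis .
qed

lemma char_stable_increment:
  assumes "prob_space M" and levy: "levy_process M S"
    and chr: "\<And>t z. 0 \<le> t \<Longrightarrow> char (distr M borel (S t)) z = complex_of_real (exp (- (c * t * \<bar>z\<bar> powr \<alpha>)))"
    and st: "0 \<le> s" "s \<le> t"
  shows "(LINT \<omega>|M. iexp (z * (S t \<omega> - S s \<omega>))) = complex_of_real (exp (- (c * (t - s) * \<bar>z\<bar> powr \<alpha>)))"
proof -
  have m[measurable]: "\<And>t. 0 \<le> t \<Longrightarrow> S t \<in> borel_measurable M" and S0: "AE \<omega> in M. S 0 \<omega> = 0"
    and stat: "stationary_increments M S"
    using levy by (auto simp: levy_process_def)
  have [measurable]: "S t \<in> borel_measurable M" "S s \<in> borel_measurable M" "S 0 \<in> borel_measurable M" "S (t - s) \<in> borel_measurable M"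
    using st by (auto intro!: m)
  have "(LINT \<omega>|M. iexp (z * (S t \<omega> - S s \<omega>))) = char (distr M borel (\<lambda>\<omega>. S (s + (t - s)) \<omega> - S s \<omega>)) z"
    unfolding char_def by (subst integral_distr) auto
  also have "distr M borel (\<lambda>\<omega>. S (s + (t - s)) \<omega> - S s \<omega>) = distr M borel (\<lambda>\<omega>. S (t - s) \<omega> - S 0 \<omega>)"
    by (rule stat[unfolded stationary_increments_def, rule_format]) (use st in auto)
  also have "\<dots> = distr M borel (S (t - s))"
    by (rule distr_cong_AE) (use S0 in auto)
  finally show ?thesis using chr[of "t - s"] st by simp
qed

text \<open>Independence allows the path of \<open>B\<close> to be frozen. The sum then consists of
  independent stable increments with constant weights; raising the weights to the power
  \<open>\<alpha>\<close> produces the Riemann sum of the exponential functional in the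
  exponent.\<close>

lemma char_elementary_integral:
  fixes B S :: "real \<Rightarrow> 'a \<Rightarrow> real"
  assumes M: "prob_space M" and levy: "levy_process M S"
    and chr: "\<And>t z. 0 \<le> t \<Longrightarrow> char (distr M borel (S t)) z = complex_of_real (exp (- (c * t * \<bar>z\<bar> powr \<alpha>)))"
    and Bm: "\<And>t. 0 \<le> t \<Longrightarrow> B t \<in> borel_measurable M"
    and ind: "independent_processes M B S"
    and t: "0 \<le> t 0" "\<And>i. i < n \<Longrightarrow> t i < t (Suc i)"
  shows "(LINT \<omega>|M. iexp (z * (\<Sum>i<n. exp (- (B (t i) \<omega> + lam * t i)) * (S (t (Suc i)) \<omega> - S (t i) \<omega>))))
    = complex_of_real (LINT \<omega>|M. exp (- (c * \<bar>z\<bar> powr \<alpha> * (\<Sum>i<n. (t (Suc i) - t i) * exp (- (\<alpha> * (B (t i) \<omega> + lam * t i)))))))"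
proof -
  interpret prob_space M by (rule M)
  have tpos: "0 \<le> t i" if "i \<le> n" for i
    using that by (induction i) (use t in \<open>auto intro: order_trans less_imp_le simp: Suc_le_eq\<close>)
  have Sm[measurable]: "\<And>t. 0 \<le> t \<Longrightarrow> S t \<in> borel_measurable M" using levy by (auto simp: levy_process_def)
  define g where "g i x = exp (- (x (t i) + lam * t i))" for i and x :: "real \<Rightarrow> real"
  define f where "f p = iexp (z * (\<Sum>i<n. g i (fst p) * (snd p (t (Suc i)) - snd p (t i))))" for p :: "(real \<Rightarrow> real) \<times> (real \<Rightarrow> real)"
  let ?X = "\<lambda>\<omega>. \<lambda>t\<in>{0..}. B t \<omega>" and ?Y = "\<lambda>\<omega>. \<lambda>t\<in>{0..}. S t \<omega>"
  let ?P = "PiM {0..} (\<lambda>_. borel) :: (real \<Rightarrow> real) measure"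
  have comp: "(\<lambda>x. x s) \<in> borel_measurable ?P" if "0 \<le> s" for s
    using that by (intro measurable_component_singleton) auto
  have gm: "g i \<in> borel_measurable ?P" if "i < n" for i
    unfolding g_def
    by (intro measurable_compose[OF _ borel_measurable_exp] borel_measurable_uminus borel_measurable_add comp tpos borel_measurable_const) (use that in auto)
  have fm: "f \<in> borel_measurable (?P \<Otimes>\<^sub>M ?P)"
  proof -
    have "(\<lambda>p. z * (\<Sum>i<n. g i (fst p) * (snd p (t (Suc i)) - snd p (t i)))) \<in> borel_measurable (?P \<Otimes>\<^sub>M ?P)"
      by (intro borel_measurable_times borel_measurable_const borel_measurable_sum borel_measurable_diff
          measurable_compose[OF measurable_fst gm] measurable_compose[OF measurable_snd comp] tpos) auto
    then show ?thesis unfolding f_def by measurable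
  qed
  have fn: "norm (f p) \<le> 1" for p by (simp add: f_def)
  have inc: "indep_vars (\<lambda>_. borel) (\<lambda>i \<omega>. S (t (Suc i)) \<omega> - S (t i) \<omega>) {..<n}"
    using levy t unfolding levy_process_def independent_increments_def by auto
  have "(LINT \<omega>|M. iexp (z * (\<Sum>i<n. exp (- (B (t i) \<omega> + lam * t i)) * (S (t (Suc i)) \<omega> - S (t i) \<omega>))))
      = (LINT \<omega>|M. f (?X \<omega>, ?Y \<omega>))"
    by (intro Bochner_Integration.integral_cong refl) (auto simp: f_def g_def tpos intro!: sum.cong arg_cong[where f = exp])
  also have "\<dots> = (LINT \<omega>|M. LINT \<omega>'|M. f (?X \<omega>, ?Y \<omega>'))"
    by (rule integral_indep_var[OF ind[unfolded independent_processes_def] fm fn])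
  also have "\<dots> = (LINT \<omega>|M. complex_of_real (exp (- (c * \<bar>z\<bar> powr \<alpha> * (\<Sum>i<n. (t (Suc i) - t i) * exp (- (\<alpha> * (B (t i) \<omega> + lam * t i))))))))"
  proof (rule Bochner_Integration.integral_cong[OF refl])
    fix \<omega> assume "\<omega> \<in> space M"
    define w where "w i = z * exp (- (B (t i) \<omega> + lam * t i))" for i
    have w: "\<bar>w i\<bar> powr \<alpha> = \<bar>z\<bar> powr \<alpha> * exp (- (\<alpha> * (B (t i) \<omega> + lam * t i)))" for i
      by (simp add: w_def abs_mult powr_mult exp_powr_real algebra_simps)
    have "f (?X \<omega>, ?Y \<omega>') = (\<Prod>i<n. iexp (w i * (S (t (Suc i)) \<omega>' - S (t i) \<omega>')))" for \<omega>'
      unfolding f_def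
      by (simp add: exp_sum[symmetric] sum_distrib_left g_def tpos w_def mult_ac cong: sum.cong_simp)
    then have "(LINT \<omega>'|M. f (?X \<omega>, ?Y \<omega>')) = (LINT \<omega>'|M. (\<Prod>i<n. iexp (w i * (S (t (Suc i)) \<omega>' - S (t i) \<omega>'))))"
      by simp
    also have "\<dots> = (\<Prod>i<n. (LINT \<omega>'|M. iexp (w i * (S (t (Suc i)) \<omega>' - S (t i) \<omega>'))))"
    proof (rule indep_vars_lebesgue_integral)
      show "indep_vars (\<lambda>_. borel) (\<lambda>i \<omega>'. iexp (w i * (S (t (Suc i)) \<omega>' - S (t i) \<omega>'))) {..<n}"
        by (rule indep_vars_compose2[OF inc]) measurable
      show "integrable M (\<lambda>\<omega>'. iexp (w i * (S (t (Suc i)) \<omega>' - S (t i) \<omega>')))" if "i \<in> {..<n}" for i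
      proof (rule integrable_const_bound[where B = 1])
        have [measurable]: "S (t (Suc i)) \<in> borel_measurable M" "S (t i) \<in> borel_measurable M"
          using that by (auto intro!: Sm tpos)
        show "(\<lambda>\<omega>'. iexp (w i * (S (t (Suc i)) \<omega>' - S (t i) \<omega>'))) \<in> borel_measurable M" by measurable
      qed simp
    qed simp
    also have "\<dots> = (\<Prod>i<n. complex_of_real (exp (- (c * (t (Suc i) - t i) * \<bar>w i\<bar> powr \<alpha>))))"
      by (intro prod.cong refl char_stable_increment[OF M levy chr]) (auto intro!: tpos less_imp_le[OF t(2)])
    also have "\<dots> = complex_of_real (exp (\<Sum>i<n. - (c * (t (Suc i) - t i) * \<bar>w i\<bar> powr \<alpha>)))"
      by (simp add: exp_sum)
    also have "(\<Sum>i<n. - (c * (t (Suc i) - t i) * \<bar>w i\<bar> powr \<alpha>))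
        = - (c * \<bar>z\<bar> powr \<alpha> * (\<Sum>i<n. (t (Suc i) - t i) * exp (- (\<alpha> * (B (t i) \<omega> + lam * t i)))))"
      by (simp add: w sum_negf sum_distrib_left mult_ac)
    finally show "(LINT \<omega>'|M. f (?X \<omega>, ?Y \<omega>')) = complex_of_real (exp (- (c * \<bar>z\<bar> powr \<alpha> * (\<Sum>i<n. (t (Suc i) - t i) * exp (- (\<alpha> * (B (t i) \<omega> + lam * t i)))))))" .
  qed
  also have "\<dots> = complex_of_real (LINT \<omega>|M. exp (- (c * \<bar>z\<bar> powr \<alpha> * (\<Sum>i<n. (t (Suc i) - t i) * exp (- (\<alpha> * (B (t i) \<omega> + lam * t i)))))))"
    by simp
  finally show ?thesis .
qed

text \<open>Rational times keep the event measurable without any completeness, and they contain the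
  dyadic grids.\<close>

definition oscillation_event :: "'a measure \<Rightarrow> (real \<Rightarrow> 'a \<Rightarrow> real) \<Rightarrow> real \<Rightarrow> real \<Rightarrow> nat \<Rightarrow> 'a set" where
  "oscillation_event M X T \<epsilon> k =
     {\<omega>\<in>space M. \<exists>r\<in>\<rat> \<inter> {0..T}. \<exists>s\<in>\<rat> \<inter> {0..T}. \<bar>r - s\<bar> \<le> 1 / 2 ^ k \<and> \<epsilon> < \<bar>X r \<omega> - X s \<omega>\<bar>}"

lemma oscillation_event_sets:
  assumes "\<And>t. 0 \<le> t \<Longrightarrow> X t \<in> borel_measurable M"
  shows "oscillation_event M X T \<epsilon> k \<in> sets M"
proof -
  have "oscillation_event M X T \<epsilon> k = (\<Union>r\<in>\<rat> \<inter> {0..T}. \<Union>s\<in>\<rat> \<inter> {0..T}.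
      (if \<bar>r - s\<bar> \<le> 1 / 2 ^ k then {\<omega>\<in>space M. \<epsilon> < \<bar>X r \<omega> - X s \<omega>\<bar>} else {}))"
    by (auto simp: oscillation_event_def split: if_splits)
  moreover have "{\<omega>\<in>space M. \<epsilon> < \<bar>X r \<omega> - X s \<omega>\<bar>} \<in> sets M" if "0 \<le> r" "0 \<le> s" for r s
  proof -
    have [measurable]: "X r \<in> borel_measurable M" "X s \<in> borel_measurable M" using assms that by auto
    show ?thesis by measurable
  qed
  ultimately show ?thesis
    by (auto intro!: sets.countable_UN' countable_Int1 countable_rat)
qed

text \<open>The events decrease in \<open>k\<close>, and uniform continuity on the compact interval
  excludes every continuous path from their intersection.\<close>

lemma oscillation_event_tendsto:
  assumes M: "prob_space M" and m: "\<And>t. 0 \<le> t \<Longrightarrow> X t \<in> borel_measurable M"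
    and cont: "AE \<omega> in M. continuous_on {0..} (\<lambda>t. X t \<omega>)" and e: "0 < \<epsilon>"
  shows "(\<lambda>k. measure M (oscillation_event M X T \<epsilon> k)) \<longlonglongrightarrow> 0"
proof -
  interpret prob_space M by (rule M)
  have dec: "decseq (oscillation_event M X T \<epsilon>)"
  proof (rule decseq_SucI)
    fix k
    have "(1::real) / 2 ^ Suc k \<le> 1 / 2 ^ k" by (simp add: field_simps)
    then show "oscillation_event M X T \<epsilon> (Suc k) \<subseteq> oscillation_event M X T \<epsilon> k"
      unfolding oscillation_event_def by (blast intro: order_trans)
  qed
  have "(\<lambda>k. measure M (oscillation_event M X T \<epsilon> k)) \<longlonglongrightarrow> measure M (\<Inter>k. oscillation_event M X T \<epsilon> k)"
    by (rule finite_Lim_measure_decseq[OF _ dec]) (use oscillation_event_sets[OF m] in auto)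
  moreover have "measure M (\<Inter>k. oscillation_event M X T \<epsilon> k) = 0"
  proof -
    have "AE \<omega> in M. \<omega> \<notin> (\<Inter>k. oscillation_event M X T \<epsilon> k)"
      using cont
    proof eventually_elim
      case (elim \<omega>)
      have "uniformly_continuous_on {0..T} (\<lambda>t. X t \<omega>)"
        by (rule compact_uniformly_continuous) (auto intro: continuous_on_subset[OF elim])
      then obtain d where d: "0 < d" "\<And>r s. r \<in> {0..T} \<Longrightarrow> s \<in> {0..T} \<Longrightarrow> dist s r < d \<Longrightarrow> dist (X s \<omega>) (X r \<omega>) < \<epsilon>"
        using e unfolding uniformly_continuous_on_def by metis
      obtain k where k: "(1/2) ^ k < d" using real_arch_pow_inv[OF d(1), of "1/2"] by auto
      have "\<omega> \<notin> oscillation_event M X T \<epsilon> k"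
      proof
        assume "\<omega> \<in> oscillation_event M X T \<epsilon> k"
        then obtain r s where rs: "r \<in> {0..T}" "s \<in> {0..T}" "\<bar>r - s\<bar> \<le> 1 / 2 ^ k" "\<epsilon> < \<bar>X r \<omega> - X s \<omega>\<bar>"
          unfolding oscillation_event_def by blast
        have "dist r s < d" using rs(3) k by (simp add: dist_real_def power_one_over)
        then have "\<bar>X r \<omega> - X s \<omega>\<bar> < \<epsilon>" using d(2)[OF rs(2,1)] by (simp add: dist_real_def)
        then show False using rs(4) by simp
      qed
      then show ?case by blast
    qed
    moreover have "(\<Inter>k. oscillation_event M X T \<epsilon> k) \<in> sets M"
      using oscillation_event_sets[OF m] by (intro sets.countable_INT) auto
    ultimately show ?thesis by (simp add: prob_eq_0)
  qed
  ultimately show ?thesis by simp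
qed

lemma rational_grid: "real i / 2 ^ k \<in> \<rat>"
  by (intro Rats_divide Rats_power Rats_number_of Rats_of_nat)

text \<open>A violation at a real time \<open>s\<close> persists, by continuity, at a rational time
  between \<open>q\<close> and \<open>s\<close>, which is still within one mesh of
  \<open>q\<close>.\<close>

lemma oscillation_continuous_bound:
  assumes cont: "continuous_on {0..} (\<lambda>t. X t \<omega>)" and \<omega>: "\<omega> \<in> space M" "\<omega> \<notin> oscillation_event M X T \<epsilon> k"
    and q: "q \<in> \<rat>" "0 \<le> q" "q < s" "s \<le> T" "s - q \<le> 1 / 2 ^ k"
  shows "\<bar>X q \<omega> - X s \<omega>\<bar> \<le> \<epsilon>"
proof (rule ccontr)
  assume "\<not> ?thesis"
  then have gap: "0 < \<bar>X q \<omega> - X s \<omega>\<bar> - \<epsilon>" by simp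
  then obtain d where d: "0 < d" "\<And>r. r \<in> {0..} \<Longrightarrow> dist r s < d \<Longrightarrow> dist (X r \<omega>) (X s \<omega>) < \<bar>X q \<omega> - X s \<omega>\<bar> - \<epsilon>"
    using cont[unfolded continuous_on_iff, rule_format, of s, OF _ gap] q by auto
  obtain r where r: "r \<in> \<rat>" "max q (s - d) < r" "r < s"
    using Rats_dense_in_real[of "max q (s - d)" s] q d by auto
  have "dist (X r \<omega>) (X s \<omega>) < \<bar>X q \<omega> - X s \<omega>\<bar> - \<epsilon>"
    using r q by (intro d) (auto simp: dist_real_def)
  then have "\<epsilon> < \<bar>X q \<omega> - X r \<omega>\<bar>" unfolding dist_real_def by linarith
  moreover have "\<bar>q - r\<bar> \<le> 1 / 2 ^ k" using r q by auto
  moreover have "q \<in> \<rat> \<inter> {0..T}" "r \<in> \<rat> \<inter> {0..T}" using r q by auto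
  ultimately have "\<omega> \<in> oscillation_event M X T \<epsilon> k"
    unfolding oscillation_event_def using \<omega>(1) by blast
  then show False using \<omega>(2) by simp
qed

text \<open>The error at time \<open>s\<close> compares \<open>X\<close> at \<open>s\<close> with
  \<open>X\<close> at the left end of its dyadic cell, so an oscillation event and a null set cover
  it. The \<open>k * 2 ^ k\<close> cells reach time \<open>k\<close>, which eventually exceeds
  \<open>t\<close>.\<close>

lemma dyadic_step_ucp:
  assumes M: "prob_space M" and m: "\<And>t. 0 \<le> t \<Longrightarrow> X t \<in> borel_measurable M"
    and cont: "AE \<omega> in M. continuous_on {0..} (\<lambda>t. X t \<omega>)"
  shows "ucp_tendsto M (\<lambda>k. simple_process (k * 2 ^ k) (\<lambda>i _. real i / 2 ^ k) (X 0) (\<lambda>i. X (real i / 2 ^ k))) X"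
  unfolding ucp_tendsto_def
proof (intro allI impI)
  interpret prob_space M by (rule M)
  fix t \<epsilon> \<delta> :: real assume t: "0 \<le> t" and e: "0 < \<epsilon>" and d: "0 < \<delta>"
  obtain N where N: "N \<in> null_sets M" "{\<omega>\<in>space M. \<not> continuous_on {0..} (\<lambda>t. X t \<omega>)} \<subseteq> N"
    using AE_E2[OF cont] cont by (auto elim!: AE_E)
  have "eventually (\<lambda>k. measure M (oscillation_event M X t \<epsilon> k) < \<delta>) sequentially"
    by (rule order_tendstoD(2)[OF oscillation_event_tendsto[OF M m cont e] d])
  moreover have "eventually (\<lambda>k. t \<le> real k) sequentially"
    using filterlim_real_sequentially by (simp add: filterlim_at_top)
  ultimately show "\<forall>\<^sub>F k in sequentially. \<exists>A\<in>sets M. measure M A < \<delta> \<and>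
      {\<omega> \<in> space M. \<exists>s\<in>{0..t}. \<epsilon> < \<bar>simple_process (k * 2 ^ k) (\<lambda>i _. real i / 2 ^ k) (X 0) (\<lambda>i. X (real i / 2 ^ k)) s \<omega> - X s \<omega>\<bar>} \<subseteq> A"
  proof eventually_elim
    case (elim k)
    let ?O = "oscillation_event M X t \<epsilon> k"
    have Om: "?O \<in> sets M" by (rule oscillation_event_sets[OF m])
    show ?case
    proof (intro bexI[of _ "?O \<union> N"] conjI subsetI)
      show "?O \<union> N \<in> sets M" using Om N by auto
      show "measure M (?O \<union> N) < \<delta>" using elim(1) measure_Un_null_set[OF Om N(1)] by simp
      fix \<omega> assume "\<omega> \<in> {\<omega> \<in> space M. \<exists>s\<in>{0..t}. \<epsilon> < \<bar>simple_process (k * 2 ^ k) (\<lambda>i _. real i / 2 ^ k) (X 0) (\<lambda>i. X (real i / 2 ^ k)) s \<omega> - X s \<omega>\<bar>}"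
      then obtain s where \<omega>: "\<omega> \<in> space M" and s: "0 \<le> s" "s \<le> t"
        and gt: "\<epsilon> < \<bar>simple_process (k * 2 ^ k) (\<lambda>i _. real i / 2 ^ k) (X 0) (\<lambda>i. X (real i / 2 ^ k)) s \<omega> - X s \<omega>\<bar>"
        by auto
      show "\<omega> \<in> ?O \<union> N"
      proof (rule ccontr)
        assume not: "\<omega> \<notin> ?O \<union> N"
        then have c: "continuous_on {0..} (\<lambda>t. X t \<omega>)" using N(2) \<omega> by auto
        show False
        proof (cases "s = 0")
          case True
          then have "indicator {real i / 2 ^ k<..real (Suc i) / 2 ^ k} s = (0::real)" for i
            by (simp add: indicator_def not_less)
          then have "simple_process (k * 2 ^ k) (\<lambda>i _. real i / 2 ^ k) (X 0) (\<lambda>i. X (real i / 2 ^ k)) s \<omega> = X 0 \<omega>"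
            using True by (simp add: simple_process_def)
          then show False using gt True e by simp
        next
          case False
          then have sp: "0 < s" using s by simp
          \<comment> \<open>The cell index: cells are open on the left and closed on the right,
            hence a ceiling minus one.\<close>
          define j where "j = nat (\<lceil>s * 2 ^ k\<rceil> - 1)"
          have cp: "1 \<le> \<lceil>s * 2 ^ k\<rceil>" using sp by (simp add: int_one_le_iff_zero_less)
          then have rj: "real j = of_int \<lceil>s * 2 ^ k\<rceil> - 1" by (simp add: j_def)
          have j1: "real j < s * 2 ^ k" and j2: "s * 2 ^ k \<le> real j + 1" unfolding rj by linarith+
          have j1': "real j / 2 ^ k < s" and j2': "s \<le> real (Suc j) / 2 ^ k"
            using j1 j2 by (auto simp: field_simps)
          have jn: "j < k * 2 ^ k"
          proof -
            have "real j < real k * 2 ^ k" using j1 s elim(2) by (smt (verit) mult_right_mono zero_le_power)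
            then have "real j < real (k * 2 ^ k)" by simp
            then show ?thesis by linarith
          qed
          have ind: "indicator {real i / 2 ^ k<..real (Suc i) / 2 ^ k} s = (if i = j then 1 else (0::real))" for i
          proof (cases i j rule: linorder_cases)
            case less
            then have "real (Suc i) \<le> real j" by linarith
            then have "real (Suc i) / 2 ^ k \<le> real j / 2 ^ k" by (intro divide_right_mono) auto
            then show ?thesis using less j1' by (auto simp: indicator_def)
          next
            case greater
            then have "real (Suc j) \<le> real i" by linarith
            then have "real (Suc j) / 2 ^ k \<le> real i / 2 ^ k" by (intro divide_right_mono) auto
            then show ?thesis using greater j2' by (auto simp: indicator_def)
          qed (use j1' j2' in \<open>auto simp: indicator_def\<close>)
          have "simple_process (k * 2 ^ k) (\<lambda>i _. real i / 2 ^ k) (X 0) (\<lambda>i. X (real i / 2 ^ k)) s \<omega> = X (real j / 2 ^ k) \<omega>"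
            unfolding simple_process_def ind using jn sp by (simp add: if_distrib[of "\<lambda>x. _ * x"] cong: if_cong)
          moreover have "\<bar>X (real j / 2 ^ k) \<omega> - X s \<omega>\<bar> \<le> \<epsilon>"
          proof (rule oscillation_continuous_bound[where M = M and X = X and T = t and k = k and q = "real j / 2 ^ k" and s = s])
            show "s - real j / 2 ^ k \<le> 1 / 2 ^ k" using j2' by (simp add: add_divide_distrib)
          qed (use c \<omega> not rational_grid j1' s in auto)
          ultimately show False using gt by simp
        qed
      qed
    qed
  qed
qed

section \<open>Adaptedness of the dyadic integrands\<close>

lemma filtration_joint_natural: "filtration (space M) (joint_natural_filtration M X Y)"
proof
  fix s t :: real
  have sub: "{X s -` A \<inter> space M | s A. s \<in> {0..t} \<and> A \<in> sets borel} \<union>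
        {Y s -` A \<inter> space M | s A. s \<in> {0..t} \<and> A \<in> sets borel} \<subseteq> Pow (space M)" for t by auto
  show "space (joint_natural_filtration M X Y s) = space M"
    unfolding joint_natural_filtration_def by (rule space_measure_of[OF sub])
  assume "s \<le> t"
  then have "{0..s} \<subseteq> {0..t}" by auto
  then show "sets (joint_natural_filtration M X Y s) \<subseteq> sets (joint_natural_filtration M X Y t)"
    unfolding joint_natural_filtration_def sets_measure_of[OF sub]
    by (intro sigma_sets_mono' Un_mono Collect_mono) blast+
qed

lemma joint_natural_measurable:
  assumes "0 \<le> t" shows "X t \<in> borel_measurable (joint_natural_filtration M X Y t)"
proof (rule measurableI)
  interpret filtration "space M" "joint_natural_filtration M X Y" by (rule filtration_joint_natural)
  have sub: "{X s -` A \<inter> space M | s A. s \<in> {0..t} \<and> A \<in> sets borel} \<union>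
        {Y s -` A \<inter> space M | s A. s \<in> {0..t} \<and> A \<in> sets borel} \<subseteq> Pow (space M)" by auto
  fix A :: "real set" assume A: "A \<in> sets borel"
  show "X t -` A \<inter> space (joint_natural_filtration M X Y t) \<in> sets (joint_natural_filtration M X Y t)"
    unfolding space_F unfolding joint_natural_filtration_def sets_measure_of[OF sub]
    by (rule sigma_sets.Basic) (use A assms in auto)
qed simp

lemma dyadic_simple_predictable:
  assumes F: "filtration (space M) F" and X: "\<And>t. 0 \<le> t \<Longrightarrow> X t \<in> borel_measurable (F t)"
  shows "simple_predictable M F n (\<lambda>i _. real i / 2 ^ k) (X 0) (\<lambda>i. X (real i / 2 ^ k))"
proof -
  interpret filtration "space M" F by (rule F)
  have pre: "X c \<in> borel_measurable (pre_sigma (\<lambda>_. c))" if c: "0 \<le> c" for c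
  proof (rule measurableI)
    fix A :: "real set" assume A: "A \<in> sets borel"
    show "X c -` A \<inter> space (pre_sigma (\<lambda>_. c)) \<in> sets (pre_sigma (\<lambda>_. c))"
    proof (rule sets_pre_sigmaI[OF stopping_time_const])
      fix t
      have "X c -` A \<inter> space M \<in> sets (F c)" using measurable_sets[OF X[OF c] A] by (simp add: space_F)
      then show "{\<omega> \<in> X c -` A \<inter> space (pre_sigma (\<lambda>_. c)). c \<le> t} \<in> sets (F t)"
        using sets_F_mono[of c t] by (cases "c \<le> t") (auto simp: space_pre_sigma vimage_def Int_def)
    qed
  qed simp
  show ?thesis
    unfolding simple_predictable_def
    by (auto intro!: stopping_time_const X pre divide_right_mono)
qed

section \<open>From ucp convergence to characteristic functions\<close>

lemma norm_iexp_diff_le: "norm (iexp a - iexp b) \<le> \<bar>a - b\<bar>"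
proof -
  have "iexp a - iexp b = iexp b * (iexp (a - b) - 1)" by (simp add: algebra_simps flip: exp_add)
  then have "norm (iexp a - iexp b) = norm (iexp (a - b) - (\<Sum>k\<le>0. (\<i> * of_real (a - b)) ^ k / fact k))"
    by (simp add: norm_mult)
  also have "\<dots> \<le> \<bar>a - b\<bar> ^ Suc 0 / fact (Suc 0)" by (rule iexp_approx1)
  finally show ?thesis by simp
qed

text \<open>Off the covering set of small measure the Lipschitz bound for \<open>iexp\<close>
  applies; on it the integrands differ by at most 2.\<close>

lemma ucp_char_tendsto:
  assumes M: "prob_space M" and ucp: "ucp_tendsto M I Y" and t: "0 \<le> t"
    and Im[measurable]: "\<And>k. I k t \<in> borel_measurable M" and Ym[measurable]: "Y t \<in> borel_measurable M"
  shows "(\<lambda>k. LINT \<omega>|M. iexp (z * I k t \<omega>)) \<longlonglongrightarrow> (LINT \<omega>|M. iexp (z * Y t \<omega>))"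
proof (rule tendstoI)
  interpret prob_space M by (rule M)
  fix e :: real assume e: "0 < e"
  \<comment> \<open>The summand 1 avoids division by zero when \<open>z = 0\<close>.\<close>
  define \<epsilon> where "\<epsilon> = e / (2 * (\<bar>z\<bar> + 1))"
  have eps: "0 < \<epsilon>" using e by (simp add: \<epsilon>_def)
  have ze: "\<bar>z\<bar> * \<epsilon> \<le> e / 2"
  proof -
    have "\<bar>z\<bar> * \<epsilon> \<le> (\<bar>z\<bar> + 1) * \<epsilon>" using eps by simp
    also have "\<dots> = e / 2" by (simp add: \<epsilon>_def field_simps)
    finally show ?thesis .
  qed
  have "\<forall>\<^sub>F k in sequentially. \<exists>A\<in>sets M. measure M A < e / 4 \<and> {\<omega>\<in>space M. \<exists>s\<in>{0..t}. \<bar>I k s \<omega> - Y s \<omega>\<bar> > \<epsilon>} \<subseteq> A"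
    by (rule ucp[unfolded ucp_tendsto_def, rule_format]) (use t eps e in auto)
  then show "\<forall>\<^sub>F k in sequentially. dist (LINT \<omega>|M. iexp (z * I k t \<omega>)) (LINT \<omega>|M. iexp (z * Y t \<omega>)) < e"
  proof eventually_elim
    case (elim k)
    then obtain A where A: "A \<in> sets M" "measure M A < e / 4" "{\<omega>\<in>space M. \<exists>s\<in>{0..t}. \<bar>I k s \<omega> - Y s \<omega>\<bar> > \<epsilon>} \<subseteq> A" by auto
    have i: "integrable M (\<lambda>\<omega>. iexp (z * I k t \<omega>))" "integrable M (\<lambda>\<omega>. iexp (z * Y t \<omega>))"
      by (auto intro!: integrable_const_bound[where B = 1])
    have iA: "integrable M (\<lambda>\<omega>. e / 2 + 2 * indicator A \<omega> :: real)"
      by (intro Bochner_Integration.integrable_add integrable_mult_right integrable_real_indicator A) (auto simp: emeasure_eq_measure)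
    have "norm ((LINT \<omega>|M. iexp (z * I k t \<omega>)) - (LINT \<omega>|M. iexp (z * Y t \<omega>)))
        = norm (LINT \<omega>|M. iexp (z * I k t \<omega>) - iexp (z * Y t \<omega>))"
      using i by simp
    also have "\<dots> \<le> (LINT \<omega>|M. norm (iexp (z * I k t \<omega>) - iexp (z * Y t \<omega>)))" by (rule integral_norm_bound)
    also have "\<dots> \<le> (LINT \<omega>|M. e / 2 + 2 * indicator A \<omega>)"
    proof (rule integral_mono)
      show "integrable M (\<lambda>\<omega>. norm (iexp (z * I k t \<omega>) - iexp (z * Y t \<omega>)))"
        by (intro integrable_norm Bochner_Integration.integrable_diff i)
      show "integrable M (\<lambda>\<omega>. e / 2 + 2 * indicator A \<omega> :: real)" by (rule iA)
      fix \<omega> assume \<omega>: "\<omega> \<in> space M"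
      show "norm (iexp (z * I k t \<omega>) - iexp (z * Y t \<omega>)) \<le> e / 2 + 2 * indicator A \<omega>"
      proof (cases "\<omega> \<in> A")
        case True
        have "norm (iexp (z * I k t \<omega>) - iexp (z * Y t \<omega>)) \<le> norm (iexp (z * I k t \<omega>)) + norm (iexp (z * Y t \<omega>))"
          by (rule norm_triangle_ineq4)
        also have "\<dots> = 2" by simp
        finally show ?thesis using True e by simp
      next
        case False
        then have "\<bar>I k t \<omega> - Y t \<omega>\<bar> \<le> \<epsilon>" using A(3) \<omega> t by (force simp: not_less)
        then have "\<bar>z\<bar> * \<bar>I k t \<omega> - Y t \<omega>\<bar> \<le> \<bar>z\<bar> * \<epsilon>" by (intro mult_left_mono) auto
        moreover have "norm (iexp (z * I k t \<omega>) - iexp (z * Y t \<omega>)) \<le> \<bar>z * I k t \<omega> - z * Y t \<omega>\<bar>"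
          by (rule norm_iexp_diff_le)
        moreover have "\<bar>z * I k t \<omega> - z * Y t \<omega>\<bar> = \<bar>z\<bar> * \<bar>I k t \<omega> - Y t \<omega>\<bar>"
          by (simp add: abs_mult flip: right_diff_distrib)
        ultimately show ?thesis using ze False by simp
      qed
    qed
    also have "\<dots> = e / 2 + 2 * measure M A"
      using A by (subst Bochner_Integration.integral_add) (auto simp: prob_space emeasure_eq_measure intro!: integrable_real_indicator integrable_mult_right)
    also have "\<dots> < e" using A(2) by simp
    finally show ?case by (simp add: dist_norm)
  qed
qed

text \<open>The radius inverts \<open>u = c * z powr \<alpha>\<close>. Continuity of a
  characteristic function at 0 thus supplies the condition at 0 in
  \<open>is_laplace_limit\<close>.\<close>

lemma char_radial_at_0:
  assumes "real_distribution \<mu>" "0 < \<alpha>" "0 < c"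
  shows "((\<lambda>u. Re (char \<mu> ((u / c) powr (1 / \<alpha>)))) \<longlongrightarrow> 1) (at_right 0)"
proof -
  interpret real_distribution \<mu> by fact
  have "((\<lambda>u. (u / c) powr (1 / \<alpha>)) \<longlongrightarrow> (0 / c) powr (1 / \<alpha>)) (at_right 0)"
    using assms by (intro tendsto_powr' tendsto_divide tendsto_ident_at tendsto_const) (auto simp: eventually_at_filter)
  then have "((\<lambda>u. (u / c) powr (1 / \<alpha>)) \<longlongrightarrow> 0) (at_right 0)" by simp
  then have "((\<lambda>u. char \<mu> ((u / c) powr (1 / \<alpha>))) \<longlongrightarrow> char \<mu> 0) (at_right 0)"
    by (rule isCont_tendsto_compose[OF isCont_char])
  then have "((\<lambda>u. Re (char \<mu> ((u / c) powr (1 / \<alpha>)))) \<longlongrightarrow> Re (char \<mu> 0)) (at_right 0)"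
    by (rule tendsto_Re)
  then show ?thesis by (simp add: char_zero)
qed

lemma brownian_grid_walk:
  assumes M: "prob_space M" and bm: "standard_brownian_motion M B" and "0 < \<alpha>" "0 < a"
  shows "iid_walk M (\<lambda>i \<omega>. (B (real (Suc i) / 2 ^ k) \<omega> - B (real i / 2 ^ k) \<omega>) + lam / 2 ^ k) \<alpha> (1 / 2 ^ k) a"
proof -
  interpret prob_space M by (rule M)
  have Bm: "B t \<in> borel_measurable M" if "0 \<le> t" for t using bm that by (auto simp: standard_brownian_motion_def)
  have [measurable]: "B (real i / 2 ^ k) \<in> borel_measurable M" for i by (rule Bm) simp
  let ?d = "\<lambda>i \<omega>. B (real (Suc i) / 2 ^ k) \<omega> - B (real i / 2 ^ k) \<omega>"
  have law: "distr M borel (?d i) = density lborel (normal_density 0 (sqrt (1 / 2 ^ k)))" for i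
  proof -
    have "distributed M lborel (?d i) (normal_density 0 (sqrt (real (Suc i) / 2 ^ k - real i / 2 ^ k)))"
      using bm unfolding standard_brownian_motion_def by (auto simp: divide_strict_right_mono)
    then have "distr M lborel (?d i) = density lborel (normal_density 0 (sqrt (real (Suc i) / 2 ^ k - real i / 2 ^ k)))"
      by (simp add: distributed_def)
    moreover have "real (Suc i) / 2 ^ k - real i / 2 ^ k = 1 / 2 ^ k" by (simp add: diff_divide_distrib[symmetric])
    moreover have "distr M borel (?d i) = distr M lborel (?d i)" by (rule distr_cong) auto
    ultimately show ?thesis by simp
  qed
  show ?thesis
  proof
    show "(\<lambda>\<omega>. ?d i \<omega> + lam / 2 ^ k) \<in> borel_measurable M" for i by measurable
    show "distr M borel (\<lambda>\<omega>. ?d i \<omega> + lam / 2 ^ k) = distr M borel (\<lambda>\<omega>. ?d 0 \<omega> + lam / 2 ^ k)" for i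
    proof -
      have e: "distr M borel (\<lambda>\<omega>. ?d i \<omega> + lam / 2 ^ k) = distr (distr M borel (?d i)) borel (\<lambda>x. x + lam / 2 ^ k)" for i
        by (subst distr_distr) (auto simp: comp_def simp del: of_nat_Suc)
      show ?thesis unfolding e law ..
    qed
    fix k0 n
    have "indep_vars (\<lambda>_. borel) (\<lambda>i \<omega>. B (real (k0 + Suc i) / 2 ^ k) \<omega> - B (real (k0 + i) / 2 ^ k) \<omega>) {..<n}"
      using bm unfolding standard_brownian_motion_def independent_increments_def
      by (elim conjE allE[of _ n] allE[of _ "\<lambda>i. real (k0 + i) / 2 ^ k"]) (auto simp: divide_strict_right_mono)
    then have "indep_vars (\<lambda>_. borel) (\<lambda>i \<omega>. (B (real (k0 + Suc i) / 2 ^ k) \<omega> - B (real (k0 + i) / 2 ^ k) \<omega>) + lam / 2 ^ k) {..<n}"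
      by (rule indep_vars_compose2) measurable
    then show "indep_vars (\<lambda>_. borel) (\<lambda>i \<omega>. ?d (k0 + i) \<omega> + lam / 2 ^ k) {..<n}" by simp
  qed (use assms in auto)
qed

section \<open>The exponential functional\<close>

lemma dyadic_refine: "m \<le> k \<Longrightarrow> real j / 2 ^ m = real (j * 2 ^ (k - m)) / 2 ^ k"
  by (auto dest!: le_Suc_ex simp: power_add)

text \<open>The integer time \<open>m\<close> is a grid point, so no cell is cut; beyond it both
  truncated endpoints coincide and the terms vanish.\<close>

lemma dyadic_integral_restrict:
  assumes "m \<le> k"
  shows "simple_integral (k * 2 ^ k) (\<lambda>i _. real i / 2 ^ k) h S (real m) \<omega>
    = (\<Sum>i<m * 2 ^ k. h i \<omega> * (S (real (Suc i) / 2 ^ k) \<omega> - S (real i / 2 ^ k) \<omega>))"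
  unfolding simple_integral_def
proof (rule sum.mono_neutral_cong_right)
  show "{..<m * 2 ^ k} \<subseteq> {..<k * 2 ^ k}"
    using mult_right_mono[OF assms, of "2 ^ k"] by (simp add: lessThan_subset_iff)
  show "\<forall>i\<in>{..<k * 2 ^ k} - {..<m * 2 ^ k}. h i \<omega> * (S (min (real (Suc i) / 2 ^ k) (real m)) \<omega> - S (min (real i / 2 ^ k) (real m)) \<omega>) = 0"
  proof
    fix i assume "i \<in> {..<k * 2 ^ k} - {..<m * 2 ^ k}"
    then have "real (m * 2 ^ k) \<le> real i" by (simp only: of_nat_le_iff) simp
    then have "real m \<le> real i / 2 ^ k" by (simp add: pos_le_divide_eq)
    moreover from this have "real m \<le> real (Suc i) / 2 ^ k"
      by (rule order_trans) (intro divide_right_mono, auto)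
    ultimately show "h i \<omega> * (S (min (real (Suc i) / 2 ^ k) (real m)) \<omega> - S (min (real i / 2 ^ k) (real m)) \<omega>) = 0"
      by (simp only: min_absorb2 diff_self mult_zero_right)
  qed
  fix i assume "i \<in> {..<m * 2 ^ k}"
  then have "real (Suc i) \<le> real (m * 2 ^ k)" by (simp only: of_nat_le_iff) simp
  then have "real (Suc i) / 2 ^ k \<le> real m" by (simp add: pos_divide_le_eq)
  moreover have "real i / 2 ^ k \<le> real (Suc i) / 2 ^ k" by (intro divide_right_mono) auto
  ultimately show "h i \<omega> * (S (min (real (Suc i) / 2 ^ k) (real m)) \<omega> - S (min (real i / 2 ^ k) (real m)) \<omega>)
      = h i \<omega> * (S (real (Suc i) / 2 ^ k) \<omega> - S (real i / 2 ^ k) \<omega>)"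
    by (simp add: min_def)
qed simp

text \<open>\<open>has_stochastic_integral\<close> covers every approximating sequence, so the
  dyadic one may be chosen, and its elementary integrals have an explicit characteristic
  function.\<close>

lemma exponential_integral_char:
  fixes B S :: "real \<Rightarrow> 'a \<Rightarrow> real" and Y :: "real \<Rightarrow> 'a \<Rightarrow> real"
  assumes M: "prob_space M" and bm: "standard_brownian_motion M B"
    and levy: "levy_process M S"
    and chr: "\<And>t z. 0 \<le> t \<Longrightarrow> char (distr M borel (S t)) z = complex_of_real (exp (- (c * t * \<bar>z\<bar> powr \<alpha>)))"
    and ind: "independent_processes M B S"
    and int: "has_stochastic_integral M (joint_natural_filtration M B S) (\<lambda>s \<omega>. exp (- (B s \<omega> + lam * s))) S Y"
  shows "(\<lambda>k. complex_of_real (LINT \<omega>|M. exp (- (c * \<bar>z\<bar> powr \<alpha> *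
      (1 / 2 ^ k * (\<Sum>i<m * 2 ^ k. exp (- (\<alpha> * (B (real i / 2 ^ k) \<omega> + lam * (real i / 2 ^ k)))))))))) \<longlonglongrightarrow> char (distr M borel (Y (real m))) z"
proof -
  interpret prob_space M by (rule M)
  define X where "X = (\<lambda>s \<omega>. exp (- (B s \<omega> + lam * s)))"
  let ?F = "joint_natural_filtration M B S"
  have Bm[measurable]: "B t \<in> borel_measurable M" if "0 \<le> t" for t using bm that by (auto simp: standard_brownian_motion_def)
  have Sm: "S t \<in> borel_measurable M" if "0 \<le> t" for t using levy that by (auto simp: levy_process_def)
  have Xm: "X t \<in> borel_measurable M" if "0 \<le> t" for t using Bm[OF that] unfolding X_def by measurable
  have Xcont: "AE \<omega> in M. continuous_on {0..} (\<lambda>t. X t \<omega>)"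
  proof -
    have "AE \<omega> in M. continuous_on {0..} (\<lambda>t. B t \<omega>)" using bm by (auto simp: standard_brownian_motion_def)
    then show ?thesis
    proof eventually_elim
      case (elim \<omega>)
      then show ?case unfolding X_def by (intro continuous_intros)
    qed
  qed
  have XF: "X t \<in> borel_measurable (?F t)" if "0 \<le> t" for t
    using joint_natural_measurable[OF that, of B M S] unfolding X_def by measurable
  have pred: "simple_predictable M ?F (k * 2 ^ k) (\<lambda>i _. real i / 2 ^ k) (X 0) (\<lambda>i. X (real i / 2 ^ k))" for k
    by (rule dyadic_simple_predictable[OF filtration_joint_natural XF])
  define I where "I k = simple_integral (k * 2 ^ k) (\<lambda>i _. real i / 2 ^ k) (\<lambda>i. X (real i / 2 ^ k)) S" for k
  have Ym: "Y t \<in> borel_measurable M" if "0 \<le> t" for t using int that by (auto simp: has_stochastic_integral_def)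
  have all: "\<forall>n T h0 h. (\<forall>k. simple_predictable M ?F (n k) (T k) (h0 k) (h k)) \<and>
        ucp_tendsto M (\<lambda>k. simple_process (n k) (T k) (h0 k) (h k)) X \<longrightarrow>
        ucp_tendsto M (\<lambda>k. simple_integral (n k) (T k) (h k) S) Y"
    using int unfolding has_stochastic_integral_def X_def by blast
  have ucp: "ucp_tendsto M I Y"
    using all[rule_format, of "\<lambda>k. k * 2 ^ k" "\<lambda>k i _. real i / 2 ^ k" "\<lambda>k. X 0" "\<lambda>k i. X (real i / 2 ^ k)"]
      pred dyadic_step_ucp[OF M Xm Xcont] unfolding I_def by simp
  have Im: "I k t \<in> borel_measurable M" if "0 \<le> t" for k t
    unfolding I_def simple_integral_def
    by (intro borel_measurable_sum borel_measurable_times borel_measurable_diff Xm Sm) (use that in auto)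
  have "(\<lambda>k. LINT \<omega>|M. iexp (z * I k (real m) \<omega>)) \<longlonglongrightarrow> (LINT \<omega>|M. iexp (z * Y (real m) \<omega>))"
    by (rule ucp_char_tendsto[OF M ucp]) (auto intro: Im Ym)
  moreover have "(LINT \<omega>|M. iexp (z * Y (real m) \<omega>)) = char (distr M borel (Y (real m))) z"
    unfolding char_def using Ym[of "real m"] by (subst integral_distr) auto
  moreover have "eventually (\<lambda>k. (LINT \<omega>|M. iexp (z * I k (real m) \<omega>)) = complex_of_real (LINT \<omega>|M. exp (- (c * \<bar>z\<bar> powr \<alpha> *
      (1 / 2 ^ k * (\<Sum>i<m * 2 ^ k. exp (- (\<alpha> * (B (real i / 2 ^ k) \<omega> + lam * (real i / 2 ^ k)))))))))) sequentially"
    using eventually_ge_at_top[of m]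
  proof eventually_elim
    case (elim k)
    have d: "real (Suc i) / 2 ^ k - real i / 2 ^ k = 1 / 2 ^ k" for i by (simp add: diff_divide_distrib[symmetric])
    have "(LINT \<omega>|M. iexp (z * I k (real m) \<omega>))
      = (LINT \<omega>|M. iexp (z * (\<Sum>i<m * 2 ^ k. exp (- (B (real i / 2 ^ k) \<omega> + lam * (real i / 2 ^ k))) * (S (real (Suc i) / 2 ^ k) \<omega> - S (real i / 2 ^ k) \<omega>))))"
      unfolding I_def dyadic_integral_restrict[OF elim] X_def ..
    also have "\<dots> = complex_of_real (LINT \<omega>|M. exp (- (c * \<bar>z\<bar> powr \<alpha> * (\<Sum>i<m * 2 ^ k. (real (Suc i) / 2 ^ k - real i / 2 ^ k) * exp (- (\<alpha> * (B (real i / 2 ^ k) \<omega> + lam * (real i / 2 ^ k))))))))"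
      by (rule char_elementary_integral[OF M levy chr Bm ind, where t = "\<lambda>i. real i / 2 ^ k"])
        (auto intro!: divide_strict_right_mono)
    finally show ?case unfolding d by (simp only: sum_distrib_left)
  qed
  ultimately show ?thesis by (simp add: tendsto_cong)
qed

text \<open>If \<open>\<xi>\<close> stayed below \<open>a\<close> forever with probability \<open>p\<close>, the exponential functional would be infinite
  on that event, so that \<open>L \<le> 1 - p\<close>.\<close>

lemma level_passage_prob:
  fixes \<xi> :: "real \<Rightarrow> 'a \<Rightarrow> real"
  assumes M: "prob_space M" and xm: "\<And>t. 0 \<le> t \<Longrightarrow> \<xi> t \<in> borel_measurable M" and al: "0 < \<alpha>"
    and lim_k: "\<And>m u. 0 < u \<Longrightarrow>
      (\<lambda>k. LINT \<omega>|M. exp (- (u * (1 / 2 ^ k * (\<Sum>i<m * 2 ^ k. exp (- (\<alpha> * \<xi> (real i / 2 ^ k) \<omega>))))))) \<longlonglongrightarrow> Lm m u"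
    and lim_m: "\<And>u. 0 < u \<Longrightarrow> (\<lambda>m. Lm m u) \<longlonglongrightarrow> L u"
    and L0: "(L \<longlongrightarrow> 1) (at_right 0)"
  shows "(\<lambda>m. measure M {\<omega>\<in>space M. \<forall>j\<le>m * 2 ^ m. \<xi> (real j / 2 ^ m) \<omega> < a}) \<longlonglongrightarrow> 0"
proof -
  interpret prob_space M by (rule M)
  \<comment> \<open>Horizon and mesh are refined together, so the events decrease; membership in
    \<open>E n\<close> controls every coarser grid up to time \<open>n\<close>.\<close>
  define E where "E m = {\<omega>\<in>space M. \<forall>j\<le>m * 2 ^ m. \<xi> (real j / 2 ^ m) \<omega> < a}" for m :: nat
  have xg[measurable]: "\<xi> (real j / 2 ^ m) \<in> borel_measurable M" for j m by (rule xm) simp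
  have Em[measurable]: "E m \<in> sets M" for m unfolding E_def by measurable
  have E_refine: "\<xi> (real j / 2 ^ k) \<omega> < a" if "\<omega> \<in> E n" "k \<le> n" "j \<le> n * 2 ^ k" for \<omega> j k n
  proof -
    have "j * 2 ^ (n - k) \<le> n * 2 ^ k * 2 ^ (n - k)" using that by (intro mult_right_mono) auto
    also have "\<dots> = n * 2 ^ n" using that(2) by (simp add: mult.assoc flip: power_add)
    finally show ?thesis using that(1) unfolding dyadic_refine[OF that(2)] E_def by blast
  qed
  have dec: "decseq E"
  proof (rule decseq_SucI)
    fix m show "E (Suc m) \<subseteq> E m"
    proof
      fix \<omega> assume w: "\<omega> \<in> E (Suc m)"
      have "\<xi> (real j / 2 ^ m) \<omega> < a" if "j \<le> m * 2 ^ m" for j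
        by (rule E_refine[OF w]) (use that in auto)
      then show "\<omega> \<in> E m" using w by (auto simp: E_def)
    qed
  qed
  define p where "p = prob (\<Inter>m. E m)"
  have lim: "(\<lambda>m. prob (E m)) \<longlonglongrightarrow> p"
    unfolding p_def by (rule finite_Lim_measure_decseq[OF _ dec]) auto
  have pm: "(\<Inter>m. E m) \<in> sets M" by (intro sets.countable_INT) auto
  have p0: "0 \<le> p" by (simp add: p_def)
  \<comment> \<open>Lower bound for each summand while the path is below \<open>a\<close>; on the
    intersection of the events the Riemann sum up to time \<open>m\<close> is at least
    \<open>q * real m\<close>.\<close>
  define q where "q = exp (- (\<alpha> * a))"
  have q: "0 < q" by (simp add: q_def)
  have bound: "(LINT \<omega>|M. exp (- (u * (1 / 2 ^ k * (\<Sum>i<m * 2 ^ k. exp (- (\<alpha> * \<xi> (real i / 2 ^ k) \<omega>))))))) \<le> 1 - p + exp (- (u * q * real m))"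
    if u: "0 < u" for u k m
  proof -
    have "(LINT \<omega>|M. exp (- (u * (1 / 2 ^ k * (\<Sum>i<m * 2 ^ k. exp (- (\<alpha> * \<xi> (real i / 2 ^ k) \<omega>)))))))
        \<le> (LINT \<omega>|M. indicator (space M - (\<Inter>m. E m)) \<omega> + exp (- (u * q * real m)))"
    proof (rule integral_mono)
      show "integrable M (\<lambda>\<omega>. exp (- (u * (1 / 2 ^ k * (\<Sum>i<m * 2 ^ k. exp (- (\<alpha> * \<xi> (real i / 2 ^ k) \<omega>)))))))"
        by (rule integrable_const_bound[where B = 1]) (use u in \<open>auto simp: sum_nonneg\<close>)
      show "integrable M (\<lambda>\<omega>. indicator (space M - (\<Inter>m. E m)) \<omega> + exp (- (u * q * real m)))"
        using pm by (intro Bochner_Integration.integrable_add integrable_real_indicator) (auto simp: emeasure_eq_measure)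
      fix \<omega> assume \<omega>: "\<omega> \<in> space M"
      show "exp (- (u * (1 / 2 ^ k * (\<Sum>i<m * 2 ^ k. exp (- (\<alpha> * \<xi> (real i / 2 ^ k) \<omega>))))))
          \<le> indicator (space M - (\<Inter>m. E m)) \<omega> + exp (- (u * q * real m))"
      proof (cases "\<omega> \<in> (\<Inter>m. E m)")
        case True
        have "q \<le> exp (- (\<alpha> * \<xi> (real i / 2 ^ k) \<omega>))" if "i < m * 2 ^ k" for i
        proof -
          have "i \<le> m * 2 ^ k" using that by simp
          \<comment> \<open>The index \<open>max m k\<close> makes the horizon at least
            \<open>m\<close> and the mesh at least as fine as that of level
            \<open>k\<close>.\<close>
          also have "\<dots> \<le> max m k * 2 ^ k" by (intro mult_right_mono) auto
          finally have "\<xi> (real i / 2 ^ k) \<omega> < a"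
            using True by (intro E_refine[of \<omega> "max m k"]) auto
          then show ?thesis using al by (simp add: q_def)
        qed
        then have "(\<Sum>i<m * 2 ^ k. q) \<le> (\<Sum>i<m * 2 ^ k. exp (- (\<alpha> * \<xi> (real i / 2 ^ k) \<omega>)))"
          by (intro sum_mono) auto
        then have "1 / 2 ^ k * (real m * 2 ^ k * q) \<le> 1 / 2 ^ k * (\<Sum>i<m * 2 ^ k. exp (- (\<alpha> * \<xi> (real i / 2 ^ k) \<omega>)))"
          by (intro mult_left_mono) auto
        then have "u * (real m * q) \<le> u * (1 / 2 ^ k * (\<Sum>i<m * 2 ^ k. exp (- (\<alpha> * \<xi> (real i / 2 ^ k) \<omega>))))"
          using u by (intro mult_left_mono) auto
        moreover have "u * (real m * q) = u * q * real m" by simp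
        ultimately have "exp (- (u * (1 / 2 ^ k * (\<Sum>i<m * 2 ^ k. exp (- (\<alpha> * \<xi> (real i / 2 ^ k) \<omega>)))))) \<le> exp (- (u * q * real m))"
          by simp
        then show ?thesis using True by (simp add: indicator_def)
      next
        case False
        have "exp (- (u * (1 / 2 ^ k * (\<Sum>i<m * 2 ^ k. exp (- (\<alpha> * \<xi> (real i / 2 ^ k) \<omega>)))))) \<le> 1"
          using u by (simp add: sum_nonneg)
        moreover have "indicator (space M - (\<Inter>m. E m)) \<omega> = (1 :: real)" using False \<omega> by simp
        ultimately show ?thesis by (simp add: add_increasing2)
      qed
    qed
    also have "\<dots> = prob (space M - (\<Inter>m. E m)) + exp (- (u * q * real m))"
      using pm by (subst Bochner_Integration.integral_add) (auto simp: prob_space emeasure_eq_measure intro!: integrable_real_indicator)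
    finally show ?thesis using prob_compl[OF pm] by (simp add: p_def)
  qed
  have "L u \<le> 1 - p" if u: "0 < u" for u
  proof -
    have Lm: "Lm m u \<le> 1 - p + exp (- (u * q * real m))" for m
      by (rule tendsto_upperbound[OF lim_k[OF u]]) (use bound[OF u] in auto)
    have uq: "0 < u * q" using u q by simp
    have "(\<lambda>m. 1 - p + exp (- (u * q * real m))) \<longlonglongrightarrow> 1 - p + 0"
    proof (intro tendsto_intros)
      have "filterlim (\<lambda>m. u * q * real m) at_top sequentially"
        by (rule filterlim_tendsto_pos_mult_at_top[OF tendsto_const uq filterlim_real_sequentially])
      then show "(\<lambda>m. exp (- (u * q * real m))) \<longlonglongrightarrow> 0"
        by (intro filterlim_compose[OF exp_at_bot] filterlim_compose[OF filterlim_uminus_at_bot_at_top])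
    qed
    then show ?thesis
      using LIMSEQ_le[OF lim_m[OF u]] Lm by fastforce
  qed
  then have "eventually (\<lambda>u. L u \<le> 1 - p) (at_right 0)"
    by (auto simp: eventually_at_filter)
  then have "1 \<le> 1 - p" by (intro tendsto_upperbound[OF L0]) auto
  then have "p = 0" using p0 by simp
  then show ?thesis using lim by (simp add: E_def)
qed

lemma exponential_integral_laplace:
  fixes B S :: "real \<Rightarrow> 'a \<Rightarrow> real" and Z :: "'a \<Rightarrow> real"
  assumes M: "prob_space M" and bm: "standard_brownian_motion M B"
    and levy: "levy_process M S"
    and chr: "\<And>t z. 0 \<le> t \<Longrightarrow> char (distr M borel (S t)) z = complex_of_real (exp (- (c * t * \<bar>z\<bar> powr \<alpha>)))"
    and al: "0 < \<alpha>" and c: "0 < c"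
    and ind: "independent_processes M B S"
    and Z: "has_improper_stochastic_integral M (joint_natural_filtration M B S) (\<lambda>s \<omega>. exp (- (B s \<omega> + lam * s))) S Z"
  shows "\<exists>L. is_laplace L \<and> (\<forall>z. z \<noteq> 0 \<longrightarrow> char (distr M borel Z) z = complex_of_real (L (c * \<bar>z\<bar> powr \<alpha>))) \<and>
    (\<forall>b. 0 < b \<longrightarrow> b < 1 \<longrightarrow> is_laplace (\<lambda>u. L u / L (b * u)))"
proof -
  interpret prob_space M by (rule M)
  have Bm: "B t \<in> borel_measurable M" if "0 \<le> t" for t using bm that by (auto simp: standard_brownian_motion_def)
  have B0: "AE \<omega> in M. B 0 \<omega> = 0" using bm by (auto simp: standard_brownian_motion_def)
  \<comment> \<open>Subtracting \<open>B 0\<close> makes the process start at 0 for every sample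
    point, so its grid values equal the partial sums of increments exactly and not just almost
    surely.\<close>
  define \<xi> where "\<xi> t \<omega> = B t \<omega> + lam * t - B 0 \<omega>" for t \<omega>
  have xm: "\<xi> t \<in> borel_measurable M" if "0 \<le> t" for t
    using Bm[OF that] Bm[of 0] unfolding \<xi>_def by measurable
  have xg[measurable]: "\<xi> (real j / 2 ^ k) \<in> borel_measurable M" for j k by (rule xm) simp
  have xcont: "AE \<omega> in M. continuous_on {0..} (\<lambda>t. \<xi> t \<omega>)"
  proof -
    have "AE \<omega> in M. continuous_on {0..} (\<lambda>t. B t \<omega>)" using bm by (auto simp: standard_brownian_motion_def)
    then show ?thesis
    proof eventually_elim
      case (elim \<omega>)
      then show ?case unfolding \<xi>_def by (intro continuous_intros)
    qed
  qed
  obtain Y where Y: "has_stochastic_integral M (joint_natural_filtration M B S) (\<lambda>s \<omega>. exp (- (B s \<omega> + lam * s))) S Y"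
    and YZ: "AE \<omega> in M. ((\<lambda>t. Y t \<omega>) \<longlongrightarrow> Z \<omega>) at_top" and Zm[measurable]: "Z \<in> borel_measurable M"
    using Z unfolding has_improper_stochastic_integral_def by blast
  have Ym[measurable]: "Y (real m) \<in> borel_measurable M" for m using Y by (auto simp: has_stochastic_integral_def)
  define ell where "ell k n u = (LINT \<omega>|M. exp (- (u * (1 / 2 ^ k * (\<Sum>i<n. exp (- (\<alpha> * \<xi> (real i / 2 ^ k) \<omega>)))))))" for k n :: nat and u :: real
  have ell_char: "(\<lambda>k. complex_of_real (ell k (m * 2 ^ k) (c * \<bar>z\<bar> powr \<alpha>))) \<longlonglongrightarrow> char (distr M borel (Y (real m))) z" for m z
  proof -
    have "ell k n u = (LINT \<omega>|M. exp (- (u * (1 / 2 ^ k * (\<Sum>i<n. exp (- (\<alpha> * (B (real i / 2 ^ k) \<omega> + lam * (real i / 2 ^ k)))))))))" for k n u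
      unfolding ell_def
    proof (rule integral_cong_AE)
      have [measurable]: "B (real j / 2 ^ k) \<in> borel_measurable M" for j by (rule Bm) simp
      show "(\<lambda>\<omega>. exp (- (u * (1 / 2 ^ k * (\<Sum>i<n. exp (- (\<alpha> * (B (real i / 2 ^ k) \<omega> + lam * (real i / 2 ^ k))))))))) \<in> borel_measurable M"
        by measurable
      show "AE \<omega> in M. exp (- (u * (1 / 2 ^ k * (\<Sum>i<n. exp (- (\<alpha> * \<xi> (real i / 2 ^ k) \<omega>))))))
          = exp (- (u * (1 / 2 ^ k * (\<Sum>i<n. exp (- (\<alpha> * (B (real i / 2 ^ k) \<omega> + lam * (real i / 2 ^ k))))))))"
        using B0 by eventually_elim (simp add: \<xi>_def)
    qed measurable
    then show ?thesis using exponential_integral_char[OF M bm levy chr ind Y] by simp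
  qed
  define Lm where "Lm m u = Re (char (distr M borel (Y (real m))) ((u / c) powr (1 / \<alpha>)))" for m u
  \<comment> \<open>The radius undoes \<open>u = c * \<bar>z\<bar> powr \<alpha>\<close>. The real
    part is harmless: for \<open>z \<noteq> 0\<close> the characteristic functions are limits of the
    real numbers \<open>ell\<close>, as used in \<open>charZ\<close>.\<close>
  define L where "L u = Re (char (distr M borel Z) ((u / c) powr (1 / \<alpha>)))" for u
  have radial: "c * \<bar>(u / c) powr (1 / \<alpha>)\<bar> powr \<alpha> = u" if "0 < u" for u
    using that al c by (simp add: powr_powr)
  have lim_k: "(\<lambda>k. ell k (m * 2 ^ k) u) \<longlonglongrightarrow> Lm m u" if "0 < u" for m u
    using tendsto_Re[OF ell_char[of m "(u / c) powr (1 / \<alpha>)"]] unfolding radial[OF that] Lm_def by simp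
  have char_lim: "(\<lambda>m. char (distr M borel (Y (real m))) z) \<longlonglongrightarrow> char (distr M borel Z) z" for z
  proof -
    have "(\<lambda>m. LINT \<omega>|M. iexp (z * Y (real m) \<omega>)) \<longlonglongrightarrow> (LINT \<omega>|M. iexp (z * Z \<omega>))"
    proof (rule integral_dominated_convergence[where w = "\<lambda>_. 1"])
      show "AE \<omega> in M. (\<lambda>m. iexp (z * Y (real m) \<omega>)) \<longlonglongrightarrow> iexp (z * Z \<omega>)"
        using YZ
      proof eventually_elim
        case (elim \<omega>)
        have "(\<lambda>m. Y (real m) \<omega>) \<longlonglongrightarrow> Z \<omega>" by (rule filterlim_compose[OF elim filterlim_real_sequentially])
        then show ?case by (intro tendsto_intros)
      qed
    qed auto
    then show ?thesis by (simp add: char_def integral_distr)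
  qed
  have lim_m: "(\<lambda>m. Lm m u) \<longlonglongrightarrow> L u" for u unfolding Lm_def L_def by (intro tendsto_Re char_lim)
  have charZ: "char (distr M borel Z) z = complex_of_real (L (c * \<bar>z\<bar> powr \<alpha>))" if z: "z \<noteq> 0" for z
  proof -
    have u: "0 < c * \<bar>z\<bar> powr \<alpha>" using z c by simp
    have "char (distr M borel (Y (real m))) z = complex_of_real (Lm m (c * \<bar>z\<bar> powr \<alpha>))" for m
      by (rule LIMSEQ_unique[OF ell_char tendsto_of_real[OF lim_k[OF u]]])
    then have "(\<lambda>m. complex_of_real (Lm m (c * \<bar>z\<bar> powr \<alpha>))) \<longlonglongrightarrow> char (distr M borel Z) z"
      using char_lim[of z] by simp
    then show ?thesis using LIMSEQ_unique[OF _ tendsto_of_real[OF lim_m]] by blast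
  qed
  have Lm_lap: "is_laplace (Lm m)" for m
  proof (rule is_laplace_limit[of "\<lambda>k. ell k (m * 2 ^ k)"])
    show "is_laplace (ell k (m * 2 ^ k))" for k
      by (rule is_laplaceI[OF M, where X = "\<lambda>\<omega>. 1 / 2 ^ k * (\<Sum>i<m * 2 ^ k. exp (- (\<alpha> * \<xi> (real i / 2 ^ k) \<omega>)))"])
        (auto simp: ell_def sum_nonneg)
    show "(Lm m \<longlongrightarrow> 1) (at_right 0)"
      unfolding Lm_def by (intro char_radial_at_0 real_distribution_distr al c) simp
  qed (rule lim_k)
  have L_lap: "is_laplace L"
  proof (rule is_laplace_limit[of Lm])
    show "(L \<longlongrightarrow> 1) (at_right 0)"
      unfolding L_def by (intro char_radial_at_0 real_distribution_distr al c) simp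
  qed (use Lm_lap lim_m in auto)
  have "is_laplace (\<lambda>u. L u / L (b * u))" if b: "0 < b" "b < 1" for b
  proof -
    \<comment> \<open>The level at which the weight \<open>exp (- (\<alpha> * a))\<close> of the
      path after passage equals \<open>b\<close>.\<close>
    define a where "a = - ln b / \<alpha>"
    have a: "0 < a" using b al ln_less_zero[OF b] by (simp add: a_def divide_neg_pos)
    have ba: "exp (- (\<alpha> * a)) = b" using b al by (simp add: a_def)
    define D where "D k i \<omega> = (B (real (Suc i) / 2 ^ k) \<omega> - B (real i / 2 ^ k) \<omega>) + lam / 2 ^ k" for k i \<omega>
    have walk: "(\<Sum>j<i. D k j \<omega>) = \<xi> (real i / 2 ^ k) \<omega>" for k i \<omega>
    proof -
      have "(\<Sum>j<i. B (real (Suc j) / 2 ^ k) \<omega> - B (real j / 2 ^ k) \<omega>) = B (real i / 2 ^ k) \<omega> - B (real 0 / 2 ^ k) \<omega>"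
        by (rule sum_lessThan_telescope)
      then show ?thesis unfolding D_def \<xi>_def by (simp add: sum.distrib)
    qed
    have inc: "D k j \<omega> = \<xi> (real (Suc j) / 2 ^ k) \<omega> - \<xi> (real j / 2 ^ k) \<omega>" for k j \<omega>
      unfolding walk[symmetric] by simp
    have "is_laplace (\<lambda>u. L u / L (exp (- (\<alpha> * a)) * u))"
    proof (rule laplace_quotient_of_walks[where M = M and D = D and h = "\<lambda>k. 1 / 2 ^ k" and Lm = Lm
          and \<delta> = "\<lambda>m. prob {\<omega>\<in>space M. \<forall>j\<le>m * 2 ^ m. \<xi> (real j / 2 ^ m) \<omega> < a}"])
      show "iid_walk M (D k) \<alpha> (1 / 2 ^ k) a" for k
        unfolding D_def[abs_def] by (rule brownian_grid_walk[OF M bm al a])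
      show "(\<lambda>k. LINT \<omega>|M. exp (- (u * (1 / 2 ^ k * (\<Sum>i<m * 2 ^ k. exp (- (\<alpha> * (\<Sum>j<i. D k j \<omega>)))))))) \<longlonglongrightarrow> Lm m u"
        if "0 < u" for m u using lim_k[OF that] unfolding walk ell_def .
      show "(\<lambda>m. Lm m u) \<longlonglongrightarrow> L u" for u by (rule lim_m)
      show "is_laplace L" by (rule L_lap)
      show "(\<lambda>m. prob {\<omega>\<in>space M. \<forall>j\<le>m * 2 ^ m. \<xi> (real j / 2 ^ m) \<omega> < a}) \<longlonglongrightarrow> 0"
        by (rule level_passage_prob[OF M xm al lim_k[unfolded ell_def] lim_m is_laplace_at_0[OF L_lap]])
      show "prob {\<omega>\<in>space M. \<forall>j\<le>m * 2 ^ k. (\<Sum>i<j. D k i \<omega>) < a} \<le> prob {\<omega>\<in>space M. \<forall>j\<le>m * 2 ^ m. \<xi> (real j / 2 ^ m) \<omega> < a}"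
        if mk: "m \<le> k" for m k
      proof (rule finite_measure_mono)
        show "{\<omega>\<in>space M. \<forall>j\<le>m * 2 ^ m. \<xi> (real j / 2 ^ m) \<omega> < a} \<in> sets M" by measurable
        show "{\<omega>\<in>space M. \<forall>j\<le>m * 2 ^ k. (\<Sum>i<j. D k i \<omega>) < a} \<subseteq> {\<omega>\<in>space M. \<forall>j\<le>m * 2 ^ m. \<xi> (real j / 2 ^ m) \<omega> < a}"
        proof safe
          fix \<omega> j assume w: "\<forall>j\<le>m * 2 ^ k. (\<Sum>i<j. D k i \<omega>) < a" and j: "j \<le> m * 2 ^ m"
          have "j * 2 ^ (k - m) \<le> m * 2 ^ m * 2 ^ (k - m)" using j by (intro mult_right_mono) auto
          also have "\<dots> = m * 2 ^ k" using mk by (simp add: mult.assoc flip: power_add)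
          finally show "\<xi> (real j / 2 ^ m) \<omega> < a" using w unfolding walk dyadic_refine[OF mk] by blast
        qed
      qed
      show "(\<lambda>k. prob {\<omega>\<in>space M. \<exists>j<m * 2 ^ k. \<epsilon> < \<bar>D k j \<omega>\<bar>}) \<longlonglongrightarrow> 0" if e: "0 < \<epsilon>" for m \<epsilon>
      \<comment> \<open>A grid increment of \<open>\<xi>\<close> is an oscillation over one mesh
        between rational times, so path continuity makes large steps, and with them large
        overshoots, unlikely.\<close>
      proof (rule real_tendsto_sandwich[OF _ _ tendsto_const oscillation_event_tendsto[OF M xm xcont e, where T = "real m"]])
        show "\<forall>\<^sub>F k in sequentially. prob {\<omega>\<in>space M. \<exists>j<m * 2 ^ k. \<epsilon> < \<bar>D k j \<omega>\<bar>} \<le> prob (oscillation_event M \<xi> (real m) \<epsilon> k)"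
        proof (intro always_eventually allI finite_measure_mono oscillation_event_sets[OF xm] subsetI)
          fix k \<omega> assume "\<omega> \<in> {\<omega>\<in>space M. \<exists>j<m * 2 ^ k. \<epsilon> < \<bar>D k j \<omega>\<bar>}"
          then obtain j where w: "\<omega> \<in> space M" and j: "j < m * 2 ^ k" "\<epsilon> < \<bar>D k j \<omega>\<bar>" by auto
          have "real (Suc j) \<le> real (m * 2 ^ k)" using j(1) by (subst of_nat_le_iff) simp
          then have j1: "real (Suc j) / 2 ^ k \<le> real m" by (simp add: pos_divide_le_eq)
          have j2: "real j / 2 ^ k \<le> real (Suc j) / 2 ^ k" by (intro divide_right_mono) auto
          have "real (Suc j) / 2 ^ k \<in> \<rat> \<inter> {0..real m}" using j1 rational_grid by auto
          moreover have "real j / 2 ^ k \<in> \<rat> \<inter> {0..real m}" using order_trans[OF j2 j1] rational_grid by auto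
          moreover have "\<bar>real (Suc j) / 2 ^ k - real j / 2 ^ k\<bar> \<le> 1 / 2 ^ k" by (simp add: diff_divide_distrib[symmetric])
          moreover have "\<epsilon> < \<bar>\<xi> (real (Suc j) / 2 ^ k) \<omega> - \<xi> (real j / 2 ^ k) \<omega>\<bar>" using j(2) unfolding inc .
          ultimately show "\<omega> \<in> oscillation_event M \<xi> (real m) \<epsilon> k"
            unfolding oscillation_event_def using w by blast
        qed
      qed (auto)
    qed
    then show ?thesis unfolding ba .
  qed
  then show ?thesis using L_lap charZ by blast
qed

theorem theorem4p1:
  fixes M :: "'a measure"
    and B S :: "real \<Rightarrow> 'a \<Rightarrow> real"
    and Z :: "'a \<Rightarrow> real"
    and \<alpha> lam :: real
  assumes "prob_space M"
    and "standard_brownian_motion M B"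
    and "lam > 0"
    and "0 < \<alpha>" and "\<alpha> \<le> 2"
    and "symmetric_stable_levy_process M \<alpha> S"
    and "independent_processes M B S"
    and "has_improper_stochastic_integral M (joint_natural_filtration M B S)
           (\<lambda>s \<omega>. exp (- (B s \<omega> + lam * s))) S Z"
  shows "type_G (distr M borel Z) \<and>
    (\<exists>\<nu>. variance_mixing_distribution (distr M borel Z) \<nu> \<and>
       infinitely_divisible \<nu> \<and> selfdecomposable \<nu>)"
proof -
  interpret prob_space M by fact
  obtain c where levy: "levy_process M S" and c: "0 < c"
    and chr: "\<And>t z. 0 \<le> t \<Longrightarrow> char (distr M borel (S t)) z = complex_of_real (exp (- (c * t * \<bar>z\<bar> powr \<alpha>)))"
    using assms(6) unfolding symmetric_stable_levy_process_def by blast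
  obtain L where L: "is_laplace L" "\<And>z. z \<noteq> 0 \<Longrightarrow> char (distr M borel Z) z = complex_of_real (L (c * \<bar>z\<bar> powr \<alpha>))"
    "\<And>b. 0 < b \<Longrightarrow> b < 1 \<Longrightarrow> is_laplace (\<lambda>u. L u / L (b * u))"
    using exponential_integral_laplace[OF assms(1,2) levy chr assms(4) c assms(7,8)] by blast
  have Sm: "S 1 \<in> borel_measurable M" using levy by (simp add: levy_process_def)
  have Zm: "Z \<in> borel_measurable M" using assms(8) by (simp add: has_improper_stochastic_integral_def)
  \<comment> \<open>The law of \<open>S 1\<close> is the symmetric stable law from which the
    positive stable law is built.\<close>
  obtain K where K: "0 < K" "is_laplace (\<lambda>u. exp (- (K * u powr (\<alpha> / 2))))"
    using positive_stable_laplace[OF real_distribution_distr[OF Sm] _ c assms(4,5)] chr[of 1] by auto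
  have "\<exists>\<nu>. variance_mixing_distribution (distr M borel Z) \<nu> \<and> infinitely_divisible \<nu> \<and> selfdecomposable \<nu>"
    by (rule stable_mixture[OF real_distribution_distr[OF Zm] L(2,1,3) c assms(4) K])
  then show ?thesis unfolding type_G_def by blast
qed

end
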